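(* If $C$ is a small category, then the classifying diagram $NC$ is a complete Segal space.
   Context: **Classifying diagram.** For a category $C$, $\mathrm{iso}\,C$ denotes its maximal subgroupoid, and $C^{[m]}$ the category of functors $[m]\to C$, where $[m]=\{0\to1\to\cdots\to m\}$. The classifying diagram $NC$ is the simplicial space with $(NC)_m=\mathrm{nerve}(\mathrm{iso}(C^{[m]}))$. **Simplicial spaces.** A "space" is a simplicial set; $\mathcal{S}$ is the category of simplicial sets. $\mathbf{\Delta}$ is the category with objects the categories $[n]$ and all functors. $s\mathcal{S}$ is the category of functors $X\colon\mathbf{\Delta}^{op}\to\mathcal{S}$, $[n]\mapsto X_n$. $\mathrm{Map}(X,Y)$ is the space whose $n$-simplices are the maps $X\times\Delta[n]\to Y$ ($\Delta[n]$ constant). $F(k)$ is $[n]\mapsto\mathbf{\Delta}([n],[k])$ (discrete), so $\mathrm{Map}(F(k),X)\cong X_k$. $\dot F(k)\subset F(k)$ is the largest subobject not containing the identity of $[k]$. $X$ is Reedy fibrant if $\mathrm{Map}(F(k),X)\to\mathrm{Map}(\dot F(k),X)$ is a Kan fibration for all $k\ge0$. **Segal spaces.** A Segal space is a Reedy fibrant simplicial space $W$ such that for all $k\ge2$ the map $\phi_k\colon W_k\to W_1\times_{W_0}\cdots\times_{W_0}W_1$ ($k$ factors; the limit of $W_1\xrightarrow{d_0}W_0\xleftarrow{d_1}W_1\xrightarrow{d_0}\cdots\xleftarrow{d_1}W_1$) induced by the maps $\alpha^i\colon[1]\to[k]$, $\alpha^i(j)=i+j$, $0\le i\le k-1$,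 is a weak equivalence. **Homotopy theory in a Segal space $W$.** $\mathrm{ob}\,W$ is the set of vertices of $W_0$. For $x_0,\dots,x_n\in\mathrm{ob}\,W$, $\mathrm{map}_W(x_0,\dots,x_n)$ is the fiber over $(x_0,\dots,x_n)$ of the map $W_n\to W_0^{n+1}$ given by the $n+1$ vertices; in particular $\mathrm{map}_W(x,y)$ is the fiber of $(d_1,d_0)\colon W_1\to W_0\times W_0$ over $(x,y)$. $\mathrm{id}_x=s_0x$. A composition of $f\in\mathrm{map}_W(x,y)$ and $g\in\mathrm{map}_W(y,z)$ is a lift $k\in\mathrm{map}_W(x,y,z)$ of $(g,f)$ along the trivial fibration $(d_0,d_2)\colon\mathrm{map}_W(x,y,z)\to\mathrm{map}_W(y,z)\times\mathrm{map}_W(x,y)$; its result is $d_1k\in\mathrm{map}_W(x,z)$ (well defined up to homotopy). The homotopy category $\mathrm{Ho}\,W$ has objects $\mathrm{ob}\,W$, morphisms $\pi_0\mathrm{map}_W(x,y)$, and this composition. A point $g\in\mathrm{map}_W(x,y)$ is a homotopy equivalence if its class is invertible in $\mathrm{Ho}\,W$. $W_{\mathrm{hoequiv}}\subseteq W_1$ is the union of those components whose points are homotopy equivalences; $s_0\colon W_0\to W_1$ factors through it. **Complete Segal spaces.** A complete Segal space is a Segal space $W$ such that $s_0\colon W_0\to W_{\mathrm{hoequiv}}$ is a weak equivalence. *)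

theory Defs
  imports "HOL-Homology.Simplices"
begin

section \<open>Categories\<close>

text \<open>Since \<open>Obj\<close> and \<open>Arr\<close> are sets, every category below is small. Composition is in the usual
  order: \<open>Comp C g f\<close> is \<open>g \<circ> f\<close>, meaningful when \<open>Cod C f = Dom C g\<close>.\<close>

record ('o, 'm) cat =
  Obj :: "'o set"
  Arr :: "'m set"
  Dom :: "'m \<Rightarrow> 'o"
  Cod :: "'m \<Rightarrow> 'o"
  Ident :: "'o \<Rightarrow> 'm"
  Comp :: "'m \<Rightarrow> 'm \<Rightarrow> 'm"

locale small_category =
  fixes C :: "('o, 'm) cat"
  assumes Dom_in_Obj: "f \<in> Arr C \<Longrightarrow> Dom C f \<in> Obj C"
    and Cod_in_Obj: "f \<in> Arr C \<Longrightarrow> Cod C f \<in> Obj C"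
    and Ident_in_Arr: "x \<in> Obj C \<Longrightarrow> Ident C x \<in> Arr C"
    and Dom_Ident: "x \<in> Obj C \<Longrightarrow> Dom C (Ident C x) = x"
    and Cod_Ident: "x \<in> Obj C \<Longrightarrow> Cod C (Ident C x) = x"
    and Comp_in_Arr:
      "\<lbrakk>f \<in> Arr C; g \<in> Arr C; Cod C f = Dom C g\<rbrakk> \<Longrightarrow> Comp C g f \<in> Arr C"
    and Dom_Comp:
      "\<lbrakk>f \<in> Arr C; g \<in> Arr C; Cod C f = Dom C g\<rbrakk> \<Longrightarrow> Dom C (Comp C g f) = Dom C f"
    and Cod_Comp:
      "\<lbrakk>f \<in> Arr C; g \<in> Arr C; Cod C f = Dom C g\<rbrakk> \<Longrightarrow> Cod C (Comp C g f) = Cod C g"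
    and Comp_Ident_right: "f \<in> Arr C \<Longrightarrow> Comp C f (Ident C (Dom C f)) = f"
    and Comp_Ident_left: "f \<in> Arr C \<Longrightarrow> Comp C (Ident C (Cod C f)) f = f"
    and Comp_assoc:
      "\<lbrakk>f \<in> Arr C; g \<in> Arr C; h \<in> Arr C; Cod C f = Dom C g; Cod C g = Dom C h\<rbrakk>
        \<Longrightarrow> Comp C h (Comp C g f) = Comp C (Comp C h g) f"

definition invertible_arrow :: "('o, 'm) cat \<Rightarrow> 'm \<Rightarrow> bool" where
  "invertible_arrow C f \<longleftrightarrow> f \<in> Arr C \<and>
     (\<exists>g \<in> Arr C. Dom C g = Cod C f \<and> Cod C g = Dom C f \<and>
        Comp C g f = Ident C (Dom C f) \<and> Comp C f g = Ident C (Cod C f))"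

definition iso_subgroupoid :: "('o, 'm) cat \<Rightarrow> ('o, 'm) cat" where
  "iso_subgroupoid C = C\<lparr>Arr := {f. invertible_arrow C f}\<rparr>"

text \<open>A functor is a pair (object map, arrow map); both are extensional, i.e. \<open>undefined\<close> off their
  domain, so that equality of functors is equality in the logic.\<close>

type_synonym ('o, 'm, 'p, 'n) functor_rep = "('o \<Rightarrow> 'p) \<times> ('m \<Rightarrow> 'n)"

definition functors :: "('o, 'm) cat \<Rightarrow> ('p, 'n) cat \<Rightarrow> ('o, 'm, 'p, 'n) functor_rep set" where
  "functors A B =
     {F. fst F \<in> Obj A \<rightarrow>\<^sub>E Obj B \<and> snd F \<in> Arr A \<rightarrow>\<^sub>E Arr B \<and>
         (\<forall>f \<in> Arr A. Dom B (snd F f) = fst F (Dom A f) \<and> Cod B (snd F f) = fst F (Cod A f)) \<and>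
         (\<forall>x \<in> Obj A. snd F (Ident A x) = Ident B (fst F x)) \<and>
         (\<forall>f \<in> Arr A. \<forall>g \<in> Arr A. Cod A f = Dom A g \<longrightarrow>
            snd F (Comp A g f) = Comp B (snd F g) (snd F f))}"

text \<open>The composite \<open>G \<circ> F\<close> of functors, where \<open>A\<close> is the source of \<open>F\<close>.\<close>

definition functor_comp ::
  "('o, 'm) cat \<Rightarrow> ('p, 'n, 'q, 'l) functor_rep \<Rightarrow> ('o, 'm, 'p, 'n) functor_rep
    \<Rightarrow> ('o, 'm, 'q, 'l) functor_rep" where
  "functor_comp A G F =
     (restrict (fst G \<circ> fst F) (Obj A), restrict (snd G \<circ> snd F) (Arr A))"

text \<open>The functor category \<open>B\<^sup>A\<close>. An arrow is a triple (source functor, target functor,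
  components of a natural transformation).\<close>

type_synonym ('o, 'm, 'p, 'n) nat_trans_rep =
  "('o, 'm, 'p, 'n) functor_rep \<times> ('o, 'm, 'p, 'n) functor_rep \<times> ('o \<Rightarrow> 'n)"

definition nat_transformations ::
  "('o, 'm) cat \<Rightarrow> ('p, 'n) cat \<Rightarrow> ('o, 'm, 'p, 'n) nat_trans_rep set" where
  "nat_transformations A B =
     {(F, G, \<eta>). F \<in> functors A B \<and> G \<in> functors A B \<and> \<eta> \<in> Obj A \<rightarrow>\<^sub>E Arr B \<and>
        (\<forall>x \<in> Obj A. Dom B (\<eta> x) = fst F x \<and> Cod B (\<eta> x) = fst G x) \<and>
        (\<forall>f \<in> Arr A. Comp B (snd G f) (\<eta> (Dom A f)) = Comp B (\<eta> (Cod A f)) (snd F f))}"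

definition functor_cat ::
  "('o, 'm) cat \<Rightarrow> ('p, 'n) cat
    \<Rightarrow> (('o, 'm, 'p, 'n) functor_rep, ('o, 'm, 'p, 'n) nat_trans_rep) cat" where
  "functor_cat A B =
     \<lparr>Obj = functors A B,
      Arr = nat_transformations A B,
      Dom = (\<lambda>(F, G, \<eta>). F),
      Cod = (\<lambda>(F, G, \<eta>). G),
      Ident = (\<lambda>F. (F, F, \<lambda>x\<in>Obj A. Ident B (fst F x))),
      Comp = (\<lambda>(G', H, \<tau>) (F, G, \<eta>). (F, H, \<lambda>x\<in>Obj A. Comp B (\<tau> x) (\<eta> x)))\<rparr>"

text \<open>For \<open>H : A' \<rightarrow> A\<close>, the functor \<open>B\<^sup>A \<rightarrow> B\<^sup>A\<^sup>'\<close> given by precomposition with \<open>H\<close>. It restricts to the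
  maximal subgroupoids.\<close>

definition precomp_functor ::
  "('r, 's) cat \<Rightarrow> ('o, 'm) cat \<Rightarrow> ('p, 'n) cat \<Rightarrow> ('r, 's, 'o, 'm) functor_rep
    \<Rightarrow> (('o, 'm, 'p, 'n) functor_rep, ('o, 'm, 'p, 'n) nat_trans_rep,
        ('r, 's, 'p, 'n) functor_rep, ('r, 's, 'p, 'n) nat_trans_rep) functor_rep" where
  "precomp_functor A' A B H =
     (\<lambda>F\<in>functors A B. functor_comp A' F H,
      \<lambda>(F, G, \<eta>)\<in>nat_transformations A B.
        (functor_comp A' F H, functor_comp A' G H, \<lambda>x\<in>Obj A'. \<eta> (fst H x)))"

text \<open>The category \<open>[n] = {0 \<rightarrow> 1 \<rightarrow> \<dots> \<rightarrow> n}\<close>; its unique arrow \<open>i \<rightarrow> j\<close> is the pair \<open>(i, j)\<close>.\<close>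

definition ordinal :: "nat \<Rightarrow> (nat, nat \<times> nat) cat" where
  "ordinal n =
     \<lparr>Obj = {..n},
      Arr = {(i, j). i \<le> j \<and> j \<le> n},
      Dom = fst,
      Cod = snd,
      Ident = (\<lambda>i. (i, i)),
      Comp = (\<lambda>g f. (fst f, snd g))\<rparr>"

text \<open>A functor \<open>[m] \<rightarrow> [n]\<close> is determined by its object map, which can be any order-preserving
  map, so the morphisms of the category \<open>\<Delta>\<close> are taken to be the latter. \<open>mono_functor\<close> gives back
  the functor.\<close>

definition Delta :: "nat \<Rightarrow> nat \<Rightarrow> (nat \<Rightarrow> nat) set" where
  "Delta m n = {\<theta> \<in> {..m} \<rightarrow>\<^sub>E {..n}. mono_on {..m} \<theta>}"

definition mono_functor :: "nat \<Rightarrow> (nat \<Rightarrow> nat) \<Rightarrow> (nat, nat \<times> nat, nat, nat \<times> nat) functor_rep"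
  where
  "mono_functor m \<theta> = (restrict \<theta> {..m}, \<lambda>(i, j)\<in>Arr (ordinal m). (\<theta> i, \<theta> j))"

section \<open>Simplicial sets\<close>

text \<open>For \<open>\<theta> \<in> Delta m n\<close>, the map \<open>X\<^sub>n \<rightarrow> X\<^sub>m\<close> induced by \<open>\<theta>\<close> is \<open>act X m n \<theta>\<close>.\<close>

record 'a sset =
  cells :: "nat \<Rightarrow> 'a set"
  act :: "nat \<Rightarrow> nat \<Rightarrow> (nat \<Rightarrow> nat) \<Rightarrow> 'a \<Rightarrow> 'a"

definition simplicial_set :: "'a sset \<Rightarrow> bool" where
  "simplicial_set X \<longleftrightarrow>
     (\<forall>m n. \<forall>\<theta> \<in> Delta m n. act X m n \<theta> \<in> cells X n \<rightarrow> cells X m) \<and>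
     (\<forall>n. \<forall>x \<in> cells X n. act X n n (restrict id {..n}) x = x) \<and>
     (\<forall>l m n. \<forall>\<theta> \<in> Delta l m. \<forall>\<psi> \<in> Delta m n. \<forall>x \<in> cells X n.
        act X l n (compose {..l} \<psi> \<theta>) x = act X l m \<theta> (act X m n \<psi> x))"

definition simplicial_map :: "'a sset \<Rightarrow> 'b sset \<Rightarrow> (nat \<Rightarrow> 'a \<Rightarrow> 'b) \<Rightarrow> bool" where
  "simplicial_map X Y f \<longleftrightarrow>
     (\<forall>n. f n \<in> cells X n \<rightarrow> cells Y n) \<and>
     (\<forall>m n. \<forall>\<theta> \<in> Delta m n. \<forall>x \<in> cells X n. f m (act X m n \<theta> x) = act Y m n \<theta> (f n x))"

definition discrete_sset :: "'a set \<Rightarrow> 'a sset" where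
  "discrete_sset A = \<lparr>cells = (\<lambda>_. A), act = (\<lambda>_ _ _ x. x)\<rparr>"

definition std_simplex :: "nat \<Rightarrow> (nat \<Rightarrow> nat) sset" where
  "std_simplex n = \<lparr>cells = (\<lambda>m. Delta m n), act = (\<lambda>l m \<theta> \<sigma>. compose {..l} \<sigma> \<theta>)\<rparr>"

definition horn :: "nat \<Rightarrow> nat \<Rightarrow> (nat \<Rightarrow> nat) sset" where
  "horn n k = (std_simplex n)
     \<lparr>cells := (\<lambda>m. {\<sigma> \<in> Delta m n. \<exists>j \<in> {..n} - {k}. j \<notin> \<sigma> ` {..m}})\<rparr>"

definition prod_sset :: "'a sset \<Rightarrow> 'b sset \<Rightarrow> ('a \<times> 'b) sset" where
  "prod_sset X Y =
     \<lparr>cells = (\<lambda>n. cells X n \<times> cells Y n),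
      act = (\<lambda>m n \<theta> (x, y). (act X m n \<theta> x, act Y m n \<theta> y))\<rparr>"

definition nerve :: "('o, 'm) cat \<Rightarrow> (nat, nat \<times> nat, 'o, 'm) functor_rep sset" where
  "nerve C =
     \<lparr>cells = (\<lambda>n. functors (ordinal n) C),
      act = (\<lambda>m n \<theta> F. functor_comp (ordinal m) F (mono_functor m \<theta>))\<rparr>"

definition nerve_map ::
  "('o, 'm, 'p, 'n) functor_rep \<Rightarrow> nat
    \<Rightarrow> (nat, nat \<times> nat, 'o, 'm) functor_rep \<Rightarrow> (nat, nat \<times> nat, 'p, 'n) functor_rep" where
  "nerve_map G n F = functor_comp (ordinal n) G F"

definition kan_fibration :: "'a sset \<Rightarrow> 'b sset \<Rightarrow> (nat \<Rightarrow> 'a \<Rightarrow> 'b) \<Rightarrow> bool" where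
  "kan_fibration X Y p \<longleftrightarrow> simplicial_map X Y p \<and>
     (\<forall>n \<ge> 1. \<forall>k \<le> n. \<forall>u v.
        simplicial_map (horn n k) X u \<and> simplicial_map (std_simplex n) Y v \<and>
        (\<forall>m. \<forall>\<sigma> \<in> cells (horn n k) m. p m (u m \<sigma>) = v m \<sigma>) \<longrightarrow>
        (\<exists>w. simplicial_map (std_simplex n) X w \<and>
             (\<forall>m. \<forall>\<sigma> \<in> cells (horn n k) m. w m \<sigma> = u m \<sigma>) \<and>
             (\<forall>m. \<forall>\<sigma> \<in> cells (std_simplex n) m. p m (w m \<sigma>) = v m \<sigma>)))"

subsection \<open>Path components\<close>

definition vert :: "nat \<Rightarrow> nat \<Rightarrow> nat" where
  "vert i = (\<lambda>j\<in>{..0}. i)"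

definition joined :: "'a sset \<Rightarrow> ('a \<times> 'a) set" where
  "joined X =
     (let E = {(act X 0 1 (vert 0) e, act X 0 1 (vert 1) e) |e. e \<in> cells X 1}
      in (E \<union> E\<inverse>)\<^sup>* \<inter> cells X 0 \<times> cells X 0)"

definition pi0 :: "'a sset \<Rightarrow> 'a set set" where
  "pi0 X = cells X 0 // joined X"

definition pi0_class :: "'a sset \<Rightarrow> 'a \<Rightarrow> 'a set" where
  "pi0_class X x = joined X `` {x}"

subsection \<open>Geometric realization and weak equivalences\<close>

text \<open>The affine map of topological simplices induced by \<open>\<theta> : [m] \<rightarrow> [n]\<close>.\<close>

definition simplex_push :: "nat \<Rightarrow> (nat \<Rightarrow> nat) \<Rightarrow> (nat \<Rightarrow> real) \<Rightarrow> (nat \<Rightarrow> real)" where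
  "simplex_push m \<theta> t = (\<lambda>j. \<Sum>i | i \<le> m \<and> \<theta> i = j. t i)"

text \<open>The disjoint union over \<open>n\<close> and \<open>x \<in> X\<^sub>n\<close> of topological \<open>n\<close>-simplices; its points are
  \<open>((n, x), t)\<close>.\<close>

definition simplex_sum :: "'a sset \<Rightarrow> ((nat \<times> 'a) \<times> (nat \<Rightarrow> real)) topology" where
  "simplex_sum X =
     sum_topology (\<lambda>(n, x). subtopology (powertop_real UNIV) (standard_simplex n))
       (Sigma UNIV (cells X))"

definition realization_rel ::
  "'a sset \<Rightarrow> (((nat \<times> 'a) \<times> (nat \<Rightarrow> real)) \<times> ((nat \<times> 'a) \<times> (nat \<Rightarrow> real))) set" where
  "realization_rel X =
     (let R = {(((m, act X m n \<theta> x), t), ((n, x), simplex_push m \<theta> t)) |m n \<theta> x t.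
                 \<theta> \<in> Delta m n \<and> x \<in> cells X n \<and> t \<in> standard_simplex m}
      in (R \<union> R\<inverse>)\<^sup>* \<inter> topspace (simplex_sum X) \<times> topspace (simplex_sum X))"

definition quotient_topology :: "'a topology \<Rightarrow> ('a \<times> 'a) set \<Rightarrow> 'a set topology" where
  "quotient_topology T r = topology (\<lambda>U. U \<subseteq> topspace T // r \<and> openin T (\<Union>U))"

definition realization :: "'a sset \<Rightarrow> ((nat \<times> 'a) \<times> (nat \<Rightarrow> real)) set topology" where
  "realization X = quotient_topology (simplex_sum X) (realization_rel X)"

definition realization_map ::
  "'b sset \<Rightarrow> (nat \<Rightarrow> 'a \<Rightarrow> 'b) \<Rightarrow> ((nat \<times> 'a) \<times> (nat \<Rightarrow> real)) set
    \<Rightarrow> ((nat \<times> 'b) \<times> (nat \<Rightarrow> real)) set" where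
  "realization_map Y f c = realization_rel Y `` ((\<lambda>((n, x), t). ((n, f n x), t)) ` c)"

definition homotopy_equivalence :: "'a topology \<Rightarrow> 'b topology \<Rightarrow> ('a \<Rightarrow> 'b) \<Rightarrow> bool" where
  "homotopy_equivalence S T f \<longleftrightarrow> continuous_map S T f \<and>
     (\<exists>g. continuous_map T S g \<and>
        homotopic_with (\<lambda>_. True) S S (g \<circ> f) id \<and>
        homotopic_with (\<lambda>_. True) T T (f \<circ> g) id)"

text \<open>Quillen's definition: a map of simplicial sets is a weak equivalence if its geometric
  realization is a homotopy equivalence. As realizations are CW complexes, asking for a weak
  homotopy equivalence gives the same notion (Whitehead's theorem).\<close>

definition weak_equivalence :: "'a sset \<Rightarrow> 'b sset \<Rightarrow> (nat \<Rightarrow> 'a \<Rightarrow> 'b) \<Rightarrow> bool" where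
  "weak_equivalence X Y f \<longleftrightarrow> simplicial_map X Y f \<and>
     homotopy_equivalence (realization X) (realization Y) (realization_map Y f)"

section \<open>Simplicial spaces\<close>

text \<open>For \<open>\<theta> \<in> Delta m n\<close>, the induced map of spaces \<open>X\<^sub>n \<rightarrow> X\<^sub>m\<close> is \<open>oper X m n \<theta>\<close>; its first
  argument is the internal degree of a simplex of the space \<open>X\<^sub>n\<close>.\<close>

record 'a sspace =
  space_at :: "nat \<Rightarrow> 'a sset"
  oper :: "nat \<Rightarrow> nat \<Rightarrow> (nat \<Rightarrow> nat) \<Rightarrow> nat \<Rightarrow> 'a \<Rightarrow> 'a"

definition simplicial_space :: "'a sspace \<Rightarrow> bool" where
  "simplicial_space X \<longleftrightarrow>
     (\<forall>n. simplicial_set (space_at X n)) \<and>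
     (\<forall>m n. \<forall>\<theta> \<in> Delta m n. simplicial_map (space_at X n) (space_at X m) (oper X m n \<theta>)) \<and>
     (\<forall>n p. \<forall>x \<in> cells (space_at X n) p. oper X n n (restrict id {..n}) p x = x) \<and>
     (\<forall>l m n. \<forall>\<theta> \<in> Delta l m. \<forall>\<psi> \<in> Delta m n. \<forall>p. \<forall>x \<in> cells (space_at X n) p.
        oper X l n (compose {..l} \<psi> \<theta>) p x = oper X l m \<theta> p (oper X m n \<psi> p x))"

text \<open>Maps of simplicial spaces, extensional so that \<open>Map(X, Y)\<close> below has the right simplices.\<close>

definition sspace_maps :: "'a sspace \<Rightarrow> 'b sspace \<Rightarrow> (nat \<Rightarrow> nat \<Rightarrow> 'a \<Rightarrow> 'b) set" where
  "sspace_maps X Y =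
     {f. (\<forall>n. simplicial_map (space_at X n) (space_at Y n) (f n)) \<and>
         (\<forall>n p. f n p \<in> extensional (cells (space_at X n) p)) \<and>
         (\<forall>m n. \<forall>\<theta> \<in> Delta m n. \<forall>p. \<forall>x \<in> cells (space_at X n) p.
            f m p (oper X m n \<theta> p x) = oper Y m n \<theta> p (f n p x))}"

definition const_sspace :: "'a sset \<Rightarrow> 'a sspace" where
  "const_sspace K = \<lparr>space_at = (\<lambda>_. K), oper = (\<lambda>_ _ _ _ x. x)\<rparr>"

definition prod_sspace :: "'a sspace \<Rightarrow> 'b sspace \<Rightarrow> ('a \<times> 'b) sspace" where
  "prod_sspace X Y =
     \<lparr>space_at = (\<lambda>n. prod_sset (space_at X n) (space_at Y n)),
      oper = (\<lambda>m n \<theta> p (x, y). (oper X m n \<theta> p x, oper Y m n \<theta> p y))\<rparr>"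

definition map_space ::
  "'a sspace \<Rightarrow> 'b sspace \<Rightarrow> (nat \<Rightarrow> nat \<Rightarrow> 'a \<times> (nat \<Rightarrow> nat) \<Rightarrow> 'b) sset" where
  "map_space X Y =
     \<lparr>cells = (\<lambda>n. sspace_maps (prod_sspace X (const_sspace (std_simplex n))) Y),
      act = (\<lambda>m n \<theta> f i p. \<lambda>(x, \<sigma>)\<in>cells (space_at X i) p \<times> Delta p m.
               f i p (x, compose {..p} \<theta> \<sigma>))\<rparr>"

definition subspace_of :: "'a sspace \<Rightarrow> (nat \<Rightarrow> nat \<Rightarrow> 'a set) \<Rightarrow> 'a sspace" where
  "subspace_of X S = X\<lparr>space_at := (\<lambda>n. (space_at X n)\<lparr>cells := S n\<rparr>)\<rparr>"

definition subobject :: "'a sspace \<Rightarrow> (nat \<Rightarrow> nat \<Rightarrow> 'a set) \<Rightarrow> bool" where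
  "subobject X S \<longleftrightarrow>
     (\<forall>n p. S n p \<subseteq> cells (space_at X n) p) \<and> simplicial_space (subspace_of X S)"

text \<open>The map \<open>Map(X, Y) \<rightarrow> Map(A, Y)\<close> induced by the inclusion of a subobject \<open>A\<close> of \<open>X\<close>.\<close>

definition map_restrict ::
  "'a sspace \<Rightarrow> nat \<Rightarrow> (nat \<Rightarrow> nat \<Rightarrow> 'a \<times> (nat \<Rightarrow> nat) \<Rightarrow> 'b)
    \<Rightarrow> (nat \<Rightarrow> nat \<Rightarrow> 'a \<times> (nat \<Rightarrow> nat) \<Rightarrow> 'b)" where
  "map_restrict A n f = (\<lambda>i p. restrict (f i p) (cells (space_at A i) p \<times> Delta p n))"

definition rep_F :: "nat \<Rightarrow> (nat \<Rightarrow> nat) sspace" where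
  "rep_F k =
     \<lparr>space_at = (\<lambda>n. discrete_sset (Delta n k)),
      oper = (\<lambda>m n \<theta> p \<psi>. compose {..m} \<psi> \<theta>)\<rparr>"

text \<open>A union of subobjects not containing the identity of \<open>[k]\<close> is again one, so the largest one
  is the union of all of them.\<close>

definition rep_F_dot :: "nat \<Rightarrow> (nat \<Rightarrow> nat) sspace" where
  "rep_F_dot k = subspace_of (rep_F k)
     (\<lambda>n p. \<Union>{S n p |S. subobject (rep_F k) S \<and> (\<forall>q. restrict id {..k} \<notin> S k q)})"

definition reedy_fibrant :: "'a sspace \<Rightarrow> bool" where
  "reedy_fibrant X \<longleftrightarrow>
     (\<forall>k. kan_fibration (map_space (rep_F k) X) (map_space (rep_F_dot k) X)
            (map_restrict (rep_F_dot k)))"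

section \<open>Segal spaces\<close>

definition coface :: "nat \<Rightarrow> nat \<Rightarrow> nat \<Rightarrow> nat" where
  "coface n i = (\<lambda>j\<in>{..n}. if j < i then j else Suc j)"

definition codegeneracy :: "nat \<Rightarrow> nat \<Rightarrow> nat \<Rightarrow> nat" where
  "codegeneracy n i = (\<lambda>j\<in>{..Suc n}. if j \<le> i then j else j - 1)"

text \<open>\<open>face W n i\<close> is \<open>d\<^sub>i : W\<^sub>n\<^sub>+\<^sub>1 \<rightarrow> W\<^sub>n\<close>, and \<open>degen W n i\<close> is \<open>s\<^sub>i : W\<^sub>n \<rightarrow> W\<^sub>n\<^sub>+\<^sub>1\<close>.\<close>

definition face :: "'a sspace \<Rightarrow> nat \<Rightarrow> nat \<Rightarrow> nat \<Rightarrow> 'a \<Rightarrow> 'a" where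
  "face W n i = oper W n (Suc n) (coface n i)"

definition degen :: "'a sspace \<Rightarrow> nat \<Rightarrow> nat \<Rightarrow> nat \<Rightarrow> 'a \<Rightarrow> 'a" where
  "degen W n i = oper W (Suc n) n (codegeneracy n i)"

definition segal_product :: "'a sspace \<Rightarrow> nat \<Rightarrow> (nat \<Rightarrow> 'a) sset" where
  "segal_product W k =
     \<lparr>cells = (\<lambda>p. {f \<in> {..<k} \<rightarrow>\<^sub>E cells (space_at W 1) p.
                     \<forall>i. Suc i < k \<longrightarrow> face W 0 0 p (f i) = face W 0 1 p (f (Suc i))}),
      act = (\<lambda>p q \<theta> f. \<lambda>i\<in>{..<k}. act (space_at W 1) p q \<theta> (f i))\<rparr>"

definition segal_map :: "'a sspace \<Rightarrow> nat \<Rightarrow> nat \<Rightarrow> 'a \<Rightarrow> nat \<Rightarrow> 'a" where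
  "segal_map W k p w = (\<lambda>i\<in>{..<k}. oper W 1 k (\<lambda>j\<in>{..1}. i + j) p w)"

definition segal_space :: "'a sspace \<Rightarrow> bool" where
  "segal_space W \<longleftrightarrow> simplicial_space W \<and> reedy_fibrant W \<and>
     (\<forall>k \<ge> 2. weak_equivalence (space_at W k) (segal_product W k) (segal_map W k))"

section \<open>The homotopy category of a Segal space\<close>

definition ob :: "'a sspace \<Rightarrow> 'a set" where
  "ob W = cells (space_at W 0) 0"

text \<open>\<open>mapping_space W [x\<^sub>0, \<dots>, x\<^sub>n]\<close> is the fiber of \<open>W\<^sub>n \<rightarrow> W\<^sub>0\<^sup>n\<^sup>+\<^sup>1\<close> over \<open>(x\<^sub>0, \<dots>, x\<^sub>n)\<close>: a
  \<open>p\<close>-simplex lies in it if its \<open>i\<close>-th vertex is the degenerate \<open>p\<close>-simplex of \<open>W\<^sub>0\<close> on \<open>x\<^sub>i\<close>.\<close>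

definition mapping_space :: "'a sspace \<Rightarrow> 'a list \<Rightarrow> 'a sset" where
  "mapping_space W xs = (space_at W (length xs - 1))
     \<lparr>cells := (\<lambda>p. {w \<in> cells (space_at W (length xs - 1)) p.
        \<forall>i < length xs. oper W 0 (length xs - 1) (vert i) p w =
          act (space_at W 0) p 0 (\<lambda>j\<in>{..p}. 0) (xs ! i)})\<rparr>"

definition is_composition ::
  "'a sspace \<Rightarrow> 'a \<Rightarrow> 'a \<Rightarrow> 'a \<Rightarrow> 'a \<Rightarrow> 'a \<Rightarrow> 'a \<Rightarrow> bool" where
  "is_composition W x y z g f k \<longleftrightarrow>
     k \<in> cells (mapping_space W [x, y, z]) 0 \<and> face W 1 0 0 k = g \<and> face W 1 2 0 k = f"

text \<open>An arrow \<open>x \<rightarrow> y\<close> is a triple \<open>(x, y, c)\<close> with \<open>c \<in> \<pi>\<^sub>0 map\<^sub>W(x, y)\<close>. Compositions are well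
  defined up to homotopy in a Segal space, so the set of all points homotopic to a result of a
  composition of representatives is a single component.\<close>

definition Ho :: "'a sspace \<Rightarrow> ('a, 'a \<times> 'a \<times> 'a set) cat" where
  "Ho W =
     \<lparr>Obj = ob W,
      Arr = {(x, y, c). x \<in> ob W \<and> y \<in> ob W \<and> c \<in> pi0 (mapping_space W [x, y])},
      Dom = (\<lambda>(x, y, c). x),
      Cod = (\<lambda>(x, y, c). y),
      Ident = (\<lambda>x. (x, x, pi0_class (mapping_space W [x, x]) (degen W 0 0 0 x))),
      Comp = (\<lambda>(y', z, b) (x, y, a). (x, z,
        \<Union>{pi0_class (mapping_space W [x, z]) (face W 1 1 0 k) |k f g.
            f \<in> a \<and> g \<in> b \<and> is_composition W x y z g f k}))\<rparr>"

definition homotopy_equiv_point :: "'a sspace \<Rightarrow> 'a \<Rightarrow> bool" where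
  "homotopy_equiv_point W g \<longleftrightarrow> g \<in> cells (space_at W 1) 0 \<and>
     (let x = face W 0 1 0 g; y = face W 0 0 0 g
      in invertible_arrow (Ho W) (x, y, pi0_class (mapping_space W [x, y]) g))"

definition hoequiv_space :: "'a sspace \<Rightarrow> 'a sset" where
  "hoequiv_space W = (space_at W 1)
     \<lparr>cells := (\<lambda>p. {w \<in> cells (space_at W 1) p. \<exists>c \<in> pi0 (space_at W 1).
        (\<forall>g \<in> c. homotopy_equiv_point W g) \<and> act (space_at W 1) 0 p (vert 0) w \<in> c})\<rparr>"

definition complete_segal_space :: "'a sspace \<Rightarrow> bool" where
  "complete_segal_space W \<longleftrightarrow> segal_space W \<and>
     weak_equivalence (space_at W 0) (hoequiv_space W) (degen W 0 0)"

section \<open>The classifying diagram\<close>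

definition classifying_diagram ::
  "('o, 'm) cat \<Rightarrow>
     (nat, nat \<times> nat, (nat, nat \<times> nat, 'o, 'm) functor_rep,
       (nat, nat \<times> nat, 'o, 'm) nat_trans_rep) functor_rep sspace" where
  "classifying_diagram C =
     \<lparr>space_at = (\<lambda>m. nerve (iso_subgroupoid (functor_cat (ordinal m) C))),
      oper = (\<lambda>m n \<theta>.
        nerve_map (precomp_functor (ordinal m) (ordinal n) C (mono_functor m \<theta>)))\<rparr>"

end

theory Submission
  imports Defs "HOL-Analysis.Abstract_Topological_Spaces" "HOL-Analysis.Homotopy"
begin

text \<open>A \<open>p\<close>-simplex of \<open>(NC)\<^sub>m\<close> is a diagram on the grid \<open>[p] \<times> [m]\<close> in \<open>C\<close> whose arrows in the \<open>[p]\<close>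
  direction are isomorphisms. Such a diagram is determined by its arrows in the \<open>[p]\<close> direction together
  with a single copy of \<open>[m]\<close>, along which everything else is transported by conjugation.

  For Reedy fibrancy in degree \<open>k \<ge> 1\<close> the boundary data contain all arrows in the \<open>[p]\<close> direction, so the
  filler of a horn is obtained by transporting the diagram at the horn vertex, and it is unique; in degree
  \<open>0\<close> the filler is the classical one for the nerve of a groupoid. The Segal maps are isomorphisms.
  Since mapping spaces are discrete, the homotopy category is isomorphic to \<open>C\<close>, so the homotopy equivalences are
  the isomorphisms of \<open>C\<close>, and \<open>s\<^sub>0\<close> has the homotopy inverse \<open>d\<^sub>1\<close>. In a groupoid a natural
  isomorphism \<open>F \<Rightarrow> G\<close> turns an \<open>n\<close>-simplex into one \<open>(2n + 1)\<close>-simplex, with \<open>F\<close> on its front and \<open>G\<close>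
  on its back face. This makes the homotopy of realizations linear, namely \<open>((1 - s) t, s t)\<close> on the
  coordinates \<open>t\<close>, so no decomposition of prisms is needed.\<close>

section \<open>Homotopies of realizations\<close>

text \<open>Weak equivalence means homotopy equivalence of realizations, so explicit inverses and
  homotopies are needed. A homotopy lives on the product of \<open>[0, 1]\<close> with a quotient
  space; as the interval is locally compact and Hausdorff, this product is again a quotient, and the
  homotopy may be written simplex by simplex. It then has to respect the operators, and doubling
  turns each \<open>\<theta>\<close> into \<open>\<theta>\<close> on two blocks.

  In a doubled simplex all front vertices precede all back vertices, so the step from the last front
  vertex to the first back vertex runs against the order of the original simplex. The invertibility
  of the arrows in the \<open>[p]\<close> direction provides it.

  Bookkeeping is kept low by recording all arrows between comparable grid points: an operator in
  either direction is then a substitution of indices, and an equation between simplices is a family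
  of equations between arrows of \<open>C\<close>.

  Degree \<open>0\<close> is exceptional for Reedy fibrancy because the boundary of
  \<open>F(0)\<close> is empty: it supplies no arrows in the \<open>[p]\<close> direction, so these
  must be built from the edges of the horn itself.\<close>

lemma openin_quotient_topology:
  assumes "equiv (topspace T) r"
  shows "openin (quotient_topology T r) U \<longleftrightarrow> U \<subseteq> topspace T // r \<and> openin T (\<Union>U)"
proof -
  have "istopology (\<lambda>U. U \<subseteq> topspace T // r \<and> openin T (\<Union>U))"
    unfolding istopology_def
  proof (intro conjI allI impI)
    fix U V assume U: "U \<subseteq> topspace T // r \<and> openin T (\<Union>U)"
      and V: "V \<subseteq> topspace T // r \<and> openin T (\<Union>V)"
    \<comment> \<open>Distinct classes are disjoint, so a point of both unions lies in a class
      common to \<open>U\<close> and \<open>V\<close>.\<close>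
    have "\<Union>(U \<inter> V) = \<Union>U \<inter> \<Union>V"
    proof (intro equalityI subsetI)
      fix x assume "x \<in> \<Union>U \<inter> \<Union>V"
      then obtain A B where AB: "A \<in> U" "B \<in> V" "x \<in> A" "x \<in> B" by blast
      then have "A = B" using quotient_disj[OF assms, of A B] U V by blast
      then show "x \<in> \<Union>(U \<inter> V)" using AB by blast
    qed auto
    then show "openin T (\<Union>(U \<inter> V))" using U V by auto
  next
    fix \<U> assume *: "\<forall>U\<in>\<U>. U \<subseteq> topspace T // r \<and> openin T (\<Union>U)"
    have "\<Union>(\<Union>\<U>) = \<Union>(Union ` \<U>)" by blast
    then show "openin T (\<Union>(\<Union>\<U>))" using * by auto
  qed blast+
  then show ?thesis
    unfolding quotient_topology_def by (simp add: topology_inverse')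
qed

lemma topspace_quotient_topology:
  assumes "equiv (topspace T) r"
  shows "topspace (quotient_topology T r) = topspace T // r"
proof
  have "openin (quotient_topology T r) (topspace T // r)"
    using Union_quotient[OF assms] by (simp add: openin_quotient_topology[OF assms])
  then show "topspace T // r \<subseteq> topspace (quotient_topology T r)"
    by (rule openin_subset)
  show "topspace (quotient_topology T r) \<subseteq> topspace T // r"
    using openin_quotient_topology[OF assms] openin_topspace by blast
qed

lemma quotient_map_quotient_topology:
  assumes "equiv (topspace T) r"
  shows "quotient_map T (quotient_topology T r) (\<lambda>x. r `` {x})"
  unfolding quotient_map_def topspace_quotient_topology[OF assms]
proof (intro conjI allI impI)
  show "(\<lambda>x. r `` {x}) ` topspace T = topspace T // r"
    by (auto simp: quotient_def)
  fix U assume U: "U \<subseteq> topspace T // r"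
  \<comment> \<open>A point lies in a class belonging to \<open>U\<close> exactly when its own class
    belongs to \<open>U\<close>, so the preimage under the class map is the union.\<close>
  have "{x \<in> topspace T. r `` {x} \<in> U} = \<Union>U"
  proof (intro equalityI subsetI)
    fix x assume "x \<in> {x \<in> topspace T. r `` {x} \<in> U}"
    then show "x \<in> \<Union>U" using equiv_class_self[OF assms] by blast
  next
    fix x assume "x \<in> \<Union>U"
    then obtain A where A: "A \<in> U" "x \<in> A" by blast
    then obtain y where "y \<in> topspace T" "A = r `` {y}" using U by (auto elim: quotientE)
    then have "r `` {x} = A" "x \<in> topspace T"
      using A equiv_class_eq[OF assms, of y x] assms by (auto simp: equiv_def refl_on_def)
    then show "x \<in> {x \<in> topspace T. r `` {x} \<in> U}" using A by simp
  qed
  then show "openin T {x \<in> topspace T. r `` {x} \<in> U} = openin (quotient_topology T r) U"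
    using U by (simp add: openin_quotient_topology[OF assms])
qed

text \<open>Products distribute over disjoint unions: for \<open>B\<close> open in
  \<open>X i\<close> the set \<open>{i} \<times> B\<close> is open in the sum, so a product
  neighbourhood found in one summand is a neighbourhood in the whole space.\<close>

lemma continuous_map_prod_sum_topology:
  assumes "\<And>i. i \<in> I \<Longrightarrow> continuous_map (prod_topology Z (X i)) Y (\<lambda>(z, t). f (z, (i, t)))"
  shows "continuous_map (prod_topology Z (sum_topology X I)) Y f"
  unfolding continuous_map_def
proof (intro conjI allI impI funcsetI)
  fix p assume "p \<in> topspace (prod_topology Z (sum_topology X I))"
  then obtain z i t where "p = (z, (i, t))" "z \<in> topspace Z" "i \<in> I" "t \<in> topspace (X i)"
    by auto
  then show "f p \<in> topspace Y"
    using assms[of i] unfolding continuous_map_def by (auto simp: Pi_iff)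
next
  fix U assume U: "openin Y U"
  let ?S = "{p \<in> topspace (prod_topology Z (sum_topology X I)). f p \<in> U}"
  have "\<exists>A B. openin Z A \<and> openin (sum_topology X I) B \<and> z \<in> A \<and> q \<in> B \<and> A \<times> B \<subseteq> ?S"
    if zq: "(z, q) \<in> ?S" for z q
  proof -
    obtain i t where q: "q = (i, t)" by (cases q)
    with zq have z: "z \<in> topspace Z" and i: "i \<in> I" and t: "t \<in> topspace (X i)"
      and fU: "f (z, (i, t)) \<in> U"
      by auto
    have "openin (prod_topology Z (X i))
        {p \<in> topspace (prod_topology Z (X i)). (\<lambda>(z, t). f (z, (i, t))) p \<in> U}"
      using assms[OF i] U unfolding continuous_map_def by blast
    moreover have "(z, t) \<in> {p \<in> topspace (prod_topology Z (X i)). (\<lambda>(z, t). f (z, (i, t))) p \<in> U}"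
      using z t fU by simp
    ultimately obtain A B where AB: "openin Z A" "openin (X i) B" "z \<in> A" "t \<in> B"
      "A \<times> B \<subseteq> {p \<in> topspace (prod_topology Z (X i)). (\<lambda>(z, t). f (z, (i, t))) p \<in> U}"
      unfolding openin_prod_topology_alt by meson
    have "B \<subseteq> topspace (X i)" using AB(2) openin_subset by blast
    have eq: "{x. (j, x) \<in> {i} \<times> B} = (if j = i then B else {})" for j by auto
    have "openin (sum_topology X I) ({i} \<times> B)"
      unfolding openin_sum_topology eq using i AB(2) \<open>B \<subseteq> topspace (X i)\<close> by auto
    moreover have "A \<times> ({i} \<times> B) \<subseteq> ?S"
      using AB(5) i by auto
    ultimately show ?thesis
      using AB q by blast
  qed
  then show "openin (prod_topology Z (sum_topology X I)) ?S"
    by (subst openin_prod_topology_alt) blast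
qed

section \<open>Realization as a quotient of a sum of simplices\<close>

lemma mem_topspace_simplex_sum:
  "((n, x), t) \<in> topspace (simplex_sum X) \<longleftrightarrow> x \<in> cells X n \<and> t \<in> standard_simplex n"
  by (auto simp: simplex_sum_def)

lemma simplicial_set_act:
  assumes "simplicial_set X" "\<theta> \<in> Delta m n" "x \<in> cells X n"
  shows "act X m n \<theta> x \<in> cells X m"
  using assms unfolding simplicial_set_def by (auto simp: Pi_iff)

text \<open>The fibres of \<open>\<theta>\<close> partition \<open>{..m}\<close>, so adding the
  coordinates over each fibre keeps their total equal to 1.\<close>

lemma simplex_push_in_standard_simplex:
  assumes \<theta>: "\<theta> \<in> Delta m n" and t: "t \<in> standard_simplex m"
  shows "simplex_push m \<theta> t \<in> standard_simplex n"
proof -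
  have im: "\<theta> ` {..m} \<subseteq> {..n}" using \<theta> by (auto simp: Delta_def)
  have sum1: "(\<Sum>i\<le>m. t i) = 1" and pos: "\<And>i. 0 \<le> t i" using t by (auto simp: standard_simplex_def)
  have eq: "{i. i \<le> m \<and> \<theta> i = j} = {i \<in> {..m}. \<theta> i = j}" for j by auto
  have "simplex_push m \<theta> t j \<le> (\<Sum>i\<le>m. t i)" for j
    unfolding simplex_push_def by (rule sum_mono2) (auto simp: pos)
  moreover have "simplex_push m \<theta> t j = 0" if "j > n" for j
    unfolding simplex_push_def using im that by (intro sum.neutral) fastforce
  moreover have "(\<Sum>j\<le>n. simplex_push m \<theta> t j) = 1"
    unfolding simplex_push_def eq using sum.group[OF _ _ im, of t] sum1 by simp
  moreover have "0 \<le> simplex_push m \<theta> t j" for j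
    unfolding simplex_push_def by (rule sum_nonneg) (auto simp: pos)
  ultimately show ?thesis by (simp add: standard_simplex_def sum1)
qed

text \<open>The elementary identifications, separated from the equivalence relation that they
  generate, so that a map of points can be checked on them alone.\<close>

definition realization_gen ::
  "'a sset \<Rightarrow> (((nat \<times> 'a) \<times> (nat \<Rightarrow> real)) \<times> ((nat \<times> 'a) \<times> (nat \<Rightarrow> real))) set" where
  "realization_gen X = {(((m, act X m n \<theta> x), t), ((n, x), simplex_push m \<theta> t)) |m n \<theta> x t.
     \<theta> \<in> Delta m n \<and> x \<in> cells X n \<and> t \<in> standard_simplex m}"

lemma realization_rel_eq:
  "realization_rel X = (realization_gen X \<union> (realization_gen X)\<inverse>)\<^sup>* \<inter>
     topspace (simplex_sum X) \<times> topspace (simplex_sum X)"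
  by (simp only: realization_rel_def realization_gen_def Let_def)

lemma equiv_realization_rel: "equiv (topspace (simplex_sum X)) (realization_rel X)"
proof (rule equivI)
  let ?E = "realization_gen X \<union> (realization_gen X)\<inverse>"
  show "refl_on (topspace (simplex_sum X)) (realization_rel X)"
    by (auto simp: realization_rel_eq refl_on_def)
  have "sym (?E\<^sup>*)" by (intro sym_rtrancl sym_Un_converse)
  then show "sym (realization_rel X)"
    by (auto simp: realization_rel_eq sym_def)
  show "trans (realization_rel X)"
    unfolding realization_rel_eq trans_def by (blast intro: rtrancl_trans)
qed (auto simp: realization_rel_eq)

lemma realization_gen_rel:
  assumes "simplicial_set X" "(p, q) \<in> realization_gen X"
  shows "(p, q) \<in> realization_rel X"
proof -
  obtain m n \<theta> x t where *: "p = ((m, act X m n \<theta> x), t)" "q = ((n, x), simplex_push m \<theta> t)"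
    "\<theta> \<in> Delta m n" "x \<in> cells X n" "t \<in> standard_simplex m"
    using assms(2) by (auto simp: realization_gen_def)
  then have "p \<in> topspace (simplex_sum X)" "q \<in> topspace (simplex_sum X)"
    using simplicial_set_act[OF assms(1)] simplex_push_in_standard_simplex
    by (auto simp: mem_topspace_simplex_sum)
  then show ?thesis using assms(2) by (auto simp: realization_rel_eq)
qed

lemma realization_rel_class_eq:
  assumes "(p, q) \<in> realization_rel X"
  shows "realization_rel X `` {p} = realization_rel X `` {q}"
  using equiv_class_eq[OF equiv_realization_rel assms] .

lemma quotient_map_realization:
  "quotient_map (simplex_sum X) (realization X) (\<lambda>z. realization_rel X `` {z})"
  unfolding realization_def by (rule quotient_map_quotient_topology[OF equiv_realization_rel])

lemma topspace_realization:
  "topspace (realization X) = topspace (simplex_sum X) // realization_rel X"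
  unfolding realization_def by (rule topspace_quotient_topology[OF equiv_realization_rel])

lemma topspace_realizationE:
  assumes "c \<in> topspace (realization X)"
  obtains n x t where "x \<in> cells X n" "t \<in> standard_simplex n"
    "c = realization_rel X `` {((n, x), t)}"
proof -
  obtain z where "z \<in> topspace (simplex_sum X)" "c = realization_rel X `` {z}"
    using assms by (auto simp: topspace_realization elim: quotientE)
  then show thesis using that by (cases z; cases "fst z") (auto simp: mem_topspace_simplex_sum)
qed

text \<open>Induction along a zigzag of elementary identifications. The image of a class may be only
  part of a class, hence the saturation by \<open>realization_rel Y\<close>.\<close>

lemma Image_realization_class:
  assumes resp: "\<And>p q. (p, q) \<in> realization_gen X \<Longrightarrow> (\<Phi> p, \<Phi> q) \<in> realization_rel Y"
    and z: "z \<in> topspace (simplex_sum X)"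
  shows "realization_rel Y `` (\<Phi> ` (realization_rel X `` {z})) = realization_rel Y `` {\<Phi> z}"
proof -
  have *: "realization_rel Y `` {\<Phi> p} = realization_rel Y `` {\<Phi> z}"
    if "(z, p) \<in> (realization_gen X \<union> (realization_gen X)\<inverse>)\<^sup>*" for p
    using that
  proof (induction rule: rtrancl_induct)
    case (step p q)
    then show ?case using resp realization_rel_class_eq by blast
  qed simp
  have "z \<in> realization_rel X `` {z}"
    using z by (auto simp: realization_rel_eq)
  then show ?thesis using * by (fastforce simp: realization_rel_eq)
qed

text \<open>The dimension may change from \<open>n\<close> to \<open>N n\<close>: \<open>N\<close>
  is the identity for \<open>realization_map\<close> and doubling for homotopies.\<close>

definition cellwise_map ::
  "'b sset \<Rightarrow> (nat \<Rightarrow> nat) \<Rightarrow> (nat \<Rightarrow> 'a \<Rightarrow> 'b) \<Rightarrow> (nat \<Rightarrow> (nat \<Rightarrow> real) \<Rightarrow> (nat \<Rightarrow> real))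
    \<Rightarrow> ((nat \<times> 'a) \<times> (nat \<Rightarrow> real)) set \<Rightarrow> ((nat \<times> 'b) \<times> (nat \<Rightarrow> real)) set" where
  "cellwise_map Y N K T c =
     realization_rel Y `` ((\<lambda>((n, x), t). ((N n, K n x), T n t)) ` c)"

lemma realization_map_eq_cellwise:
  "realization_map Y f = cellwise_map Y (\<lambda>n. n) f (\<lambda>n t. t)"
  by (rule ext) (simp add: realization_map_def cellwise_map_def)

text \<open>One operator \<open>\<theta>'\<close> must serve both the cells and the coordinates;
  then an elementary identification in \<open>X\<close> goes to one in \<open>Y\<close>, and the
  value does not depend on the representative.\<close>

lemma cellwise_map_class:
  assumes Y: "simplicial_set Y"
    and K: "\<And>n x. x \<in> cells X n \<Longrightarrow> K n x \<in> cells Y (N n)"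
    and T: "\<And>n t. t \<in> standard_simplex n \<Longrightarrow> T n t \<in> standard_simplex (N n)"
    and compat: "\<And>m n \<theta>. \<theta> \<in> Delta m n \<Longrightarrow> \<exists>\<theta>' \<in> Delta (N m) (N n).
        (\<forall>x \<in> cells X n. K m (act X m n \<theta> x) = act Y (N m) (N n) \<theta>' (K n x)) \<and>
        (\<forall>t \<in> standard_simplex m. T n (simplex_push m \<theta> t) = simplex_push (N m) \<theta>' (T m t))"
    and xt: "x \<in> cells X n" "t \<in> standard_simplex n"
  shows "cellwise_map Y N K T (realization_rel X `` {((n, x), t)})
           = realization_rel Y `` {((N n, K n x), T n t)}"
proof -
  let ?\<Phi> = "\<lambda>((n, x), t). ((N n, K n x), T n t)"
  have "(?\<Phi> p, ?\<Phi> q) \<in> realization_rel Y" if pq: "(p, q) \<in> realization_gen X" for p q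
  proof -
    obtain m n \<theta> x t where *: "p = ((m, act X m n \<theta> x), t)" "q = ((n, x), simplex_push m \<theta> t)"
      "\<theta> \<in> Delta m n" "x \<in> cells X n" "t \<in> standard_simplex m"
      using pq by (auto simp: realization_gen_def)
    obtain \<theta>' where \<theta>': "\<theta>' \<in> Delta (N m) (N n)"
      "K m (act X m n \<theta> x) = act Y (N m) (N n) \<theta>' (K n x)"
      "T n (simplex_push m \<theta> t) = simplex_push (N m) \<theta>' (T m t)"
      using compat[OF *(3)] *(4,5) by blast
    have "(?\<Phi> p, ?\<Phi> q) \<in> realization_gen Y"
      unfolding realization_gen_def *(1,2) case_prod_conv \<theta>'(2,3)
      using \<theta>'(1) K[OF *(4)] T[OF *(5)] by blast
    then show ?thesis using realization_gen_rel[OF Y] by blast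
  qed
  from Image_realization_class[of X ?\<Phi> Y "((n, x), t)", OF this] xt show ?thesis
    unfolding cellwise_map_def by (simp add: mem_topspace_simplex_sum)
qed

text \<open>Taking the product with a locally compact Hausdorff \<open>Z\<close> preserves quotient
  maps. Continuity can therefore be tested before passing to classes, and there on one summand at a
  time.\<close>

lemma continuous_map_cellwise:
  assumes Y: "simplicial_set Y"
    and Z: "locally_compact_space Z" "Hausdorff_space Z"
    and K: "\<And>n x. x \<in> cells X n \<Longrightarrow> K n x \<in> cells Y (N n)"
    and cont: "\<And>n. continuous_map
        (prod_topology Z (subtopology (powertop_real UNIV) (standard_simplex n)))
        (subtopology (powertop_real UNIV) (standard_simplex (N n))) (\<lambda>(z, t). T z n t)"
    and compat: "\<And>m n \<theta>. \<theta> \<in> Delta m n \<Longrightarrow> \<exists>\<theta>' \<in> Delta (N m) (N n).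
        (\<forall>x \<in> cells X n. K m (act X m n \<theta> x) = act Y (N m) (N n) \<theta>' (K n x)) \<and>
        (\<forall>z \<in> topspace Z. \<forall>t \<in> standard_simplex m.
           T z n (simplex_push m \<theta> t) = simplex_push (N m) \<theta>' (T z m t))"
  shows "continuous_map (prod_topology Z (realization X)) (realization Y)
           (\<lambda>(z, c). cellwise_map Y N K (T z) c)"
proof -
  have T: "T z n t \<in> standard_simplex (N n)" if "z \<in> topspace Z" "t \<in> standard_simplex n" for z n t
    using cont[of n] that unfolding continuous_map_def by (auto simp: Pi_iff)
  have cls: "cellwise_map Y N K (T z) (realization_rel X `` {((n, x), t)})
           = realization_rel Y `` {((N n, K n x), T z n t)}"
    if "z \<in> topspace Z" "x \<in> cells X n" "t \<in> standard_simplex n" for z n x t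
  proof (rule cellwise_map_class[OF Y K _ _ that(2,3)])
    show "T z n t \<in> standard_simplex (N n)" if "t \<in> standard_simplex n" for n t
      using that T \<open>z \<in> topspace Z\<close> by blast
  next
    fix m n \<theta> assume "\<theta> \<in> Delta m n"
    from compat[OF this] that(1)
    show "\<exists>\<theta>' \<in> Delta (N m) (N n).
        (\<forall>x \<in> cells X n. K m (act X m n \<theta> x) = act Y (N m) (N n) \<theta>' (K n x)) \<and>
        (\<forall>t \<in> standard_simplex m. T z n (simplex_push m \<theta> t) = simplex_push (N m) \<theta>' (T z m t))"
      by blast
  qed
  have q: "quotient_map (prod_topology Z (simplex_sum X)) (prod_topology Z (realization X))
      (\<lambda>(z, s). (z, realization_rel X `` {s}))"
    using quotient_map_prod_right[OF Z(1) _ quotient_map_realization] Z(2) by blast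
  let ?\<Psi> = "\<lambda>(z, s). realization_rel Y `` {case s of ((n, x), t) \<Rightarrow> ((N n, K n x), T z n t)}"
  have "continuous_map (prod_topology Z (simplex_sum X)) (realization Y) ?\<Psi>"
    unfolding simplex_sum_def
  proof (rule continuous_map_prod_sum_topology)
    fix i assume "i \<in> Sigma UNIV (cells X)"
    then obtain n x where i: "i = (n, x)" and x: "x \<in> cells X n" by auto
    have inj: "continuous_map (subtopology (powertop_real UNIV) (standard_simplex (N n)))
        (simplex_sum Y) (\<lambda>t. ((N n, K n x), t))"
      unfolding simplex_sum_def
      using continuous_map_component_injection[of "(N n, K n x)" "Sigma UNIV (cells Y)"
        "\<lambda>(n, x). subtopology (powertop_real UNIV) (standard_simplex n)"] K[OF x] by simp
    have "continuous_map (prod_topology Z (subtopology (powertop_real UNIV) (standard_simplex n)))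
       (realization Y) ((\<lambda>z. realization_rel Y `` {z}) \<circ> ((\<lambda>t. ((N n, K n x), t)) \<circ> (\<lambda>(z, t). T z n t)))"
      by (intro continuous_map_compose[OF continuous_map_compose[OF cont inj]]
          quotient_imp_continuous_map quotient_map_realization)
    then show "continuous_map (prod_topology Z (case i of
        (n, x) \<Rightarrow> subtopology (powertop_real UNIV) (standard_simplex n)))
        (realization Y) (\<lambda>(z, t). ?\<Psi> (z, i, t))"
      by (simp add: i o_def case_prod_unfold)
  qed
  then have "continuous_map (prod_topology Z (simplex_sum X)) (realization Y)
      ((\<lambda>(z, c). cellwise_map Y N K (T z) c) \<circ> (\<lambda>(z, s). (z, realization_rel X `` {s})))"
    by (rule continuous_map_eq) (auto simp: cls mem_topspace_simplex_sum)
  then show ?thesis by (rule continuous_compose_quotient_map[OF q])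
qed

lemma unit_interval_locally_compact_Hausdorff:
  "locally_compact_space (top_of_set {0..1::real})" "Hausdorff_space (top_of_set {0..1::real})"
  by (auto intro!: compact_imp_locally_compact_space Hausdorff_space_subtopology
      simp: compact_space_subtopology)

lemma realization_map_class:
  assumes "simplicial_set Y" "simplicial_map X Y f" "x \<in> cells X n" "t \<in> standard_simplex n"
  shows "realization_map Y f (realization_rel X `` {((n, x), t)}) = realization_rel Y `` {((n, f n x), t)}"
  unfolding realization_map_eq_cellwise
  by (rule cellwise_map_class) (use assms in \<open>auto simp: simplicial_map_def Pi_iff\<close>)

lemma continuous_map_realization_map:
  assumes Y: "simplicial_set Y" and f: "simplicial_map X Y f"
  shows "continuous_map (realization X) (realization Y) (realization_map Y f)"
proof -
  \<comment> \<open>The parametrized statement is applied to a family constant in the parameter and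
    then restricted to the slice at 0.\<close>
  have "continuous_map (prod_topology (top_of_set {0..1::real}) (realization X)) (realization Y)
           (\<lambda>(z, c). cellwise_map Y (\<lambda>n. n) f (\<lambda>n t. t) c)"
    by (rule continuous_map_cellwise[OF Y unit_interval_locally_compact_Hausdorff])
      (use f in \<open>auto simp: simplicial_map_def Pi_iff case_prod_unfold intro: continuous_map_snd\<close>)
  moreover have "continuous_map (realization X)
      (prod_topology (top_of_set {0..1::real}) (realization X)) (\<lambda>c. (0, c))"
    by (auto intro!: continuous_map_pairedI)
  ultimately have "continuous_map (realization X) (realization Y)
     ((\<lambda>(z, c). cellwise_map Y (\<lambda>n. n) f (\<lambda>n t. t) c) \<circ> (\<lambda>c. (0::real, c)))"
    by (rule continuous_map_compose[rotated])
  then show ?thesis by (simp add: realization_map_eq_cellwise o_def)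
qed

section \<open>Doubled simplices and linear homotopies\<close>

lemma simplex_push_eq: "simplex_push m \<theta> t j = (\<Sum>i\<le>m. if \<theta> i = j then t i else 0)"
proof -
  have "{i. i \<le> m \<and> \<theta> i = j} = {i \<in> {..m}. \<theta> i = j}" by auto
  then show ?thesis by (simp add: simplex_push_def sum.inter_filter[symmetric])
qed

text \<open>The ordinal sum of \<open>\<theta>\<close> with itself; the second block of
  \<open>[2 * m + 1]\<close> starts at \<open>Suc m\<close>. This is the functor on the simplex
  category that underlies edgewise subdivision.\<close>

definition ordinal_double :: "nat \<Rightarrow> nat \<Rightarrow> (nat \<Rightarrow> nat) \<Rightarrow> nat \<Rightarrow> nat" where
  "ordinal_double m n \<theta> = (\<lambda>i\<in>{..2 * m + 1}. if i \<le> m then \<theta> i else Suc n + \<theta> (i - Suc m))"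

text \<open>The point with parameter \<open>s\<close> on the segment joining the two copies of
  \<open>t\<close> in the front and back faces.\<close>

definition join_coords :: "real \<Rightarrow> nat \<Rightarrow> (nat \<Rightarrow> real) \<Rightarrow> nat \<Rightarrow> real" where
  "join_coords s n t = (\<lambda>j. if j \<le> n then (1 - s) * t j else s * t (j - Suc n))"

lemma ordinal_double_in_Delta:
  assumes "\<theta> \<in> Delta m n" shows "ordinal_double m n \<theta> \<in> Delta (2 * m + 1) (2 * n + 1)"
proof -
  have *: "\<theta> i \<le> n" if "i \<le> m" for i using assms that by (auto simp: Delta_def)
  have mono: "\<theta> i \<le> \<theta> j" if "i \<le> j" "j \<le> m" for i j
    using assms that by (auto simp: Delta_def mono_on_def)
  have "ordinal_double m n \<theta> i \<le> 2 * n + 1" if "i \<le> 2 * m + 1" for i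
    using *[of i] *[of "i - Suc m"] that by (auto simp: ordinal_double_def)
  moreover have "ordinal_double m n \<theta> i \<le> ordinal_double m n \<theta> j" if "i \<le> j" "j \<le> 2 * m + 1" for i j
  proof -
    consider "j \<le> m" | "i \<le> m" "\<not> j \<le> m" | "\<not> i \<le> m" "\<not> j \<le> m" by linarith
    then show ?thesis
      using that *[of i] mono[of i j] mono[of "i - Suc m" "j - Suc m"]
      by cases (auto simp: ordinal_double_def)
  qed
  moreover have "ordinal_double m n \<theta> \<in> extensional {..2 * m + 1}"
    by (simp add: ordinal_double_def)
  ultimately show ?thesis by (auto simp: Delta_def PiE_iff mono_on_def)
qed

lemma sum_atMost_double: "(\<Sum>j\<le>2 * n + 1. f j) = (\<Sum>j\<le>n. f j) + (\<Sum>j\<le>n. f (j + Suc n))"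
  for f :: "nat \<Rightarrow> 'a :: comm_monoid_add"
proof -
  have "(\<Sum>j\<le>2 * n + 1. f j) = sum f ({..n} \<union> {Suc n..2 * n + 1})"
    by (rule sum.cong) auto
  also have "\<dots> = sum f {..n} + sum f {Suc n..2 * n + 1}"
    by (rule sum.union_disjoint) auto
  also have "sum f {Suc n..2 * n + 1} = sum f {0 + Suc n..n + Suc n}"
    by (rule sum.cong) auto
  also have "\<dots> = (\<Sum>j=0..n. f (j + Suc n))" by (rule sum.shift_bounds_cl_nat_ivl)
  finally show ?thesis by (simp add: atLeast0AtMost)
qed

lemma join_coords_in_standard_simplex:
  assumes "s \<in> {0..1}" and t: "t \<in> standard_simplex n"
  shows "join_coords s n t \<in> standard_simplex (2 * n + 1)"
proof -
  have "(\<Sum>j\<le>2 * n + 1. join_coords s n t j) = 1"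
    using t unfolding sum_atMost_double
    by (simp add: join_coords_def standard_simplex_def flip: sum_distrib_left)
  then show ?thesis
    using assms by (auto simp: join_coords_def standard_simplex_def mult_le_one)
qed

text \<open>The back block lands beyond \<open>n\<close> and the front block does not, so at each
  coordinate one of the two half sums vanishes and the other is a scaled push-forward of
  \<open>t\<close>.\<close>

lemma simplex_push_join_coords:
  assumes \<theta>: "\<theta> \<in> Delta m n" and t: "t \<in> standard_simplex m"
  shows "join_coords s n (simplex_push m \<theta> t)
           = simplex_push (2 * m + 1) (ordinal_double m n \<theta>) (join_coords s m t)"
proof
  fix j
  have im: "\<theta> i \<le> n" if "i \<le> m" for i using \<theta> that by (auto simp: Delta_def)
  have "simplex_push (2 * m + 1) (ordinal_double m n \<theta>) (join_coords s m t) j =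
     (\<Sum>i\<le>2 * m + 1. if ordinal_double m n \<theta> i = j then join_coords s m t i else 0)"
    by (rule simplex_push_eq)
  also have "\<dots> = (\<Sum>i\<le>m. if \<theta> i = j then (1 - s) * t i else 0)
       + (\<Sum>i\<le>m. if Suc n + \<theta> i = j then s * t i else 0)"
    unfolding sum_atMost_double
    by (rule arg_cong2[where f = "(+)"]; rule sum.cong)
       (auto simp: ordinal_double_def join_coords_def)
  also have "\<dots> = join_coords s n (simplex_push m \<theta> t) j"
  proof (cases "j \<le> n")
    case True
    then have "(\<Sum>i\<le>m. if Suc n + \<theta> i = j then s * t i else 0) = 0"
      by (intro sum.neutral) auto
    moreover have "(\<Sum>i\<le>m. if \<theta> i = j then (1 - s) * t i else 0) = (1 - s) * simplex_push m \<theta> t j"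
      unfolding simplex_push_eq sum_distrib_left by (rule sum.cong) auto
    ultimately show ?thesis using True by (simp add: join_coords_def)
  next
    case False
    then have "(\<Sum>i\<le>m. if \<theta> i = j then (1 - s) * t i else 0) = 0"
      using im by (intro sum.neutral) auto
    moreover have "(\<Sum>i\<le>m. if Suc n + \<theta> i = j then s * t i else 0)
        = (\<Sum>i\<le>m. if \<theta> i = j - Suc n then s * t i else 0)"
      by (rule sum.cong) (use False in auto)
    moreover have "\<dots> = s * simplex_push m \<theta> t (j - Suc n)"
      unfolding simplex_push_eq sum_distrib_left by (rule sum.cong) auto
    ultimately show ?thesis using False by (simp add: join_coords_def)
  qed
  finally show "join_coords s n (simplex_push m \<theta> t) j
           = simplex_push (2 * m + 1) (ordinal_double m n \<theta>) (join_coords s m t) j" by simp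
qed

lemma continuous_map_join_coords:
  "continuous_map
     (prod_topology (top_of_set {0..1}) (subtopology (powertop_real UNIV) (standard_simplex n)))
     (subtopology (powertop_real UNIV) (standard_simplex (2 * n + 1))) (\<lambda>(s, t). join_coords s n t)"
proof (rule continuous_map_into_subtopology)
  let ?S = "prod_topology (top_of_set {0..1}) (subtopology (powertop_real UNIV) (standard_simplex n))"
  have s: "continuous_map ?S euclideanreal fst"
    by (rule continuous_map_into_fulltopology[OF continuous_map_fst])
  have t: "continuous_map ?S euclideanreal (\<lambda>p. snd p j)" for j
  proof -
    have "continuous_map ?S (powertop_real UNIV) snd"
      by (rule continuous_map_into_fulltopology[OF continuous_map_snd])
    then show ?thesis unfolding continuous_map_componentwise_UNIV by blast
  qed
  have "continuous_map ?S euclideanreal (\<lambda>p. join_coords (fst p) n (snd p) j)" for j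
    by (cases "j \<le> n") (auto simp: join_coords_def intro!: continuous_map_real_mult
        continuous_map_diff continuous_map_canonical_const s t)
  then show "continuous_map ?S (powertop_real UNIV) (\<lambda>(s, t). join_coords s n t)"
    by (simp add: continuous_map_componentwise_UNIV case_prod_unfold)
  show "(\<lambda>(s, t). join_coords s n t) \<in> topspace ?S \<rightarrow> standard_simplex (2 * n + 1)"
    using join_coords_in_standard_simplex by auto
qed

definition ordinal_front :: "nat \<Rightarrow> nat \<Rightarrow> nat" where
  "ordinal_front n = (\<lambda>i\<in>{..n}. i)"

definition ordinal_back :: "nat \<Rightarrow> nat \<Rightarrow> nat" where
  "ordinal_back n = (\<lambda>i\<in>{..n}. Suc n + i)"

lemma ordinal_front_in_Delta: "ordinal_front n \<in> Delta n (2 * n + 1)"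
  by (auto simp: Delta_def ordinal_front_def mono_on_def)

lemma ordinal_back_in_Delta: "ordinal_back n \<in> Delta n (2 * n + 1)"
  by (auto simp: Delta_def ordinal_back_def mono_on_def)

lemma simplex_push_front: "simplex_push n (ordinal_front n) t = join_coords 0 n t"
proof
  fix j
  have "{i. i \<le> n \<and> ordinal_front n i = j} = (if j \<le> n then {j} else {})"
    by (auto simp: ordinal_front_def)
  then show "simplex_push n (ordinal_front n) t j = join_coords 0 n t j"
    by (simp add: simplex_push_def join_coords_def)
qed

lemma simplex_push_back:
  assumes "t \<in> standard_simplex n"
  shows "simplex_push n (ordinal_back n) t = join_coords 1 n t"
proof
  fix j
  have "{i. i \<le> n \<and> ordinal_back n i = j} = (if j > n \<and> j \<le> 2 * n + 1 then {j - Suc n} else {})"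
    by (auto simp: ordinal_back_def)
  \<comment> \<open>Beyond \<open>2 * n + 1\<close> the function \<open>join_coords\<close> still
    reads \<open>t\<close>, but outside the support of a point of the simplex.\<close>
  moreover have "t (j - Suc n) = 0" if "j > 2 * n + 1" for j
    using assms that by (auto simp: standard_simplex_def)
  ultimately show "simplex_push n (ordinal_back n) t j = join_coords 1 n t j"
    by (simp add: simplex_push_def join_coords_def)
qed

text \<open>\<open>K n x\<close> is one big simplex with \<open>f n x\<close> as front and
  \<open>g n x\<close> as back face, natural along doubling. At parameters 0 and 1 the moving point
  lies on one of these faces, and the elementary identification for that face gives the value of
  \<open>f\<close> or \<open>g\<close>.\<close>

lemma homotopic_realization_maps:
  assumes X: "simplicial_set X" and Y: "simplicial_set Y"
    and f: "simplicial_map X Y f" and g: "simplicial_map X Y g"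
    and K: "\<And>n x. x \<in> cells X n \<Longrightarrow> K n x \<in> cells Y (2 * n + 1)"
    and natural: "\<And>m n \<theta> x. \<theta> \<in> Delta m n \<Longrightarrow> x \<in> cells X n \<Longrightarrow>
        K m (act X m n \<theta> x) = act Y (2 * m + 1) (2 * n + 1) (ordinal_double m n \<theta>) (K n x)"
    and front: "\<And>n x. x \<in> cells X n \<Longrightarrow> act Y n (2 * n + 1) (ordinal_front n) (K n x) = f n x"
    and rear: "\<And>n x. x \<in> cells X n \<Longrightarrow> act Y n (2 * n + 1) (ordinal_back n) (K n x) = g n x"
  shows "homotopic_with (\<lambda>_. True) (realization X) (realization Y)
           (realization_map Y f) (realization_map Y g)"
proof -
  let ?h = "\<lambda>(s, c). cellwise_map Y (\<lambda>n. 2 * n + 1) K (join_coords s) c"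
  have cls: "?h (s, realization_rel X `` {((n, x), t)})
           = realization_rel Y `` {((2 * n + 1, K n x), join_coords s n t)}"
    if "s \<in> {0..1}" "x \<in> cells X n" "t \<in> standard_simplex n" for s n x t
    unfolding case_prod_conv
    by (rule cellwise_map_class[OF Y K _ _ that(2,3)])
      (use that join_coords_in_standard_simplex simplex_push_join_coords natural ordinal_double_in_Delta in blast)+
  have h: "continuous_map (prod_topology (top_of_set {0..1}) (realization X)) (realization Y) ?h"
  proof (rule continuous_map_cellwise[OF Y unit_interval_locally_compact_Hausdorff K])
    fix m n \<theta> assume "\<theta> \<in> Delta m n"
    then show "\<exists>\<theta>'\<in>Delta (2 * m + 1) (2 * n + 1).
          (\<forall>x\<in>cells X n. K m (act X m n \<theta> x) = act Y (2 * m + 1) (2 * n + 1) \<theta>' (K n x)) \<and>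
          (\<forall>z\<in>topspace (top_of_set {0..1}). \<forall>t\<in>standard_simplex m.
              join_coords z n (simplex_push m \<theta> t) = simplex_push (2 * m + 1) \<theta>' (join_coords z m t))"
      by (intro bexI[of _ "ordinal_double m n \<theta>"] conjI ballI)
        (simp_all add: natural simplex_push_join_coords ordinal_double_in_Delta del: One_nat_def)
  qed (simp_all only: continuous_map_join_coords)
  have gen: "realization_rel Y `` {((n, act Y n (2 * n + 1) \<theta> (K n x)), t)} =
      realization_rel Y `` {((2 * n + 1, K n x), simplex_push n \<theta> t)}"
    if "x \<in> cells X n" "t \<in> standard_simplex n" "\<theta> \<in> Delta n (2 * n + 1)" for n x t \<theta>
  proof -
    have "(((n, act Y n (2 * n + 1) \<theta> (K n x)), t), ((2 * n + 1, K n x), simplex_push n \<theta> t))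
        \<in> realization_gen Y"
      unfolding realization_gen_def using that K[OF that(1)] by blast
    then show ?thesis using realization_gen_rel[OF Y] realization_rel_class_eq by blast
  qed
  have 0: "?h (0, c) = realization_map Y f c" and 1: "?h (1, c) = realization_map Y g c"
    if c: "c \<in> topspace (realization X)" for c
  proof -
    obtain n x t where *: "x \<in> cells X n" "t \<in> standard_simplex n"
      "c = realization_rel X `` {((n, x), t)}"
      using c by (rule topspace_realizationE)
    show "?h (0, c) = realization_map Y f c"
      using cls[of 0, OF _ *(1,2)] gen[OF *(1,2) ordinal_front_in_Delta] *
      by (simp add: realization_map_class[OF Y f] front simplex_push_front del: One_nat_def)
    show "?h (1, c) = realization_map Y g c"
      using cls[of 1, OF _ *(1,2)] gen[OF *(1,2) ordinal_back_in_Delta] *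
      by (simp add: realization_map_class[OF Y g] rear simplex_push_back del: One_nat_def)
  qed
  show ?thesis
    by (subst homotopic_with) (use h 0 1 in \<open>auto intro!: exI[of _ ?h]\<close>)
qed

section \<open>Criteria for weak equivalences\<close>

lemma simplicial_map_cells:
  "simplicial_map X Y f \<Longrightarrow> x \<in> cells X n \<Longrightarrow> f n x \<in> cells Y n"
  by (auto simp: simplicial_map_def)

lemma simplicial_map_act:
  "simplicial_map X Y f \<Longrightarrow> \<theta> \<in> Delta m n \<Longrightarrow> x \<in> cells X n \<Longrightarrow> f m (act X m n \<theta> x) = act Y m n \<theta> (f n x)"
  by (auto simp: simplicial_map_def)

lemma simplicial_map_comp:
  assumes "simplicial_map X Y f" "simplicial_map Y Z g"
  shows "simplicial_map X Z (\<lambda>n x. g n (f n x))"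
  using assms unfolding simplicial_map_def by (auto simp: Pi_iff)

lemma realization_map_comp:
  assumes "simplicial_set Y" "simplicial_set Z" "simplicial_map X Y f" "simplicial_map Y Z g"
    and c: "c \<in> topspace (realization X)"
  shows "realization_map Z g (realization_map Y f c) = realization_map Z (\<lambda>n x. g n (f n x)) c"
proof -
  obtain n x t where *: "x \<in> cells X n" "t \<in> standard_simplex n"
    "c = realization_rel X `` {((n, x), t)}"
    using c by (rule topspace_realizationE)
  show ?thesis
    using * assms simplicial_map_cells[OF assms(3) *(1)]
      simplicial_map_comp[OF assms(3,4)]
    by (simp add: realization_map_class)
qed

lemma realization_map_id:
  assumes "simplicial_set X" "c \<in> topspace (realization X)" "\<And>n x. x \<in> cells X n \<Longrightarrow> f n x = x"
  shows "realization_map X f c = c"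
proof -
  obtain n x t where *: "x \<in> cells X n" "t \<in> standard_simplex n"
    "c = realization_rel X `` {((n, x), t)}"
    using assms(2) by (rule topspace_realizationE)
  have "simplicial_map X X f"
    using assms simplicial_set_act by (fastforce simp: simplicial_map_def)
  then show ?thesis using * assms by (simp add: realization_map_class)
qed

text \<open>The composite on \<open>X\<close> is the identity on the nose, so a homotopy is required
  on \<open>Y\<close> alone.\<close>

lemma weak_equivalence_deformation:
  assumes X: "simplicial_set X" and Y: "simplicial_set Y"
    and f: "simplicial_map X Y f" and g: "simplicial_map Y X g"
    and gf: "\<And>n x. x \<in> cells X n \<Longrightarrow> g n (f n x) = x"
    and fg: "homotopic_with (\<lambda>_. True) (realization Y) (realization Y)
        (realization_map Y (\<lambda>n y. f n (g n y))) (realization_map Y (\<lambda>n y. y))"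
  shows "weak_equivalence X Y f"
  unfolding weak_equivalence_def homotopy_equivalence_def
proof (intro conjI exI)
  show cf: "continuous_map (realization X) (realization Y) (realization_map Y f)"
    by (rule continuous_map_realization_map[OF Y f])
  show cg: "continuous_map (realization Y) (realization X) (realization_map X g)"
    by (rule continuous_map_realization_map[OF X g])
  show "homotopic_with (\<lambda>_. True) (realization X) (realization X)
      (realization_map X g \<circ> realization_map Y f) id"
    by (rule homotopic_with_equal)
      (use continuous_map_compose[OF cf cg] gf in
        \<open>auto simp: realization_map_comp[OF Y X f g] realization_map_id[OF X]\<close>)
  show "homotopic_with (\<lambda>_. True) (realization Y) (realization Y)
      (realization_map Y f \<circ> realization_map X g) id"
    by (rule homotopic_with_eq[OF fg])
      (auto simp: realization_map_comp[OF X Y g f] realization_map_id[OF Y])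
qed (rule f)

text \<open>The degreewise inverses commute with the operators because \<open>f\<close> does and is
  injective; both composites are then identities.\<close>

lemma weak_equivalence_iso:
  assumes X: "simplicial_set X" and Y: "simplicial_set Y" and f: "simplicial_map X Y f"
    and bij: "\<And>n. bij_betw (f n) (cells X n) (cells Y n)"
  shows "weak_equivalence X Y f"
proof -
  define g where "g n = inv_into (cells X n) (f n)" for n
  have gf: "g n (f n x) = x" if "x \<in> cells X n" for n x
    using bij that by (auto simp: g_def bij_betw_def)
  have g_in: "g n y \<in> cells X n" and fg: "f n (g n y) = y" if "y \<in> cells Y n" for n y
    using bij[of n] that by (auto simp: g_def bij_betw_def inv_into_into f_inv_into_f)
  have g: "simplicial_map Y X g"
    unfolding simplicial_map_def
  proof (intro conjI allI ballI funcsetI)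
    fix m n \<theta> y assume *: "\<theta> \<in> Delta m n" "y \<in> cells Y n"
    have "act Y m n \<theta> y = f m (act X m n \<theta> (g n y))"
      using simplicial_map_act[OF f *(1) g_in[OF *(2)]] fg[OF *(2)] by simp
    then show "g m (act Y m n \<theta> y) = act X m n \<theta> (g n y)"
      using gf simplicial_set_act[OF X *(1) g_in[OF *(2)]] by simp
  qed (rule g_in)
  have "homotopic_with (\<lambda>_. True) (realization Y) (realization Y)
        (realization_map Y (\<lambda>n y. f n (g n y))) (realization_map Y (\<lambda>n y. y))"
    by (rule homotopic_with_equal)
      (auto intro!: continuous_map_realization_map simplicial_map_comp[OF g f] Y
        simp: fg realization_map_id[OF Y] simplicial_map_def)
  from weak_equivalence_deformation[OF X Y f g gf this] show ?thesis .
qed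

section \<open>Simplices of the classifying diagram as grid diagrams\<close>

text \<open>An arrow of \<open>[m]\<close> is a pair of indices and a composable pair is a chain
  \<open>i \<le> j \<le> k\<close>, so functoriality can be written with bounded indices. Both
  directions of the grid use this form.\<close>

lemma functors_ordinal:
  "F \<in> functors (ordinal m) B \<longleftrightarrow>
     fst F \<in> extensional {..m} \<and> snd F \<in> extensional (Arr (ordinal m)) \<and>
     (\<forall>i\<le>m. fst F i \<in> Obj B) \<and>
     (\<forall>i j. i \<le> j \<longrightarrow> j \<le> m \<longrightarrow> snd F (i, j) \<in> Arr B \<and>
        Dom B (snd F (i, j)) = fst F i \<and> Cod B (snd F (i, j)) = fst F j) \<and>
     (\<forall>i\<le>m. snd F (i, i) = Ident B (fst F i)) \<and>
     (\<forall>i j k. i \<le> j \<longrightarrow> j \<le> k \<longrightarrow> k \<le> m \<longrightarrow> Comp B (snd F (j, k)) (snd F (i, j)) = snd F (i, k))"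
proof -
  have A: "(\<forall>f\<in>Arr (ordinal m). P f) \<longleftrightarrow> (\<forall>i j. i \<le> j \<longrightarrow> j \<le> m \<longrightarrow> P (i, j))" for P
    by (auto simp: ordinal_def)
  have B: "(\<forall>f\<in>Arr (ordinal m). \<forall>g\<in>Arr (ordinal m). Cod (ordinal m) f = Dom (ordinal m) g \<longrightarrow> P f g)
      \<longleftrightarrow> (\<forall>i j k. i \<le> j \<longrightarrow> j \<le> k \<longrightarrow> k \<le> m \<longrightarrow> P (i, j) (j, k))" for P
    unfolding A by (auto simp: ordinal_def)
  have C: "(\<forall>x\<in>Obj (ordinal m). P x) \<longleftrightarrow> (\<forall>i\<le>m. P i)" for P
    by (auto simp: ordinal_def)
  have "F \<in> functors (ordinal m) B \<longleftrightarrow>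
     (fst F \<in> extensional (Obj (ordinal m)) \<and> (\<forall>i\<le>m. fst F i \<in> Obj B)) \<and>
     (snd F \<in> extensional (Arr (ordinal m)) \<and> (\<forall>i j. i \<le> j \<longrightarrow> j \<le> m \<longrightarrow> snd F (i, j) \<in> Arr B)) \<and>
     (\<forall>i j. i \<le> j \<longrightarrow> j \<le> m \<longrightarrow> Dom B (snd F (i, j)) = fst F (Dom (ordinal m) (i, j)) \<and>
         Cod B (snd F (i, j)) = fst F (Cod (ordinal m) (i, j))) \<and>
     (\<forall>i\<le>m. snd F (Ident (ordinal m) i) = Ident B (fst F i)) \<and>
     (\<forall>i j k. i \<le> j \<longrightarrow> j \<le> k \<longrightarrow> k \<le> m \<longrightarrow>
        snd F (Comp (ordinal m) (j, k) (i, j)) = Comp B (snd F (j, k)) (snd F (i, j)))"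
    unfolding functors_def mem_Collect_eq PiE_iff B unfolding A C by (simp only: conj_ac)
  also have "\<dots> \<longleftrightarrow>
     (fst F \<in> extensional {..m} \<and> (\<forall>i\<le>m. fst F i \<in> Obj B)) \<and>
     (snd F \<in> extensional (Arr (ordinal m)) \<and> (\<forall>i j. i \<le> j \<longrightarrow> j \<le> m \<longrightarrow> snd F (i, j) \<in> Arr B)) \<and>
     (\<forall>i j. i \<le> j \<longrightarrow> j \<le> m \<longrightarrow> Dom B (snd F (i, j)) = fst F i \<and>
         Cod B (snd F (i, j)) = fst F j) \<and>
     (\<forall>i\<le>m. snd F (i, i) = Ident B (fst F i)) \<and>
     (\<forall>i j k. i \<le> j \<longrightarrow> j \<le> k \<longrightarrow> k \<le> m \<longrightarrow> snd F (i, k) = Comp B (snd F (j, k)) (snd F (i, j)))"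
    by (simp only: ordinal_def cat.simps fst_conv snd_conv)
  finally show ?thesis
    unfolding eq_commute[of "Comp B (snd F (j, k)) (snd F (i, j))" "snd F (i, k)" for i j k] by blast
qed

lemma nat_transformations_ordinal:
  "(F, G, \<eta>) \<in> nat_transformations (ordinal m) B \<longleftrightarrow>
     F \<in> functors (ordinal m) B \<and> G \<in> functors (ordinal m) B \<and> \<eta> \<in> extensional {..m} \<and>
     (\<forall>i\<le>m. \<eta> i \<in> Arr B \<and> Dom B (\<eta> i) = fst F i \<and> Cod B (\<eta> i) = fst G i) \<and>
     (\<forall>i j. i \<le> j \<longrightarrow> j \<le> m \<longrightarrow> Comp B (snd G (i, j)) (\<eta> i) = Comp B (\<eta> j) (snd F (i, j)))"
  by (auto simp: nat_transformations_def ordinal_def PiE_iff Pi_iff)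

section \<open>Monotone maps, horns and the boundary of \<open>F(k)\<close>\<close>

lemma Arr_ordinal: "(i, j) \<in> Arr (ordinal n) \<longleftrightarrow> i \<le> j \<and> j \<le> n"
  and Obj_ordinal: "Obj (ordinal n) = {..n}"
  by (auto simp: ordinal_def)

lemma DeltaD:
  assumes "\<theta> \<in> Delta m n"
  shows "i \<le> m \<Longrightarrow> \<theta> i \<le> n" "i \<le> j \<Longrightarrow> j \<le> m \<Longrightarrow> \<theta> i \<le> \<theta> j"
  using assms by (auto simp: Delta_def mono_on_def)

lemma fst_mono_functor: "fst (mono_functor m \<theta>) = restrict \<theta> {..m}"
  by (simp add: mono_functor_def)

lemma Delta_compose:
  assumes "\<theta> \<in> Delta l m" "\<psi> \<in> Delta m n"
  shows "compose {..l} \<psi> \<theta> \<in> Delta l n"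
proof -
  have "compose {..l} \<psi> \<theta> \<in> {..l} \<rightarrow>\<^sub>E {..n}"
    using DeltaD(1)[OF assms(2) DeltaD(1)[OF assms(1)]] by (auto simp: compose_def)
  moreover have "compose {..l} \<psi> \<theta> i \<le> compose {..l} \<psi> \<theta> j" if "i \<le> j" "j \<le> l" for i j
    using that DeltaD(2)[OF assms(2) DeltaD(2)[OF assms(1) that] DeltaD(1)[OF assms(1)]] by (simp add: compose_def)
  ultimately show ?thesis by (auto simp: Delta_def mono_on_def)
qed

lemma Delta_restrict_id: "restrict id {..n} \<in> Delta n n"
  by (auto simp: Delta_def mono_on_def)

lemma vert_in_Delta: "i \<le> n \<Longrightarrow> vert i \<in> Delta 0 n"
  by (auto simp: vert_def Delta_def mono_on_def)

lemma vert_0 [simp]: "vert i 0 = i"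
  by (simp add: vert_def)

text \<open>\<open>d\<^sub>0\<close> omits the source of an edge and so returns its target;
  \<open>d\<^sub>1\<close> returns the source.\<close>

lemma coface_0: "coface 0 0 = vert 1" "coface 0 (Suc 0) = vert 0"
  by (auto simp: coface_def vert_def)

definition segment :: "nat \<Rightarrow> nat \<Rightarrow> nat" where "segment i = (\<lambda>j\<in>{..1}. i + j)"

lemma segment_in_Delta: "i < k \<Longrightarrow> segment i \<in> Delta 1 k"
  by (auto simp: segment_def Delta_def mono_on_def)

lemma segment_simps [simp]: "j \<le> Suc 0 \<Longrightarrow> segment i j = i + j"
  by (simp add: segment_def)

text \<open>If every edge is a loop, the equivalence closure adds nothing to the diagonal. This is
  how mapping spaces will be seen to have singleton components.\<close>

lemma joined_eq_Id_on:
  assumes "\<And>e. e \<in> cells X 1 \<Longrightarrow> act X 0 1 (vert 0) e = act X 0 1 (vert 1) e"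
  shows "joined X = Id_on (cells X 0)"
proof -
  let ?E = "{(act X 0 1 (vert 0) e, act X 0 1 (vert 1) e) |e. e \<in> cells X 1}"
  have "?E \<union> ?E\<inverse> \<subseteq> Id" using assms by auto
  then have "(?E \<union> ?E\<inverse>)\<^sup>* \<subseteq> Id\<^sup>*" by (rule rtrancl_mono)
  then have "(?E \<union> ?E\<inverse>)\<^sup>* = Id" by auto
  then show ?thesis by (auto simp: joined_def Let_def)
qed

lemma codegeneracy_Delta: "codegeneracy 0 0 \<in> Delta 1 0"
  by (auto simp: codegeneracy_def Delta_def mono_on_def)

lemma codegeneracy_0: "j \<le> 1 \<Longrightarrow> codegeneracy 0 0 j = 0"
  by (auto simp: codegeneracy_def)

text \<open>The simplices of the boundary of the \<open>k\<close>-simplex: those lying in some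
  proper face. \<open>rep_F_dot_cells\<close> identifies them with the cells of
  \<open>rep_F_dot k\<close>.\<close>

definition nonsurjections :: "nat \<Rightarrow> nat \<Rightarrow> (nat \<Rightarrow> nat) set" where
  "nonsurjections k n = {\<theta> \<in> Delta n k. \<theta> ` {..n} \<noteq> {..k}}"

lemma Delta_extensional: "\<theta> \<in> Delta m n \<Longrightarrow> \<theta> \<in> extensional {..m}"
  by (simp add: Delta_def PiE_iff)

lemma compose_restrict_id:
  assumes "\<theta> \<in> Delta m n"
  shows "compose {..m} (restrict id {..n}) \<theta> = \<theta>" "compose {..m} \<theta> (restrict id {..m}) = \<theta>"
  using Delta_extensional[OF assms] DeltaD(1)[OF assms]
  by (auto simp: compose_def fun_eq_iff extensional_def)

lemma compose_assoc_Delta: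
  assumes "\<theta> \<in> Delta l m" "\<psi> \<in> Delta m n"
  shows "compose {..l} (compose {..m} \<kappa> \<psi>) \<theta> = compose {..l} \<kappa> (compose {..l} \<psi> \<theta>)"
  using DeltaD(1)[OF assms(1)] by (auto simp: compose_def fun_eq_iff)

lemma nonsurjections_compose:
  assumes "\<theta> \<in> Delta l m" "\<psi> \<in> nonsurjections k m"
  shows "compose {..l} \<psi> \<theta> \<in> nonsurjections k l"
proof -
  have \<psi>: "\<psi> \<in> Delta m k" "\<psi> ` {..m} \<noteq> {..k}" using assms(2) by (auto simp: nonsurjections_def)
  have "compose {..l} \<psi> \<theta> ` {..l} \<subseteq> \<psi> ` {..m}"
    using DeltaD(1)[OF assms(1)] by (auto simp: compose_def)
  moreover have "\<psi> ` {..m} \<subset> {..k}"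
    using \<psi> DeltaD(1)[OF \<psi>(1)] by auto
  ultimately show ?thesis
    using Delta_compose[OF assms(1) \<psi>(1)] by (auto simp: nonsurjections_def)
qed

text \<open>A choice of preimages of a monotone surjection is itself monotone: if
  \<open>s j < s i\<close> with \<open>i \<le> j\<close>, applying \<open>\<theta>\<close> gives
  \<open>j \<le> i\<close>, hence \<open>i = j\<close>, a contradiction.\<close>

lemma surjection_section:
  assumes \<theta>: "\<theta> \<in> Delta n k" and surj: "\<theta> ` {..n} = {..k}"
  obtains s where "s \<in> Delta k n" "compose {..k} \<theta> s = restrict id {..k}"
proof
  define s where "s = (\<lambda>j\<in>{..k}. LEAST i. i \<le> n \<and> \<theta> i = j)"
  have ex: "\<exists>i. i \<le> n \<and> \<theta> i = j" if "j \<le> k" for j using surj that by force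
  have s: "s j \<le> n \<and> \<theta> (s j) = j" if "j \<le> k" for j
    unfolding s_def using LeastI_ex[OF ex[OF that]] that by simp
  have "s i \<le> s j" if "i \<le> j" "j \<le> k" for i j
  proof (rule ccontr)
    assume "\<not> s i \<le> s j"
    then have "\<theta> (s j) \<le> \<theta> (s i)" using DeltaD(2)[OF \<theta>, of "s j" "s i"] s[of i] that by simp
    then have "i = j" using s[of i] s[of j] that by simp
    with \<open>\<not> s i \<le> s j\<close> show False by simp
  qed
  moreover have "s \<in> {..k} \<rightarrow>\<^sub>E {..n}" using s by (auto simp: s_def)
  ultimately show "s \<in> Delta k n" by (auto simp: Delta_def mono_on_def)
  show "compose {..k} \<theta> s = restrict id {..k}"
    using s by (auto simp: compose_def fun_eq_iff)
qed

text \<open>Simplicial spaces of maps \<open>[i] \<rightarrow> [k]\<close> that are discrete in the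
  space direction. \<open>F(k)\<close> and its boundary are both of this kind, so mapping spaces out
  of them can be described once.\<close>

definition represents :: "(nat \<Rightarrow> nat) sspace \<Rightarrow> (nat \<Rightarrow> (nat \<Rightarrow> nat) set) \<Rightarrow> bool" where
  "represents A T \<longleftrightarrow> (\<forall>i p. cells (space_at A i) p = T i) \<and>
     (\<forall>i p q \<tau> \<psi>. act (space_at A i) p q \<tau> \<psi> = \<psi>) \<and>
     (\<forall>m i \<theta> p \<psi>. oper A m i \<theta> p \<psi> = compose {..m} \<psi> \<theta>)"

lemma represents_rep_F: "represents (rep_F k) (\<lambda>n. Delta n k)"
  by (simp add: represents_def rep_F_def discrete_sset_def)

lemma nonsurjections_subobject: "subobject (rep_F k) (\<lambda>n p. nonsurjections k n)"
proof -
  let ?X = "subspace_of (rep_F k) (\<lambda>n p. nonsurjections k n)"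
  have X: "cells (space_at ?X n) p = nonsurjections k n" "act (space_at ?X n) p q \<tau> \<psi> = \<psi>"
    "oper ?X m n \<theta> p \<psi> = compose {..m} \<psi> \<theta>" for m n p q \<tau> \<psi> \<theta>
    by (simp_all add: subspace_of_def rep_F_def discrete_sset_def)
  have D: "\<psi> \<in> Delta n k" if "\<psi> \<in> nonsurjections k n" for \<psi> n
    using that by (simp add: nonsurjections_def)
  have "simplicial_space ?X"
    unfolding simplicial_space_def simplicial_set_def simplicial_map_def X
    by (auto simp: nonsurjections_compose compose_restrict_id(2)[OF D] compose_assoc_Delta[OF _ _])
  then show ?thesis
    unfolding subobject_def using D by (auto simp: rep_F_def discrete_sset_def)
qed

text \<open>Acting on a surjection by a section produces the identity of \<open>[k]\<close>, so a
  subobject avoiding the identity contains no surjection; conversely the nonsurjections form such a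
  subobject.\<close>

lemma rep_F_dot_cells: "cells (space_at (rep_F_dot k) n) p = nonsurjections k n"
proof -
  have "\<theta> \<in> nonsurjections k n"
    if S: "subobject (rep_F k) S" and id: "\<forall>q. restrict id {..k} \<notin> S k q" and \<theta>: "\<theta> \<in> S n p" for S \<theta>
  proof -
    have \<theta>D: "\<theta> \<in> Delta n k"
      using S \<theta> by (auto simp: subobject_def rep_F_def discrete_sset_def)
    have "\<theta> ` {..n} \<noteq> {..k}"
    proof
      assume "\<theta> ` {..n} = {..k}"
      then obtain s where s: "s \<in> Delta k n" "compose {..k} \<theta> s = restrict id {..k}"
        using surjection_section[OF \<theta>D] by blast
      have "simplicial_map (space_at (subspace_of (rep_F k) S) n) (space_at (subspace_of (rep_F k) S) k)
          (oper (subspace_of (rep_F k) S) k n s)"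
        using S s(1) unfolding subobject_def simplicial_space_def by blast
      then have "oper (subspace_of (rep_F k) S) k n s p \<theta> \<in> S k p"
        using \<theta> by (auto simp: simplicial_map_def subspace_of_def)
      then show False
        using id s(2) by (simp add: subspace_of_def rep_F_def)
    qed
    then show ?thesis using \<theta>D by (simp add: nonsurjections_def)
  qed
  moreover have "restrict id {..k} \<notin> nonsurjections k k"
    by (simp add: nonsurjections_def)
  ultimately show ?thesis
    unfolding rep_F_dot_def subspace_of_def using nonsurjections_subobject by auto blast
qed

lemma represents_rep_F_dot: "represents (rep_F_dot k) (nonsurjections k)"
  unfolding represents_def rep_F_dot_cells
  by (simp add: rep_F_dot_def subspace_of_def rep_F_def discrete_sset_def)

lemma horn_cells:
  "\<sigma> \<in> cells (horn n r) m \<longleftrightarrow> \<sigma> \<in> Delta m n \<and> (\<exists>j\<le>n. j \<noteq> r \<and> (\<forall>i\<le>m. \<sigma> i \<noteq> j))"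
  by (auto simp: horn_def image_iff Bex_def)

lemma horn_act: "act (horn n r) l m \<theta> \<sigma> = compose {..l} \<sigma> \<theta>"
  by (simp add: horn_def std_simplex_def)

lemma std_simplex_cells: "cells (std_simplex n) m = Delta m n"
  by (simp add: std_simplex_def)

lemma std_simplex_act: "act (std_simplex n) l m \<theta> \<sigma> = compose {..l} \<sigma> \<theta>"
  by (simp add: std_simplex_def)

lemma horn_compose:
  assumes "\<sigma> \<in> cells (horn n r) m" "\<tau> \<in> Delta l m"
  shows "compose {..l} \<sigma> \<tau> \<in> cells (horn n r) l"
  using assms Delta_compose[OF assms(2), of \<sigma> n] DeltaD(1)[OF assms(2)]
  unfolding horn_cells by (metis atMost_iff compose_eq)

definition edge :: "nat \<Rightarrow> nat \<Rightarrow> nat \<Rightarrow> nat" where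
  "edge a b = (\<lambda>j\<in>{..1}. if j = 0 then a else b)"

lemma edge_simps [simp]: "edge a b 0 = a" "edge a b (Suc 0) = b"
  by (simp_all add: edge_def)

lemma edge_in_Delta: "a \<le> b \<Longrightarrow> b \<le> n \<Longrightarrow> edge a b \<in> Delta 1 n"
  by (auto simp: Delta_def mono_on_def edge_def)

lemma compose_vert: "j \<le> m \<Longrightarrow> compose {..0} \<sigma> (vert j) = vert (\<sigma> j)"
  by (auto simp: compose_def vert_def)

lemma compose_edge: "compose {..1} \<sigma> (edge a b) = edge (\<sigma> a) (\<sigma> b)"
  by (auto simp: compose_def edge_def)

section \<open>Isomorphisms in \<open>C\<close> and in its diagram categories\<close>

context small_category
begin

abbreviation cmp (infixr "\<cdot>" 70) where "g \<cdot> f \<equiv> Comp C g f"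

definition hom where "hom f a b \<longleftrightarrow> f \<in> Arr C \<and> Dom C f = a \<and> Cod C f = b"

definition iso where "iso f a b \<longleftrightarrow> hom f a b \<and> invertible_arrow C f"

definition inverse_arrow where
  "inverse_arrow f = (SOME g. hom g (Cod C f) (Dom C f) \<and>
     g \<cdot> f = Ident C (Dom C f) \<and> f \<cdot> g = Ident C (Cod C f))"

lemma hom_Obj: "hom f a b \<Longrightarrow> a \<in> Obj C \<and> b \<in> Obj C"
  using Dom_in_Obj Cod_in_Obj by (auto simp: hom_def)

lemma hom_Ident: "a \<in> Obj C \<Longrightarrow> hom (Ident C a) a a"
  by (simp add: hom_def Ident_in_Arr Dom_Ident Cod_Ident)

lemma hom_comp: "hom f a b \<Longrightarrow> hom g b c \<Longrightarrow> hom (g \<cdot> f) a c"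
  by (simp add: hom_def Comp_in_Arr Dom_Comp Cod_Comp)

lemma hom_comp_Ident: "hom f a b \<Longrightarrow> f \<cdot> Ident C a = f" "hom f a b \<Longrightarrow> Ident C b \<cdot> f = f"
  using Comp_Ident_right Comp_Ident_left by (auto simp: hom_def)

lemma hom_assoc: "hom f a b \<Longrightarrow> hom g b c \<Longrightarrow> hom h c d \<Longrightarrow> (h \<cdot> g) \<cdot> f = h \<cdot> (g \<cdot> f)"
  using Comp_assoc[of f g h] by (simp add: hom_def)

lemma iso_hom: "iso f a b \<Longrightarrow> hom f a b"
  by (simp add: iso_def)

lemma inverse_arrow:
  assumes "iso f a b"
  shows "hom (inverse_arrow f) b a" "inverse_arrow f \<cdot> f = Ident C a" "f \<cdot> inverse_arrow f = Ident C b"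
proof -
  have "\<exists>g. hom g (Cod C f) (Dom C f) \<and> g \<cdot> f = Ident C (Dom C f) \<and> f \<cdot> g = Ident C (Cod C f)"
    using assms by (auto simp: iso_def invertible_arrow_def hom_def)
  from someI_ex[OF this] show "hom (inverse_arrow f) b a"
    "inverse_arrow f \<cdot> f = Ident C a" "f \<cdot> inverse_arrow f = Ident C b"
    using assms by (auto simp: inverse_arrow_def iso_def hom_def)
qed

lemma isoI:
  assumes "hom f a b" "hom g b a" "g \<cdot> f = Ident C a" "f \<cdot> g = Ident C b"
  shows "iso f a b"
  using assms by (auto simp: iso_def invertible_arrow_def hom_def)

lemma iso_inverse_arrow: "iso f a b \<Longrightarrow> iso (inverse_arrow f) b a"
  by (rule isoI[of _ _ _ f]) (auto simp: inverse_arrow iso_hom)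

lemma iso_Ident: "a \<in> Obj C \<Longrightarrow> iso (Ident C a) a a"
  by (rule isoI[of _ _ _ "Ident C a"]) (auto simp: hom_Ident hom_comp_Ident[OF hom_Ident])

lemma comp_inverse_cancel:
  assumes "iso f a b"
  shows "hom g a c \<Longrightarrow> (g \<cdot> inverse_arrow f) \<cdot> f = g"
    and "hom g b c \<Longrightarrow> (g \<cdot> f) \<cdot> inverse_arrow f = g"
    and "hom g c b \<Longrightarrow> f \<cdot> inverse_arrow f \<cdot> g = g"
    and "hom g c a \<Longrightarrow> inverse_arrow f \<cdot> f \<cdot> g = g"
proof -
  note f = iso_hom[OF assms] and i = inverse_arrow[OF assms]
  show "(g \<cdot> inverse_arrow f) \<cdot> f = g" if g: "hom g a c"
    using hom_assoc[OF f i(1) g] i(2) hom_comp_Ident(1)[OF g] by simp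
  show "(g \<cdot> f) \<cdot> inverse_arrow f = g" if g: "hom g b c"
    using hom_assoc[OF i(1) f g] i(3) hom_comp_Ident(1)[OF g] by simp
  show "f \<cdot> inverse_arrow f \<cdot> g = g" if g: "hom g c b"
    using hom_assoc[OF g i(1) f] i(3) hom_comp_Ident(2)[OF g] by simp
  show "inverse_arrow f \<cdot> f \<cdot> g = g" if g: "hom g c a"
    using hom_assoc[OF g f i(1)] i(2) hom_comp_Ident(2)[OF g] by simp
qed

lemma iso_comp:
  assumes "iso f a b" "iso g b c"
  shows "iso (g \<cdot> f) a c"
proof (rule isoI[of _ _ _ "inverse_arrow f \<cdot> inverse_arrow g"])
  note f = inverse_arrow[OF assms(1)] and g = inverse_arrow[OF assms(2)]
  note h = assms[THEN iso_hom]
  show "hom (g \<cdot> f) a c" "hom (inverse_arrow f \<cdot> inverse_arrow g) c a"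
    using h f g hom_comp by blast+
  show "(inverse_arrow f \<cdot> inverse_arrow g) \<cdot> g \<cdot> f = Ident C a"
    using hom_assoc[OF hom_comp[OF h] g(1) f(1)] comp_inverse_cancel(4)[OF assms(2) h(1)] f by simp
  show "(g \<cdot> f) \<cdot> inverse_arrow f \<cdot> inverse_arrow g = Ident C c"
    using hom_assoc[OF hom_comp[OF g(1) f(1)] h] comp_inverse_cancel(3)[OF assms(1) g(1)] g by simp
qed

lemma iso_cancel_right:
  assumes "iso f a b" "hom g b c" "hom h b c" "g \<cdot> f = h \<cdot> f"
  shows "g = h"
  using comp_inverse_cancel(2)[OF assms(1)] assms(2-4) by metis

lemma iso_cancel_left:
  assumes "iso f a b" "hom g c a" "hom h c a" "f \<cdot> g = f \<cdot> h"
  shows "g = h"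
  using comp_inverse_cancel(4)[OF assms(1)] assms(2-4) by metis

text \<open>Composing the naturality square of \<open>\<eta>\<close> with the inverse components on
  both sides gives the naturality square of the inverses.\<close>

lemma invertible_nat_trans:
  assumes t: "(F, G, \<eta>) \<in> nat_transformations (ordinal m) C"
  shows "invertible_arrow (functor_cat (ordinal m) C) (F, G, \<eta>) \<longleftrightarrow> (\<forall>j\<le>m. invertible_arrow C (\<eta> j))"
proof
  assume "invertible_arrow (functor_cat (ordinal m) C) (F, G, \<eta>)"
  then obtain \<tau> where \<tau>: "(G, F, \<tau>) \<in> nat_transformations (ordinal m) C"
    and 1: "(\<lambda>j\<in>{..m}. \<tau> j \<cdot> \<eta> j) = (\<lambda>j\<in>{..m}. Ident C (fst F j))"
    and 2: "(\<lambda>j\<in>{..m}. \<eta> j \<cdot> \<tau> j) = (\<lambda>j\<in>{..m}. Ident C (fst G j))"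
    by (auto simp: invertible_arrow_def functor_cat_def Obj_ordinal)
  show "\<forall>j\<le>m. invertible_arrow C (\<eta> j)"
  proof (intro allI impI)
    fix j assume "j \<le> m"
    then show "invertible_arrow C (\<eta> j)"
      using t \<tau> fun_cong[OF 1, of j] fun_cong[OF 2, of j]
      by (auto simp: nat_transformations_ordinal invertible_arrow_def)
  qed
next
  assume inv: "\<forall>j\<le>m. invertible_arrow C (\<eta> j)"
  note t' = t[unfolded nat_transformations_ordinal]
  have iso: "iso (\<eta> j) (fst F j) (fst G j)" if "j \<le> m" for j
    using t' inv that by (auto simp: iso_def hom_def)
  define \<tau> where "\<tau> = (\<lambda>j\<in>{..m}. inverse_arrow (\<eta> j))"
  have "(G, F, \<tau>) \<in> nat_transformations (ordinal m) C"
    unfolding nat_transformations_ordinal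
  proof (intro conjI allI impI)
    fix i j assume ij: "i \<le> j" "j \<le> m"
    then have F: "hom (snd F (i, j)) (fst F i) (fst F j)" and G: "hom (snd G (i, j)) (fst G i) (fst G j)"
      and nat: "snd G (i, j) \<cdot> \<eta> i = \<eta> j \<cdot> snd F (i, j)"
      using t' by (auto simp: functors_ordinal hom_def)
    note i = iso[OF order_trans[OF ij]] and j = iso[OF ij(2)]
    have "snd F (i, j) \<cdot> inverse_arrow (\<eta> i)
        = inverse_arrow (\<eta> j) \<cdot> (\<eta> j \<cdot> snd F (i, j)) \<cdot> inverse_arrow (\<eta> i)"
      using hom_assoc[OF inverse_arrow(1)[OF i] F iso_hom[OF j]]
        comp_inverse_cancel(4)[OF j hom_comp[OF inverse_arrow(1)[OF i] F]] by simp
    also have "\<dots> = inverse_arrow (\<eta> j) \<cdot> snd G (i, j)"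
      unfolding nat[symmetric] using comp_inverse_cancel(2)[OF i G] by simp
    finally show "snd F (i, j) \<cdot> \<tau> i = \<tau> j \<cdot> snd G (i, j)"
      using ij by (simp add: \<tau>_def)
  qed (use t' inverse_arrow(1)[OF iso] in \<open>auto simp: \<tau>_def hom_def\<close>)
  moreover have "(\<lambda>j\<in>{..m}. \<tau> j \<cdot> \<eta> j) = (\<lambda>j\<in>{..m}. Ident C (fst F j))"
    "(\<lambda>j\<in>{..m}. \<eta> j \<cdot> \<tau> j) = (\<lambda>j\<in>{..m}. Ident C (fst G j))"
    by (rule restrict_ext; simp add: \<tau>_def inverse_arrow[OF iso])+
  ultimately show "invertible_arrow (functor_cat (ordinal m) C) (F, G, \<eta>)"
    using t by (auto simp: invertible_arrow_def functor_cat_def Obj_ordinal intro!: bexI[of _ "(G, F, \<tau>)"])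
qed

section \<open>Simplices as grid diagrams\<close>

abbreviation NC where "NC \<equiv> classifying_diagram C"

abbreviation cel where "cel m p \<equiv> cells (space_at NC m) p"

text \<open>The object at a grid point is read off the identity arrow there, so a diagram consists
  of arrows only.\<close>

definition vertex_obj where "vertex_obj D i j = Dom C (D i j i j)"

text \<open>\<open>D i j i' j'\<close> goes from grid point \<open>(i, j)\<close> to
  \<open>(i', j')\<close>, with the space direction \<open>[p]\<close> first. All comparable pairs
  are recorded instead of generators, so that monotone reindexing is substitution. Invertibility is
  demanded along \<open>[p]\<close> only.\<close>

definition diagram :: "nat \<Rightarrow> nat \<Rightarrow> (nat \<Rightarrow> nat \<Rightarrow> nat \<Rightarrow> nat \<Rightarrow> 'm) \<Rightarrow> bool" where
  "diagram m p D \<longleftrightarrow>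
     (\<forall>i i' j j'. i \<le> i' \<longrightarrow> i' \<le> p \<longrightarrow> j \<le> j' \<longrightarrow> j' \<le> m \<longrightarrow>
        hom (D i j i' j') (vertex_obj D i j) (vertex_obj D i' j')) \<and>
     (\<forall>i j. i \<le> p \<longrightarrow> j \<le> m \<longrightarrow> D i j i j = Ident C (vertex_obj D i j)) \<and>
     (\<forall>i i' i'' j j' j''. i \<le> i' \<longrightarrow> i' \<le> i'' \<longrightarrow> i'' \<le> p \<longrightarrow> j \<le> j' \<longrightarrow> j' \<le> j'' \<longrightarrow> j'' \<le> m \<longrightarrow>
        D i' j' i'' j'' \<cdot> D i j i' j' = D i j i'' j'') \<and>
     (\<forall>i i' j. i \<le> i' \<longrightarrow> i' \<le> p \<longrightarrow> j \<le> m \<longrightarrow> invertible_arrow C (D i j i' j))"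

definition row where
  "row m D i = (\<lambda>j\<in>{..m}. vertex_obj D i j, \<lambda>(j, j')\<in>Arr (ordinal m). D i j i j')"

definition cell_of where
  "cell_of m p D = (\<lambda>i\<in>{..p}. row m D i,
     \<lambda>(i, i')\<in>Arr (ordinal p). (row m D i, row m D i', \<lambda>j\<in>{..m}. D i j i' j))"

text \<open>The diagonal of a naturality square: along row \<open>i\<close> from \<open>j\<close> to
  \<open>j'\<close>, then down column \<open>j'\<close> from \<open>i\<close> to
  \<open>i'\<close>.\<close>

definition arrow where
  "arrow x i j i' j' = snd (snd (snd x (i, i'))) j' \<cdot> snd (fst x i) (j, j')"

lemma diagram_hom:
  assumes "diagram m p D" "i \<le> i'" "i' \<le> p" "j \<le> j'" "j' \<le> m"
  shows "hom (D i j i' j') (vertex_obj D i j) (vertex_obj D i' j')"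
  using assms by (simp add: diagram_def)

lemma diagram_Ident:
  assumes "diagram m p D" "i \<le> p" "j \<le> m"
  shows "D i j i j = Ident C (vertex_obj D i j)"
  using assms by (simp add: diagram_def)

lemma diagram_comp:
  assumes "diagram m p D" "i \<le> i'" "i' \<le> i''" "i'' \<le> p" "j \<le> j'" "j' \<le> j''" "j'' \<le> m"
  shows "D i' j' i'' j'' \<cdot> D i j i' j' = D i j i'' j''"
  using assms by (simp add: diagram_def)

lemma diagram_iso:
  assumes "diagram m p D" "i \<le> i'" "i' \<le> p" "j \<le> m"
  shows "iso (D i j i' j) (vertex_obj D i j) (vertex_obj D i' j)"
  using assms diagram_hom[OF assms(1-3) order_refl assms(4)] by (simp add: diagram_def iso_def)

lemma row_in_functors:
  assumes "diagram m p D" "i \<le> p"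
  shows "row m D i \<in> functors (ordinal m) C"
  unfolding functors_ordinal
proof (intro conjI allI impI)
  show "fst (row m D i) \<in> extensional {..m}" "snd (row m D i) \<in> extensional (Arr (ordinal m))"
    by (simp_all add: row_def)
next
  fix j assume "j \<le> m"
  then show "fst (row m D i) j \<in> Obj C" "snd (row m D i) (j, j) = Ident C (fst (row m D i) j)"
    using hom_Obj[OF diagram_hom[OF assms(1) order_refl assms(2) order_refl, of j]]
      diagram_Ident[OF assms, of j]
    by (simp_all add: row_def Arr_ordinal)
next
  fix j j' assume "j \<le> j'" "j' \<le> m"
  then show "snd (row m D i) (j, j') \<in> Arr C"
    "Dom C (snd (row m D i) (j, j')) = fst (row m D i) j"
    "Cod C (snd (row m D i) (j, j')) = fst (row m D i) j'"
    using diagram_hom[OF assms(1) order_refl assms(2), of j j']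
    by (simp_all add: row_def Arr_ordinal hom_def)
next
  fix j j' j'' assume "j \<le> j'" "j' \<le> j''" "j'' \<le> m"
  then show "snd (row m D i) (j', j'') \<cdot> snd (row m D i) (j, j') = snd (row m D i) (j, j'')"
    using diagram_comp[OF assms(1) order_refl order_refl assms(2)]
    by (simp add: row_def Arr_ordinal)
qed

lemma nat_trans_row:
  assumes "diagram m p D" "i \<le> i'" "i' \<le> p"
  shows "(row m D i, row m D i', \<lambda>j\<in>{..m}. D i j i' j) \<in> nat_transformations (ordinal m) C"
  unfolding nat_transformations_ordinal
proof (intro conjI allI impI)
  show "row m D i \<in> functors (ordinal m) C" "row m D i' \<in> functors (ordinal m) C"
    using row_in_functors[OF assms(1)] assms by auto
  show "(\<lambda>j\<in>{..m}. D i j i' j) \<in> extensional {..m}" by simp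
next
  fix j assume "j \<le> m"
  then show "(\<lambda>j\<in>{..m}. D i j i' j) j \<in> Arr C"
    "Dom C ((\<lambda>j\<in>{..m}. D i j i' j) j) = fst (row m D i) j"
    "Cod C ((\<lambda>j\<in>{..m}. D i j i' j) j) = fst (row m D i') j"
    using diagram_hom[OF assms order_refl, of j] by (auto simp: hom_def row_def)
next
  fix j j' assume "j \<le> j'" "j' \<le> m"
  then show "snd (row m D i') (j, j') \<cdot> (\<lambda>j\<in>{..m}. D i j i' j) j =
     (\<lambda>j\<in>{..m}. D i j i' j) j' \<cdot> snd (row m D i) (j, j')"
    using diagram_comp[OF assms(1,2) order_refl assms(3) order_refl, of j j']
      diagram_comp[OF assms(1) order_refl assms(2,3) _ order_refl, of j j']
    by (simp add: row_def Arr_ordinal)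
qed

lemma arrow_cell_of:
  assumes D: "diagram m p D" and *: "i \<le> i'" "i' \<le> p" "j \<le> j'" "j' \<le> m"
  shows "arrow (cell_of m p D) i j i' j' = D i j i' j'"
  using * diagram_comp[OF D order_refl *(1-3) order_refl *(4)]
  by (simp add: arrow_def cell_of_def row_def Arr_ordinal)

text \<open>\<open>cell_of\<close> reads \<open>D\<close> at comparable pairs of grid points only,
  so values elsewhere may be arbitrary.\<close>

lemma cell_of_cong:
  assumes "\<And>i i' j j'. i \<le> i' \<Longrightarrow> i' \<le> p \<Longrightarrow> j \<le> j' \<Longrightarrow> j' \<le> m \<Longrightarrow> D i j i' j' = E i j i' j'"
  shows "cell_of m p D = cell_of m p E"
proof -
  have "row m D i = row m E i" if "i \<le> p" for i
    unfolding row_def vertex_obj_def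
    using assms that by (auto intro!: restrict_ext simp: Arr_ordinal)
  then show ?thesis
    unfolding cell_of_def Arr_ordinal using assms
    by (intro arg_cong2[where f = Pair] restrict_ext) (auto simp: Arr_ordinal intro!: restrict_ext)
qed

lemma cel_eq: "cel m p = functors (ordinal p) (iso_subgroupoid (functor_cat (ordinal m) C))"
  by (simp add: classifying_diagram_def nerve_def)

lemma cell_of_in_cel:
  assumes D: "diagram m p D"
  shows "cell_of m p D \<in> cel m p"
  unfolding cel_eq functors_ordinal
proof (intro conjI allI impI)
  show "fst (cell_of m p D) \<in> extensional {..p}" "snd (cell_of m p D) \<in> extensional (Arr (ordinal p))"
    by (auto simp: cell_of_def)
next
  fix i assume "i \<le> p"
  then show "fst (cell_of m p D) i \<in> Obj (iso_subgroupoid (functor_cat (ordinal m) C))"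
    by (simp add: cell_of_def iso_subgroupoid_def functor_cat_def row_in_functors[OF D])
  show "snd (cell_of m p D) (i, i) =
     Ident (iso_subgroupoid (functor_cat (ordinal m) C)) (fst (cell_of m p D) i)"
    using \<open>i \<le> p\<close> diagram_Ident[OF D \<open>i \<le> p\<close>]
    by (auto simp: cell_of_def iso_subgroupoid_def functor_cat_def row_def Arr_ordinal Obj_ordinal
        intro!: restrict_ext)
next
  fix i i' assume *: "i \<le> i'" "i' \<le> p"
  have "invertible_arrow (functor_cat (ordinal m) C) (row m D i, row m D i', \<lambda>j\<in>{..m}. D i j i' j)"
    unfolding invertible_nat_trans[OF nat_trans_row[OF D *]]
    using diagram_iso[OF D *] by (auto simp: iso_def)
  then show "snd (cell_of m p D) (i, i') \<in> Arr (iso_subgroupoid (functor_cat (ordinal m) C))"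
    using * by (simp add: cell_of_def iso_subgroupoid_def Arr_ordinal)
  show "Dom (iso_subgroupoid (functor_cat (ordinal m) C)) (snd (cell_of m p D) (i, i')) =
      fst (cell_of m p D) i"
    "Cod (iso_subgroupoid (functor_cat (ordinal m) C)) (snd (cell_of m p D) (i, i')) =
      fst (cell_of m p D) i'"
    using * by (simp_all add: cell_of_def iso_subgroupoid_def functor_cat_def Arr_ordinal)
next
  fix i j k assume *: "i \<le> j" "j \<le> k" "k \<le> p"
  then show "Comp (iso_subgroupoid (functor_cat (ordinal m) C))
      (snd (cell_of m p D) (j, k)) (snd (cell_of m p D) (i, j)) = snd (cell_of m p D) (i, k)"
    using diagram_comp[OF D *]
    by (auto simp: cell_of_def iso_subgroupoid_def functor_cat_def Arr_ordinal Obj_ordinal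
        intro!: restrict_ext)
qed

text \<open>Split a simplex into row arrows \<open>H\<close> and components \<open>V\<close> of
  natural isomorphisms. Rows and columns compose separately, and naturality lets diagonals
  compose.\<close>

lemma cel_arrow:
  assumes x: "x \<in> cel m p"
  shows diagram_arrow: "diagram m p (arrow x)"
    and cell_of_arrow: "cell_of m p (arrow x) = x"
proof -
  define H where "H i j j' = snd (fst x i) (j, j')" for i j j'
  define V where "V i i' j = snd (snd (snd x (i, i'))) j" for i i' j
  define Ob where "Ob i j = fst (fst x i) j" for i j
  let ?G = "iso_subgroupoid (functor_cat (ordinal m) C)"
  note x' = x[unfolded cel_eq functors_ordinal]
  have fn: "fst x i \<in> functors (ordinal m) C" if "i \<le> p" for i
    using x' that by (simp add: iso_subgroupoid_def functor_cat_def)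
  have tr: "snd x (i, i') = (fst x i, fst x i', V i i')"
    and inv: "invertible_arrow (functor_cat (ordinal m) C) (snd x (i, i'))"
    if "i \<le> i'" "i' \<le> p" for i i'
    using x' that by (auto simp: iso_subgroupoid_def functor_cat_def V_def prod_eq_iff case_prod_unfold)
  have nt: "(fst x i, fst x i', V i i') \<in> nat_transformations (ordinal m) C"
    if "i \<le> i'" "i' \<le> p" for i i'
    using inv[OF that] unfolding tr[OF that] by (simp add: invertible_arrow_def functor_cat_def)
  have H: "hom (H i j j') (Ob i j) (Ob i j')" if "i \<le> p" "j \<le> j'" "j' \<le> m" for i j j'
    using fn[OF that(1)] that by (auto simp: functors_ordinal hom_def H_def Ob_def)
  have HI: "H i j j = Ident C (Ob i j)" if "i \<le> p" "j \<le> m" for i j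
    using fn[OF that(1)] that by (auto simp: functors_ordinal H_def Ob_def)
  have HC: "H i j' j'' \<cdot> H i j j' = H i j j''" if "i \<le> p" "j \<le> j'" "j' \<le> j''" "j'' \<le> m" for i j j' j''
    using fn[OF that(1)] that by (simp add: functors_ordinal H_def)
  have V: "iso (V i i' j) (Ob i j) (Ob i' j)" if "i \<le> i'" "i' \<le> p" "j \<le> m" for i i' j
    using nt[OF that(1,2)] inv[OF that(1,2)] invertible_nat_trans[OF nt[OF that(1,2)]] that
    unfolding tr[OF that(1,2)] by (auto simp: nat_transformations_ordinal iso_def hom_def Ob_def)
  note Vh = iso_hom[OF V]
  have VI: "V i i j = Ident C (Ob i j)" if "i \<le> p" "j \<le> m" for i j
  proof -
    have "snd x (i, i) = Ident ?G (fst x i)" using x' that by simp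
    then show ?thesis
      using that by (simp add: V_def Ob_def iso_subgroupoid_def functor_cat_def Obj_ordinal)
  qed
  have VC: "V i' i'' j \<cdot> V i i' j = V i i'' j" if "i \<le> i'" "i' \<le> i''" "i'' \<le> p" "j \<le> m" for i i' i'' j
  proof -
    have "snd x (i, i'') = Comp ?G (snd x (i', i'')) (snd x (i, i'))" using x' that by metis
    also have "\<dots> = Comp ?G (fst x i', fst x i'', V i' i'') (fst x i, fst x i', V i i')"
      using that tr[of i i'] tr[of i' i''] by simp
    finally show ?thesis
      using that by (simp add: V_def[of i i''] iso_subgroupoid_def functor_cat_def Obj_ordinal)
  qed
  have nat: "H i' j j' \<cdot> V i i' j = V i i' j' \<cdot> H i j j'"
    if "i \<le> i'" "i' \<le> p" "j \<le> j'" "j' \<le> m" for i i' j j'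
    using nt[OF that(1,2)] that by (simp add: nat_transformations_ordinal H_def)
  have arr: "arrow x i j i' j' = V i i' j' \<cdot> H i j j'" for i j i' j'
    by (simp add: arrow_def V_def H_def)
  have h: "hom (arrow x i j i' j') (Ob i j) (Ob i' j')"
    if "i \<le> i'" "i' \<le> p" "j \<le> j'" "j' \<le> m" for i i' j j'
    unfolding arr using hom_comp[OF H Vh] that by simp
  have aI: "arrow x i j i j' = H i j j'" if "i \<le> p" "j \<le> j'" "j' \<le> m" for i j j'
    unfolding arr using that VI H hom_comp_Ident by metis
  have aV: "arrow x i j i' j = V i i' j" if "i \<le> i'" "i' \<le> p" "j \<le> m" for i j i'
    unfolding arr using that HI[of i j] Vh[of i i' j] hom_comp_Ident by simp
  have vo: "vertex_obj (arrow x) i j = Ob i j" if "i \<le> p" "j \<le> m" for i j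
    using h[of i i j j] that by (simp add: vertex_obj_def hom_def)
  show "diagram m p (arrow x)"
    unfolding diagram_def
  proof (intro conjI allI impI)
    fix i i' i'' j j' j''
    assume *: "i \<le> i'" "i' \<le> i''" "i'' \<le> p" "j \<le> j'" "j' \<le> j''" "j'' \<le> m"
    have 1: "hom (H i j j') (Ob i j) (Ob i j')" "hom (V i i' j') (Ob i j') (Ob i' j')"
      "hom (H i' j' j'') (Ob i' j') (Ob i' j'')" "hom (V i' i'' j'') (Ob i' j'') (Ob i'' j'')"
      "hom (H i j' j'') (Ob i j') (Ob i j'')" "hom (V i i' j'') (Ob i j'') (Ob i' j'')"
      using * H Vh by auto
    have "(V i' i'' j'' \<cdot> H i' j' j'') \<cdot> (V i i' j' \<cdot> H i j j') =
       V i' i'' j'' \<cdot> (H i' j' j'' \<cdot> V i i' j') \<cdot> H i j j'"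
      using hom_assoc[OF hom_comp[OF 1(1,2)] 1(3,4)] hom_assoc[OF 1(1,2,3)] by simp
    \<comment> \<open>The interchange: turning over the naturality square in the middle brings the
      two column arrows together and the two row arrows together.\<close>
    also have "H i' j' j'' \<cdot> V i i' j' = V i i' j'' \<cdot> H i j' j''"
      using * nat by simp
    also have "V i' i'' j'' \<cdot> (V i i' j'' \<cdot> H i j' j'') \<cdot> H i j j' =
       (V i' i'' j'' \<cdot> V i i' j'') \<cdot> (H i j' j'' \<cdot> H i j j')"
      using hom_assoc[OF 1(1,5,6)] hom_assoc[OF hom_comp[OF 1(1,5)] 1(6,4)] by simp
    also have "\<dots> = V i i'' j'' \<cdot> H i j j''" using * VC HC by simp
    finally show "arrow x i' j' i'' j'' \<cdot> arrow x i j i' j' = arrow x i j i'' j''"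
      unfolding arr by simp
  qed (use h vo aI HI V aV iso_def in auto)
  \<comment> \<open>Equality of functions also covers indices out of range, where extensionality
    makes both sides \<open>undefined\<close>.\<close>
  have row: "row m (arrow x) i = fst x i" if "i \<le> p" for i
  proof (rule prod_eqI)
    show "fst (row m (arrow x) i) = fst (fst x i)"
    proof
      fix j show "fst (row m (arrow x) i) j = fst (fst x i) j"
        using fn[OF that] vo[OF that, of j]
        by (cases "j \<le> m") (auto simp: row_def functors_ordinal extensional_def Ob_def)
    qed
    show "snd (row m (arrow x) i) = snd (fst x i)"
    proof
      fix jj show "snd (row m (arrow x) i) jj = snd (fst x i) jj"
        using fn[OF that] aI[OF that, of "fst jj" "snd jj"]
        by (cases "jj \<in> Arr (ordinal m)"; cases jj)
          (auto simp: row_def functors_ordinal extensional_def H_def Arr_ordinal)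
    qed
  qed
  show "cell_of m p (arrow x) = x"
  proof (rule prod_eqI)
    show "fst (cell_of m p (arrow x)) = fst x"
    proof
      fix i show "fst (cell_of m p (arrow x)) i = fst x i"
        using x' row[of i] by (cases "i \<le> p") (auto simp: cell_of_def extensional_def)
    qed
    show "snd (cell_of m p (arrow x)) = snd x"
    proof
      fix ii :: "nat \<times> nat"
      obtain i i' where ii: "ii = (i, i')" by (cases ii)
      show "snd (cell_of m p (arrow x)) ii = snd x ii"
      proof (cases "(i, i') \<in> Arr (ordinal p)")
        case True
        then have *: "i \<le> i'" "i' \<le> p" by (auto simp: Arr_ordinal)
        have "(\<lambda>j\<in>{..m}. arrow x i j i' j) = V i i'"
        proof
          fix j show "(\<lambda>j\<in>{..m}. arrow x i j i' j) j = V i i' j"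
            using nt[OF *] aV[OF *, of j]
            by (cases "j \<le> m") (auto simp: nat_transformations_ordinal extensional_def)
        qed
        then show ?thesis
          using True * row tr[OF *] by (simp add: cell_of_def ii)
      qed (use x' in \<open>auto simp: cell_of_def extensional_def ii\<close>)
    qed
  qed
qed

text \<open>Reduces every later equation between simplices, which are nested pairs of extensional
  functions, to equations between arrows of \<open>C\<close>.\<close>

lemma cel_eqI:
  assumes "x \<in> cel m p" "y \<in> cel m p"
    and "\<And>i i' j j'. i \<le> i' \<Longrightarrow> i' \<le> p \<Longrightarrow> j \<le> j' \<Longrightarrow> j' \<le> m \<Longrightarrow> arrow x i j i' j' = arrow y i j i' j'"
  shows "x = y"
  using cell_of_cong[of p m "arrow x" "arrow y", OF assms(3)]
  unfolding cell_of_arrow[OF assms(1)] cell_of_arrow[OF assms(2)] by simp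

section \<open>Simplicial operators as reindexing of diagrams\<close>

lemma functor_comp_row:
  assumes \<theta>: "\<theta> \<in> Delta m n"
  shows "functor_comp (ordinal m) (row n D i) (mono_functor m \<theta>)
           = row m (\<lambda>i j i' j'. D i (\<theta> j) i' (\<theta> j')) i"
  using DeltaD[OF \<theta>]
  by (auto simp: functor_comp_def row_def mono_functor_def vertex_obj_def Obj_ordinal Arr_ordinal
      intro!: restrict_ext)

lemma oper_cell_of:
  assumes D: "diagram n p D" and \<theta>: "\<theta> \<in> Delta m n"
  shows "oper NC m n \<theta> p (cell_of n p D) = cell_of m p (\<lambda>i j i' j'. D i (\<theta> j) i' (\<theta> j'))"
  using DeltaD[OF \<theta>]
  by (auto simp: classifying_diagram_def nerve_map_def functor_comp_def[of "ordinal p"] precomp_functor_def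
      cell_of_def Obj_ordinal Arr_ordinal row_in_functors[OF D] nat_trans_row[OF D]
      functor_comp_row[OF \<theta>] fst_mono_functor intro!: restrict_ext)

lemma act_cell_of:
  assumes D: "diagram m q D" and \<sigma>: "\<sigma> \<in> Delta p q"
  shows "act (space_at NC m) p q \<sigma> (cell_of m q D) = cell_of m p (\<lambda>i j i' j'. D (\<sigma> i) j (\<sigma> i') j')"
proof -
  have "row m D (\<sigma> i) = row m (\<lambda>i j i' j'. D (\<sigma> i) j (\<sigma> i') j') i" for i
    by (simp add: row_def vertex_obj_def)
  then show ?thesis
    using DeltaD[OF \<sigma>]
    by (auto simp: classifying_diagram_def nerve_def functor_comp_def cell_of_def mono_functor_def
        Obj_ordinal Arr_ordinal intro!: restrict_ext)
qed

text \<open>Monotonicity is required on the index ranges and not through \<open>Delta\<close>, so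
  that plain functions such as \<open>\<lambda>j. j\<close> can stand for the direction that is left
  alone.\<close>

lemma diagram_reindex:
  assumes D: "diagram n q D"
    and \<theta>: "\<And>j. j \<le> m \<Longrightarrow> \<theta> j \<le> n" "\<And>j j'. j \<le> j' \<Longrightarrow> j' \<le> m \<Longrightarrow> \<theta> j \<le> \<theta> j'"
    and \<sigma>: "\<And>i. i \<le> p \<Longrightarrow> \<sigma> i \<le> q" "\<And>i i'. i \<le> i' \<Longrightarrow> i' \<le> p \<Longrightarrow> \<sigma> i \<le> \<sigma> i'"
  shows "diagram m p (\<lambda>i j i' j'. D (\<sigma> i) (\<theta> j) (\<sigma> i') (\<theta> j'))"
proof -
  have v: "vertex_obj (\<lambda>i j i' j'. D (\<sigma> i) (\<theta> j) (\<sigma> i') (\<theta> j')) i j = vertex_obj D (\<sigma> i) (\<theta> j)" for i j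
    by (simp add: vertex_obj_def)
  show ?thesis
    unfolding diagram_def v
  proof (intro conjI allI impI)
    fix i i' j assume *: "i \<le> i'" "i' \<le> p" "j \<le> m"
    show "invertible_arrow C (D (\<sigma> i) (\<theta> j) (\<sigma> i') (\<theta> j))"
      using diagram_iso[OF D \<sigma>(2)[OF *(1,2)] \<sigma>(1)[OF *(2)] \<theta>(1)[OF *(3)]] by (simp add: iso_def)
  qed (auto intro!: diagram_hom[OF D] diagram_Ident[OF D] diagram_comp[OF D] \<theta> \<sigma>)
qed

lemma
  assumes x: "x \<in> cel n p" and \<theta>: "\<theta> \<in> Delta m n"
  shows oper_in_cel: "oper NC m n \<theta> p x \<in> cel m p"
    and arrow_oper: "\<And>i i' j j'. i \<le> i' \<Longrightarrow> i' \<le> p \<Longrightarrow> j \<le> j' \<Longrightarrow> j' \<le> m \<Longrightarrow>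
       arrow (oper NC m n \<theta> p x) i j i' j' = arrow x i (\<theta> j) i' (\<theta> j')"
proof -
  have D: "diagram m p (\<lambda>i j i' j'. arrow x i (\<theta> j) i' (\<theta> j'))"
    by (rule diagram_reindex[where \<sigma> = "\<lambda>i. i", OF diagram_arrow[OF x]]) (auto simp: DeltaD[OF \<theta>])
  have eq: "oper NC m n \<theta> p x = cell_of m p (\<lambda>i j i' j'. arrow x i (\<theta> j) i' (\<theta> j'))"
    using oper_cell_of[OF diagram_arrow[OF x] \<theta>] cell_of_arrow[OF x] by simp
  show "oper NC m n \<theta> p x \<in> cel m p"
    unfolding eq by (rule cell_of_in_cel[OF D])
  show "arrow (oper NC m n \<theta> p x) i j i' j' = arrow x i (\<theta> j) i' (\<theta> j')"
    if "i \<le> i'" "i' \<le> p" "j \<le> j'" "j' \<le> m" for i i' j j'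
    unfolding eq by (rule arrow_cell_of[OF D that])
qed

lemma
  assumes x: "x \<in> cel m q" and \<sigma>: "\<sigma> \<in> Delta p q"
  shows act_in_cel: "act (space_at NC m) p q \<sigma> x \<in> cel m p"
    and arrow_act: "\<And>i i' j j'. i \<le> i' \<Longrightarrow> i' \<le> p \<Longrightarrow> j \<le> j' \<Longrightarrow> j' \<le> m \<Longrightarrow>
       arrow (act (space_at NC m) p q \<sigma> x) i j i' j' = arrow x (\<sigma> i) j (\<sigma> i') j'"
proof -
  have D: "diagram m p (\<lambda>i j i' j'. arrow x (\<sigma> i) j (\<sigma> i') j')"
    by (rule diagram_reindex[where \<theta> = "\<lambda>j. j", OF diagram_arrow[OF x]]) (auto simp: DeltaD[OF \<sigma>])
  have eq: "act (space_at NC m) p q \<sigma> x = cell_of m p (\<lambda>i j i' j'. arrow x (\<sigma> i) j (\<sigma> i') j')"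
    using act_cell_of[OF diagram_arrow[OF x] \<sigma>] cell_of_arrow[OF x] by simp
  show "act (space_at NC m) p q \<sigma> x \<in> cel m p"
    unfolding eq by (rule cell_of_in_cel[OF D])
  show "arrow (act (space_at NC m) p q \<sigma> x) i j i' j' = arrow x (\<sigma> i) j (\<sigma> i') j'"
    if "i \<le> i'" "i' \<le> p" "j \<le> j'" "j' \<le> m" for i i' j j'
    unfolding eq by (rule arrow_cell_of[OF D that])
qed

text \<open>After \<open>cel_eqI\<close> each axiom compares two substitutions of indices. Operators
  in the two directions commute because they act on different indices.\<close>

lemma simplicial_space_NC: "simplicial_space NC"
  unfolding simplicial_space_def simplicial_set_def simplicial_map_def
proof (intro conjI allI ballI funcsetI)
  fix m p q \<sigma> x assume "\<sigma> \<in> Delta p q" "x \<in> cel m q"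
  then show "act (space_at NC m) p q \<sigma> x \<in> cel m p" by (simp add: act_in_cel)
next
  fix m n x assume "x \<in> cel m n"
  then show "act (space_at NC m) n n (restrict id {..n}) x = x"
    by (intro cel_eqI[of _ m n]) (auto simp: act_in_cel arrow_act Delta_restrict_id)
next
  fix k l m n \<theta> \<psi> x assume "\<theta> \<in> Delta l m" "\<psi> \<in> Delta m n" "x \<in> cel k n"
  then show "act (space_at NC k) l n (compose {..l} \<psi> \<theta>) x =
     act (space_at NC k) l m \<theta> (act (space_at NC k) m n \<psi> x)"
    by (intro cel_eqI[of _ k l])
      (auto simp: act_in_cel arrow_act Delta_compose DeltaD compose_eq)
next
  fix m n \<theta> p x assume "\<theta> \<in> Delta m n" "x \<in> cel n p"
  then show "oper NC m n \<theta> p x \<in> cel m p" by (simp add: oper_in_cel)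
next
  fix m n \<theta> p q \<sigma> x assume "\<theta> \<in> Delta m n" "\<sigma> \<in> Delta p q" "x \<in> cel n q"
  then show "oper NC m n \<theta> p (act (space_at NC n) p q \<sigma> x) =
     act (space_at NC m) p q \<sigma> (oper NC m n \<theta> q x)"
    by (intro cel_eqI[of _ m p]) (auto simp: act_in_cel arrow_act oper_in_cel arrow_oper DeltaD)
next
  fix n p x assume "x \<in> cel n p"
  then show "oper NC n n (restrict id {..n}) p x = x"
    by (intro cel_eqI[of _ n p]) (auto simp: oper_in_cel arrow_oper Delta_restrict_id)
next
  fix l m n \<theta> \<psi> p x assume "\<theta> \<in> Delta l m" "\<psi> \<in> Delta m n" "x \<in> cel n p"
  then show "oper NC l n (compose {..l} \<psi> \<theta>) p x = oper NC l m \<theta> p (oper NC m n \<psi> p x)"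
    by (intro cel_eqI[of _ l p]) (auto simp: oper_in_cel arrow_oper Delta_compose DeltaD compose_eq)
qed

subsection \<open>Transport along isomorphisms and the Segal maps\<close>

abbreviation vob where "vob x \<equiv> vertex_obj (arrow x)"

lemmas arrow_hom = diagram_hom[OF diagram_arrow]
lemmas arrow_Ident = diagram_Ident[OF diagram_arrow]
lemmas arrow_comp = diagram_comp[OF diagram_arrow]
lemmas arrow_iso = diagram_iso[OF diagram_arrow]

lemma vob_Obj: "x \<in> cel m p \<Longrightarrow> i \<le> p \<Longrightarrow> j \<le> m \<Longrightarrow> vob x i j \<in> Obj C"
  using hom_Obj[OF arrow_hom[of x m p i i j j]] by simp

text \<open>\<open>\<phi> i j\<close> carries the \<open>j\<close>-th object of the single row
  \<open>A\<close> to grid point \<open>(i, j)\<close>; this is the conjugate of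
  \<open>A j j'\<close> by these isomorphisms.\<close>

definition star where
  "star \<phi> A i j i' j' = \<phi> i' j' \<cdot> A j j' \<cdot> inverse_arrow (\<phi> i j)"

text \<open>As \<open>\<phi> i j\<close> is invertible, one arrow alone closes the square.
  Identifying a transported arrow thus becomes checking a square, without handling inverses.\<close>

lemma star_eqI:
  assumes "iso (\<phi> i j) a b" "hom (A j j') a a'" "hom (\<phi> i' j') a' b'"
    and x: "hom x b b'" "x \<cdot> \<phi> i j = \<phi> i' j' \<cdot> A j j'"
  shows "star \<phi> A i j i' j' = x"
proof -
  note inv = inverse_arrow(1)[OF assms(1)]
  have "star \<phi> A i j i' j' = (\<phi> i' j' \<cdot> A j j') \<cdot> inverse_arrow (\<phi> i j)"
    unfolding star_def using hom_assoc[OF inv assms(2,3)] by simp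
  also have "\<dots> = x"
    unfolding x(2)[symmetric] using comp_inverse_cancel(2)[OF assms(1) x(1)] .
  finally show ?thesis .
qed

lemma star_hom:
  assumes "iso (\<phi> i j) a b" "hom (A j j') a a'" "hom (\<phi> i' j') a' b'"
  shows "hom (star \<phi> A i j i' j') b b'" "star \<phi> A i j i' j' \<cdot> \<phi> i j = \<phi> i' j' \<cdot> A j j'"
proof -
  note inv = inverse_arrow(1)[OF assms(1)]
  show "hom (star \<phi> A i j i' j') b b'"
    unfolding star_def using hom_comp[OF hom_comp[OF inv assms(2)] assms(3)] .
  have "star \<phi> A i j i' j' = (\<phi> i' j' \<cdot> A j j') \<cdot> inverse_arrow (\<phi> i j)"
    unfolding star_def using hom_assoc[OF inv assms(2,3)] by simp
  then show "star \<phi> A i j i' j' \<cdot> \<phi> i j = \<phi> i' j' \<cdot> A j j'"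
    using comp_inverse_cancel(1)[OF assms(1) hom_comp[OF assms(2,3)]] by simp
qed

text \<open>Squares paste: after composition with \<open>\<phi> i j\<close> both sides of the
  composition law equal \<open>\<phi> i'' j'' \<cdot> A j j''\<close>. Inside a column
  \<open>A j j\<close> is an identity, so the conjugate there is a composite of
  isomorphisms.\<close>

lemma star_diagram:
  assumes A: "diagram m 0 (\<lambda>_ j _ j'. A j j')"
    and \<phi>: "\<And>i j. i \<le> p \<Longrightarrow> j \<le> m \<Longrightarrow> iso (\<phi> i j) (Dom C (A j j)) (c i j)"
  shows "diagram m p (star \<phi> A)"
proof -
  have hA: "hom (A j j') (Dom C (A j j)) (Dom C (A j' j'))" if "j \<le> j'" "j' \<le> m" for j j'
    using diagram_hom[OF A order_refl order_refl that] by (simp add: vertex_obj_def)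
  have IA: "A j j = Ident C (Dom C (A j j))" if "j \<le> m" for j
    using diagram_Ident[OF A order_refl that] by (simp add: vertex_obj_def)
  have CA: "A j' j'' \<cdot> A j j' = A j j''" if "j \<le> j'" "j' \<le> j''" "j'' \<le> m" for j j' j''
    using diagram_comp[OF A order_refl order_refl order_refl that] .
  have h: "hom (star \<phi> A i j i' j') (c i j) (c i' j')"
    and s: "star \<phi> A i j i' j' \<cdot> \<phi> i j = \<phi> i' j' \<cdot> A j j'"
    if "i \<le> i'" "i' \<le> p" "j \<le> j'" "j' \<le> m" for i i' j j'
    using star_hom[where \<phi> = \<phi> and A = A and i = i and j = j and i' = i' and j' = j',
        OF \<phi>[of i j] hA[of j j'] iso_hom[OF \<phi>[of i' j']]] that by auto
  have v: "vertex_obj (star \<phi> A) i j = c i j" if "i \<le> p" "j \<le> m" for i j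
    using h[of i i j j] that by (simp add: vertex_obj_def hom_def)
  show ?thesis
    unfolding diagram_def
  proof (intro conjI allI impI)
    fix i i' j j' assume *: "i \<le> i'" "i' \<le> p" "j \<le> j'" "j' \<le> m"
    then show "hom (star \<phi> A i j i' j') (vertex_obj (star \<phi> A) i j) (vertex_obj (star \<phi> A) i' j')"
      using h[OF *] v by simp
  next
    fix i j assume *: "i \<le> p" "j \<le> m"
    then have "star \<phi> A i j i j = Ident C (c i j)"
      using hom_comp_Ident[OF iso_hom[OF \<phi>[OF *]]] IA[of j]
        hom_Obj[OF iso_hom[OF \<phi>[OF *]]] hom_Ident[of "c i j"] *(2)
      by (intro star_eqI[where \<phi> = \<phi> and A = A, OF \<phi>[OF *] hA[of j j] iso_hom[OF \<phi>[OF *]]]) auto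
    then show "star \<phi> A i j i j = Ident C (vertex_obj (star \<phi> A) i j)"
      using v * by simp
  next
    fix i i' i'' j j' j''
    assume *: "i \<le> i'" "i' \<le> i''" "i'' \<le> p" "j \<le> j'" "j' \<le> j''" "j'' \<le> m"
    have 1: "hom (star \<phi> A i j i' j') (c i j) (c i' j')" "hom (star \<phi> A i' j' i'' j'') (c i' j') (c i'' j'')"
      "iso (\<phi> i j) (Dom C (A j j)) (c i j)" "iso (\<phi> i' j') (Dom C (A j' j')) (c i' j')"
      "iso (\<phi> i'' j'') (Dom C (A j'' j'')) (c i'' j'')" "hom (A j j') (Dom C (A j j)) (Dom C (A j' j'))"
      "hom (A j' j'') (Dom C (A j' j')) (Dom C (A j'' j''))"
      using * h \<phi> hA by auto
    note 2 = 1(3-5)[THEN iso_hom]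
    have "(star \<phi> A i' j' i'' j'' \<cdot> star \<phi> A i j i' j') \<cdot> \<phi> i j =
       star \<phi> A i' j' i'' j'' \<cdot> \<phi> i' j' \<cdot> A j j'"
      using hom_assoc[OF 2(1) 1(1,2)] s[of i i' j j'] * by simp
    also have "\<dots> = \<phi> i'' j'' \<cdot> A j j''"
      using hom_assoc[OF 1(6) 2(2) 1(2)] s[of i' i'' j' j''] hom_assoc[OF 1(6,7) 2(3)] CA * by simp
    finally show "star \<phi> A i' j' i'' j'' \<cdot> star \<phi> A i j i' j' = star \<phi> A i j i'' j''"
      using star_eqI[where \<phi> = \<phi> and A = A, OF 1(3) hA[of j j''] 2(3) hom_comp[OF 1(1,2)]] * by simp
  next
    fix i i' j assume *: "i \<le> i'" "i' \<le> p" "j \<le> m"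
    then have 1: "iso (\<phi> i j) (Dom C (A j j)) (c i j)" "iso (\<phi> i' j) (Dom C (A j j)) (c i' j)"
      using \<phi> by auto
    have "A j j \<cdot> inverse_arrow (\<phi> i j) = inverse_arrow (\<phi> i j)"
      using hom_comp_Ident(2)[OF inverse_arrow(1)[OF 1(1)]] IA[OF *(3)] by metis
    then have "iso (\<phi> i' j \<cdot> A j j \<cdot> inverse_arrow (\<phi> i j)) (c i j) (c i' j)"
      using iso_comp[OF iso_inverse_arrow[OF 1(1)] 1(2)] by simp
    then show "invertible_arrow C (star \<phi> A i j i' j)"
      by (simp add: star_def iso_def)
  qed
qed

text \<open>Indexed by starting point and length \<open>d\<close>, not by the two end points, so
  that the recursion is primitive.\<close>

primrec path_comp where
  "path_comp a v j 0 = Ident C (v j)"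
| "path_comp a v j (Suc d) = a (j + d) \<cdot> path_comp a v j d"

definition path_arrow where "path_arrow a v j j' = path_comp a v j (j' - j)"

lemma path_arrow_diagram:
  assumes v: "\<And>j. j \<le> k \<Longrightarrow> v j \<in> Obj C"
    and a: "\<And>j. j < k \<Longrightarrow> hom (a j) (v j) (v (Suc j))"
  shows path_diagram: "diagram k 0 (\<lambda>_ j _ j'. path_arrow a v j j')"
    and path_arrow_self: "path_arrow a v j j = Ident C (v j)"
    and path_arrow_Suc: "j < k \<Longrightarrow> path_arrow a v j (Suc j) = a j"
proof -
  have h: "hom (path_comp a v j d) (v j) (v (j + d))" if "j + d \<le> k" for j d
    using that
  proof (induction d)
    case (Suc d)
    then show ?case using hom_comp[OF Suc.IH a[of "j + d"]] by simp
  qed (simp add: hom_Ident v)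
  have c: "path_comp a v (j + d) e \<cdot> path_comp a v j d = path_comp a v j (d + e)"
    if "j + d + e \<le> k" for j d e
    using that
  proof (induction e)
    case 0
    then show ?case using hom_comp_Ident(2)[OF h] by simp
  next
    case (Suc e)
    then have "hom (a (j + d + e)) (v (j + d + e)) (v (j + d + Suc e))"
      using a[of "j + d + e"] by simp
    then show ?case
      using Suc hom_assoc[OF h h, of j d e] by (simp add: add.assoc)
  qed
  show Id: "path_arrow a v j j = Ident C (v j)" for j
    by (simp add: path_arrow_def)
  have vo: "vertex_obj (\<lambda>_ j _ j'. path_arrow a v j j') i j = v j" if "j \<le> k" for i j
    using hom_Ident[OF v[OF that]] by (simp add: vertex_obj_def Id hom_def)
  show "path_arrow a v j (Suc j) = a j" if "j < k"
    using hom_comp_Ident(1)[OF a[OF that]] by (simp add: path_arrow_def)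
  show "diagram k 0 (\<lambda>_ j _ j'. path_arrow a v j j')"
    unfolding diagram_def
  proof (intro conjI allI impI)
    fix i i' :: nat and j j' assume "j \<le> j'" "j' \<le> k"
    then show "hom (path_arrow a v j j') (vertex_obj (\<lambda>_ j _ j'. path_arrow a v j j') i j)
        (vertex_obj (\<lambda>_ j _ j'. path_arrow a v j j') i' j')"
      using h[of j "j' - j", folded path_arrow_def] by (simp add: vo)
  next
    fix i j :: nat assume "j \<le> k"
    then show "path_arrow a v j j = Ident C (vertex_obj (\<lambda>_ j _ j'. path_arrow a v j j') i j)"
      by (simp add: vo Id)
  next
    fix j j' j'' assume "j \<le> j'" "j' \<le> j''" "j'' \<le> k"
    then show "path_arrow a v j' j'' \<cdot> path_arrow a v j j' = path_arrow a v j j''"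
      using c[of j "j' - j" "j'' - j'"] by (simp add: path_arrow_def)
  next
    fix j assume "j \<le> k"
    then show "invertible_arrow C (path_arrow a v j j)"
      using iso_Ident[OF v] by (simp add: Id iso_def)
  qed
qed

section \<open>The Segal maps are isomorphisms\<close>

lemma segal_map_eq: "segal_map NC k p w = (\<lambda>i\<in>{..<k}. oper NC 1 k (segment i) p w)"
  by (simp add: segal_map_def segment_def)

lemma simplicial_set_NC: "simplicial_set (space_at NC m)"
  using simplicial_space_NC by (simp add: simplicial_space_def)

lemma simplicial_map_oper: "\<theta> \<in> Delta m n \<Longrightarrow> simplicial_map (space_at NC n) (space_at NC m) (oper NC m n \<theta>)"
  using simplicial_space_NC by (simp add: simplicial_space_def)

lemma oper_act:
  assumes "\<theta> \<in> Delta m n" "\<sigma> \<in> Delta p q" "x \<in> cel n q"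
  shows "oper NC m n \<theta> p (act (space_at NC n) p q \<sigma> x) = act (space_at NC m) p q \<sigma> (oper NC m n \<theta> q x)"
  using simplicial_map_oper[OF assms(1)] assms by (simp add: simplicial_map_def)

lemma segal_product_cells:
  "f \<in> cells (segal_product NC k) p \<longleftrightarrow> f \<in> extensional {..<k} \<and> (\<forall>l<k. f l \<in> cel 1 p) \<and>
     (\<forall>l. Suc l < k \<longrightarrow> oper NC 0 1 (vert 1) p (f l) = oper NC 0 1 (vert 0) p (f (Suc l)))"
  by (auto simp: segal_product_def face_def coface_0 PiE_iff)

lemma simplicial_set_segal_product: "simplicial_set (segal_product NC k)"
proof -
  note S = simplicial_set_NC[of 1, unfolded simplicial_set_def]
  show ?thesis
    unfolding simplicial_set_def
  proof (intro conjI allI ballI funcsetI)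
    fix m n \<theta> f assume *: "\<theta> \<in> Delta m n" "f \<in> cells (segal_product NC k) n"
    then show "act (segal_product NC k) m n \<theta> f \<in> cells (segal_product NC k) m"
      unfolding segal_product_cells
      by (auto simp: segal_product_def act_in_cel oper_act vert_in_Delta)
  next
    fix n f assume "f \<in> cells (segal_product NC k) n"
    then show "act (segal_product NC k) n n (restrict id {..n}) f = f"
      unfolding segal_product_cells using S
      by (auto simp: segal_product_def extensional_def fun_eq_iff)
  next
    fix l m n \<theta> \<psi> f assume *: "\<theta> \<in> Delta l m" "\<psi> \<in> Delta m n" "f \<in> cells (segal_product NC k) n"
    then show "act (segal_product NC k) l n (compose {..l} \<psi> \<theta>) f =
        act (segal_product NC k) l m \<theta> (act (segal_product NC k) m n \<psi> f)"
      unfolding segal_product_cells using S by (auto simp: segal_product_def fun_eq_iff)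
  qed
qed

lemma segal_map_in_product:
  assumes x: "x \<in> cel k p"
  shows "segal_map NC k p x \<in> cells (segal_product NC k) p"
  unfolding segal_product_cells segal_map_eq
proof (intro conjI allI impI)
  fix l assume "l < k"
  then show "(\<lambda>i\<in>{..<k}. oper NC 1 k (segment i) p x) l \<in> cel 1 p"
    using oper_in_cel[OF x segment_in_Delta] by simp
next
  fix l assume l: "Suc l < k"
  then have 1: "oper NC 1 k (segment l) p x \<in> cel 1 p" "oper NC 1 k (segment (Suc l)) p x \<in> cel 1 p"
    using oper_in_cel[OF x segment_in_Delta] by auto
  have [simp]: "l + 1 = Suc l" by simp
  have "oper NC 0 1 (vert 1) p (oper NC 1 k (segment l) p x) =
     oper NC 0 1 (vert 0) p (oper NC 1 k (segment (Suc l)) p x)"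
    using l by (intro cel_eqI[of _ 0 p])
      (auto simp: oper_in_cel[OF 1(1)] oper_in_cel[OF 1(2)] vert_in_Delta arrow_oper[OF 1(1)]
        arrow_oper[OF 1(2)] arrow_oper[OF x] segment_in_Delta simp del: One_nat_def)
  then show "oper NC 0 1 (vert 1) p ((\<lambda>i\<in>{..<k}. oper NC 1 k (segment i) p x) l) =
     oper NC 0 1 (vert 0) p ((\<lambda>i\<in>{..<k}. oper NC 1 k (segment i) p x) (Suc l))"
    using l by simp
qed simp

lemma simplicial_map_segal_map: "simplicial_map (space_at NC k) (segal_product NC k) (segal_map NC k)"
  unfolding simplicial_map_def
proof (intro conjI allI ballI funcsetI segal_map_in_product)
  fix p q \<sigma> x assume "\<sigma> \<in> Delta p q" "x \<in> cel k q"
  then show "segal_map NC k p (act (space_at NC k) p q \<sigma> x) =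
      act (segal_product NC k) p q \<sigma> (segal_map NC k q x)"
    by (auto simp: segal_map_eq segal_product_def oper_act segment_in_Delta simp del: One_nat_def
        intro!: restrict_ext)
qed

text \<open>The spine contains all columns and all row arrows between neighbouring columns. A
  general arrow is a column arrow followed by such steps, added one at a time.\<close>

lemma segal_map_inj:
  assumes k: "k \<ge> 1" and x: "x \<in> cel k p" and y: "y \<in> cel k p"
    and eq: "segal_map NC k p x = segal_map NC k p y"
  shows "x = y"
proof (rule cel_eqI[OF x y])
  have *: "arrow x i (l + j) i' (l + j') = arrow y i (l + j) i' (l + j')"
    if "l < k" "i \<le> i'" "i' \<le> p" "j \<le> j'" "j' \<le> 1" for l i i' j j'
  proof -
    have "oper NC 1 k (segment l) p x = oper NC 1 k (segment l) p y"
      using fun_cong[OF eq, of l] that by (simp add: segal_map_eq)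
    then show ?thesis
      using arrow_oper[OF x segment_in_Delta[OF that(1)] that(2-5)]
        arrow_oper[OF y segment_in_Delta[OF that(1)] that(2-5)] that by simp
  qed
  \<comment> \<open>Column \<open>k\<close> starts no segment; it is the end of segment
    \<open>k - 1\<close>.\<close>
  have eq_same: "arrow x i j i' j = arrow y i j i' j" if "i \<le> i'" "i' \<le> p" "j \<le> k" for i i' j
    using *[of j i i' 0 0] *[of "k - 1" i i' 1 1] that k by (cases "j < k") auto
  fix i i' j j' assume "i \<le> i'" "i' \<le> p" "j \<le> j'" "j' \<le> k"
  from \<open>j \<le> j'\<close> \<open>j' \<le> k\<close> show "arrow x i j i' j' = arrow y i j i' j'"
  proof (induction j' rule: dec_induct)
    case base
    then show ?case using eq_same \<open>i \<le> i'\<close> \<open>i' \<le> p\<close> by simp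
  next
    case (step j')
    then have "arrow x i j i' j' = arrow y i j i' j'" "arrow x i' j' i' (Suc j') = arrow y i' j' i' (Suc j')"
      using *[of j' i' i' 0 1] \<open>i' \<le> p\<close> by auto
    then show ?case
      using arrow_comp[OF x \<open>i \<le> i'\<close> order_refl \<open>i' \<le> p\<close> \<open>j \<le> j'\<close>, of "Suc j'"]
        arrow_comp[OF y \<open>i \<le> i'\<close> order_refl \<open>i' \<le> p\<close> \<open>j \<le> j'\<close>, of "Suc j'"] step by simp
  qed
qed

text \<open>The rows 0 of the given edges form a chain, which generates the row \<open>A\<close>.
  Their columns, which agree where consecutive edges meet, supply the isomorphisms \<open>u\<close>
  along which \<open>A\<close> is transported to the other rows.\<close>

lemma segal_map_surj:
  assumes k: "k \<ge> 1" and f: "f \<in> cells (segal_product NC k) p"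
  obtains x where "x \<in> cel k p" "segal_map NC k p x = f"
proof -
  note f' = f[unfolded segal_product_cells]
  have fc: "f l \<in> cel 1 p" if "l < k" for l using f' that by blast
  have match: "arrow (f l) i 1 i' 1 = arrow (f (Suc l)) i 0 i' 0"
    if "Suc l < k" "i \<le> i'" "i' \<le> p" for l i i'
  proof -
    have "arrow (oper NC 0 1 (vert 1) p (f l)) i 0 i' 0 = arrow (oper NC 0 1 (vert 0) p (f (Suc l))) i 0 i' 0"
      using f' that by simp
    then show ?thesis
      using arrow_oper[OF fc vert_in_Delta, of l 1 i i' 0 0]
        arrow_oper[OF fc vert_in_Delta, of "Suc l" 0 i i' 0 0] that by simp
  qed
  \<comment> \<open>Each inner column belongs to two edges. It is read at the start of segment
    \<open>j\<close>, and the last column at the end of segment \<open>k - 1\<close>;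
    \<open>match\<close> shows that the other reading gives the same arrow.\<close>
  define u where "u i j = (if j < k then arrow (f j) 0 0 i 0 else arrow (f (k - 1)) 0 1 i 1)" for i j
  define v where "v j = Dom C (u 0 j)" for j
  define a where "a j = arrow (f j) 0 0 0 1" for j
  define A where "A = path_arrow a v"
  have u: "u i (l + j) = arrow (f l) 0 j i j" if "l < k" "j \<le> 1" "i \<le> p" for l j i
  proof (cases "j = 0")
    case False
    then have "j = 1" using that by simp
    then show ?thesis
      using match[of l 0 i] that by (cases "Suc l < k") (auto simp: u_def le_Suc_eq dest: less_antisym)
  qed (use that in \<open>simp add: u_def\<close>)
  have v: "v (l + j) = vob (f l) 0 j" if "l < k" "j \<le> 1" for l j
    using u[OF that, of 0] by (simp add: v_def vertex_obj_def)
  have col: "\<exists>l t. l < k \<and> t \<le> 1 \<and> j = l + t" if "j \<le> k" for j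
  proof (cases "j < k")
    case False
    then show ?thesis using that k by (intro exI[of _ "k - 1"] exI[of _ 1]) auto
  qed (use that in auto)
  have vO: "v j \<in> Obj C" if "j \<le> k" for j
    using col[OF that] vob_Obj[OF fc] v by auto
  have a: "hom (a j) (v j) (v (Suc j))" if "j < k" for j
    using arrow_hom[OF fc[OF that], of 0 0 0 1] v[OF that, of 0] v[OF that, of 1] by (simp add: a_def)
  have A: "diagram k 0 (\<lambda>_ j _ j'. A j j')" "\<And>j. A j j = Ident C (v j)"
    "\<And>j. j < k \<Longrightarrow> A j (Suc j) = a j"
    unfolding A_def by (rule path_arrow_diagram[where k = k]; (rule vO a)?; assumption)+
  have AA: "A (l + j) (l + j') = arrow (f l) 0 j 0 j'" if "l < k" "j \<le> j'" "j' \<le> 1" for l j j'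
  proof (cases "j = j'")
    case True
    then show ?thesis
      using A(2)[of "l + j"] arrow_Ident[OF fc[OF that(1)], of 0 j] v[OF that(1), of j] that by simp
  next
    case False
    then have "j = 0" "j' = 1" using that by auto
    then show ?thesis using A(3)[OF that(1)] by (simp add: a_def)
  qed
  have Dom_A: "Dom C (A j j) = v j" if "j \<le> k" for j
    using A(2)[of j] vO[OF that] by (simp add: Dom_Ident)
  have u_iso: "iso (u i j) (Dom C (A j j)) (Cod C (u i j))" if "i \<le> p" "j \<le> k" for i j
  proof -
    note ij = that
    obtain l t where lt: "l < k" "t \<le> 1" "j = l + t" using col[OF ij(2)] by blast
    have "iso (u i j) (vob (f l) 0 t) (vob (f l) i t)"
      unfolding lt(3) u[OF lt(1,2) ij(1)] using arrow_iso[OF fc[OF lt(1)]] ij(1) lt(2) by simp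
    then show ?thesis
      using v[OF lt(1,2)] Dom_A[OF ij(2)] lt(3) by (simp add: iso_def hom_def)
  qed
  have D: "diagram k p (star u A)"
    by (rule star_diagram[OF A(1) u_iso])
  define x where "x = cell_of k p (star u A)"
  have x: "x \<in> cel k p" unfolding x_def by (rule cell_of_in_cel[OF D])
  have "oper NC 1 k (segment l) p x = f l" if l: "l < k" for l
  proof (rule cel_eqI[OF oper_in_cel[OF x segment_in_Delta[OF l]] fc[OF l]])
    fix i i' j j' assume *: "i \<le> i'" "i' \<le> p" "j \<le> j'" "j' \<le> (1::nat)"
    note F = fc[OF l]
    have "arrow (oper NC 1 k (segment l) p x) i j i' j' = star u A i (l + j) i' (l + j')"
      using arrow_oper[OF x segment_in_Delta[OF l] *] arrow_cell_of[OF D *(1,2), of "l + j" "l + j'"] * l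
      by (simp add: x_def)
    also have "\<dots> = arrow (f l) i j i' j'"
    proof (rule star_eqI[where \<phi> = u and A = A])
      show "iso (u i (l + j)) (vob (f l) 0 j) (vob (f l) i j)"
        using * u[OF l, of j i] arrow_iso[OF F, of 0 i j] by simp
      show "hom (A (l + j) (l + j')) (vob (f l) 0 j) (vob (f l) 0 j')"
        using * AA[OF l *(3,4)] arrow_hom[OF F, of 0 0 j j'] by simp
      show "hom (u i' (l + j')) (vob (f l) 0 j') (vob (f l) i' j')"
        using * u[OF l, of j' i'] arrow_hom[OF F, of 0 i' j' j'] by simp
      show "hom (arrow (f l) i j i' j') (vob (f l) i j) (vob (f l) i' j')"
        using arrow_hom[OF F *] .
      show "arrow (f l) i j i' j' \<cdot> u i (l + j) = u i' (l + j') \<cdot> A (l + j) (l + j')"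
        using * u[OF l, of j i] u[OF l, of j' i'] AA[OF l *(3,4)]
          arrow_comp[OF F, of 0 i i' j j j'] arrow_comp[OF F, of 0 0 i' j j' j'] by simp
    qed
    finally show "arrow (oper NC 1 k (segment l) p x) i j i' j' = arrow (f l) i j i' j'" .
  qed
  then have "segal_map NC k p x = f"
    using f' by (auto simp: segal_map_eq extensional_def fun_eq_iff)
  with x show thesis by (rule that)
qed

lemma segal_map_weak_equivalence:
  assumes "k \<ge> 1"
  shows "weak_equivalence (space_at NC k) (segal_product NC k) (segal_map NC k)"
proof (rule weak_equivalence_iso[OF simplicial_set_NC simplicial_set_segal_product simplicial_map_segal_map])
  show "bij_betw (segal_map NC k n) (cel k n) (cells (segal_product NC k) n)" for n
    unfolding bij_betw_def inj_on_def
  proof (intro conjI ballI impI equalityI subsetI)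
    fix f assume "f \<in> cells (segal_product NC k) n"
    then show "f \<in> segal_map NC k n ` cel k n" by (metis segal_map_surj[OF assms] imageI)
  qed (use segal_map_inj[OF assms] segal_map_in_product in blast)+
qed

subsection \<open>The homotopy category and completeness\<close>

abbreviation edge_arrow where "edge_arrow g \<equiv> arrow g 0 0 0 1"

abbreviation src where "src g \<equiv> oper NC 0 1 (vert 0) 0 g"

abbreviation tgt where "tgt g \<equiv> oper NC 0 1 (vert 1) 0 g"

lemma ob_NC: "ob NC = cel 0 0"
  by (simp add: ob_def)

lemma point_eqI:
  assumes "x \<in> cel 0 0" "y \<in> cel 0 0" "vob x 0 0 = vob y 0 0"
  shows "x = y"
  by (rule cel_eqI[OF assms(1,2)])
    (use assms(3) arrow_Ident[OF assms(1), of 0 0] arrow_Ident[OF assms(2), of 0 0] in simp)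

lemma vob_oper:
  assumes "x \<in> cel n p" "\<theta> \<in> Delta m n" "i \<le> p" "j \<le> m"
  shows "vob (oper NC m n \<theta> p x) i j = vob x i (\<theta> j)"
  using arrow_oper[OF assms(1,2), of i i j j] assms(3,4) by (simp add: vertex_obj_def)

lemma vob_act:
  assumes "x \<in> cel m q" "\<sigma> \<in> Delta p q" "i \<le> p" "j \<le> m"
  shows "vob (act (space_at NC m) p q \<sigma> x) i j = vob x (\<sigma> i) j"
  using arrow_act[OF assms(1,2), of i i j j] assms(3,4) by (simp add: vertex_obj_def)

lemma src_tgt:
  assumes "g \<in> cel 1 0"
  shows "src g \<in> cel 0 0" "tgt g \<in> cel 0 0" "vob (src g) 0 0 = vob g 0 0" "vob (tgt g) 0 0 = vob g 0 1"
  using oper_in_cel[OF assms vert_in_Delta, of 0] oper_in_cel[OF assms vert_in_Delta, of 1]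
    vob_oper[OF assms vert_in_Delta, of 0 0 0] vob_oper[OF assms vert_in_Delta, of 1 0 0] by simp_all

text \<open>The end objects are the domain and codomain of the arrow, so nothing else is stored in
  an edge. With \<open>edge_exists\<close> this identifies the points in degree 1 with the arrows of
  \<open>C\<close>.\<close>

lemma edge_eqI:
  assumes g: "g \<in> cel 1 0" and h: "h \<in> cel 1 0" and eq: "edge_arrow g = edge_arrow h"
  shows "g = h"
proof (rule cel_eqI[OF g h])
  fix i i' j j' :: nat assume *: "i \<le> i'" "i' \<le> 0" "j \<le> j'" "j' \<le> 1"
  have "vob g 0 0 = vob h 0 0" "vob g 0 1 = vob h 0 1"
    using arrow_hom[OF g, of 0 0 0 1] arrow_hom[OF h, of 0 0 0 1] eq by (auto simp: hom_def)
  then have "arrow g 0 0 0 0 = arrow h 0 0 0 0" "arrow g 0 1 0 1 = arrow h 0 1 0 1"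
    using arrow_Ident[OF g] arrow_Ident[OF h] by auto
  moreover have "(j = 0 \<and> j' = 0) \<or> (j = 0 \<and> j' = 1) \<or> (j = 1 \<and> j' = 1)" using * by auto
  ultimately show "arrow g i j i' j' = arrow h i j i' j'" using * eq by auto
qed

lemma edge_exists:
  assumes "hom a b c"
  obtains g where "g \<in> cel 1 0" "edge_arrow g = a" "vob g 0 0 = b" "vob g 0 1 = c"
proof -
  \<comment> \<open>A chain of length one: the family of arrows is constant, but only its member at
    index 0 has to fit the objects.\<close>
  let ?v = "\<lambda>j::nat. if j = 0 then b else c"
  have v: "?v j \<in> Obj C" for j using hom_Obj[OF assms] by simp
  have a: "hom a (?v j) (?v (Suc j))" if "j < 1" for j using assms that by simp
  note D = path_diagram[where k = 1 and v = ?v and a = "\<lambda>_. a", OF v a]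
  define g where "g = cell_of 1 0 (\<lambda>_ j _ j'. path_arrow (\<lambda>_. a) ?v j j')"
  have g: "g \<in> cel 1 0"
    unfolding g_def by (rule cell_of_in_cel[OF D])
  have ga: "edge_arrow g = a"
    unfolding g_def using arrow_cell_of[OF D, of 0 0 0 1] path_arrow_Suc[where k = 1 and v = ?v and a = "\<lambda>_. a", OF v a, of 0]
    by simp
  moreover have "vob g 0 0 = b" "vob g 0 1 = c"
    using arrow_hom[OF g, of 0 0 0 1] ga assms by (auto simp: hom_def)
  ultimately show thesis using g that by blast
qed

lemma act_point:
  assumes "z \<in> cel 0 0"
  shows "act (space_at NC 0) 0 0 (restrict (\<lambda>j. 0) {..0}) z = z"
    "act (space_at NC 0) 0 0 (restrict (\<lambda>j. 0) {0}) z = z"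
proof -
  have "restrict (\<lambda>j::nat. 0) {..0::nat} = restrict id {..0::nat}" by auto
  then show *: "act (space_at NC 0) 0 0 (restrict (\<lambda>j. 0) {..0}) z = z"
    using assms simplicial_set_NC[of 0] unfolding simplicial_set_def by metis
  have "{..0::nat} = {0}" by auto
  with * show "act (space_at NC 0) 0 0 (restrict (\<lambda>j. 0) {0}) z = z" by metis
qed

section \<open>Mapping spaces and the homotopy category\<close>

lemma mapping_space_vertices:
  assumes "x \<in> cel 0 0" "y \<in> cel 0 0"
  shows "w \<in> cells (mapping_space NC [x, y]) 0 \<longleftrightarrow> w \<in> cel 1 0 \<and> src w = x \<and> tgt w = y"
proof -
  have "w \<in> cells (mapping_space NC [x, y]) 0 \<longleftrightarrow> w \<in> cel 1 0 \<and>
    (\<forall>i<2. oper NC 0 1 (vert i) 0 w = act (space_at NC 0) 0 0 (\<lambda>j\<in>{..0}. 0) ([x, y] ! i))"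
    by (simp add: mapping_space_def numeral_2_eq_2)
  also have "\<dots> \<longleftrightarrow> w \<in> cel 1 0 \<and> src w = act (space_at NC 0) 0 0 (\<lambda>j\<in>{..0}. 0) x \<and>
      tgt w = act (space_at NC 0) 0 0 (\<lambda>j\<in>{..0}. 0) y"
    unfolding less_2_cases_iff by (metis One_nat_def nth_Cons_0 nth_Cons_Suc)
  finally show ?thesis unfolding act_point(1)[OF assms(1)] act_point(1)[OF assms(2)] .
qed

text \<open>An edge of the mapping space is a commutative square whose two columns are degenerate,
  hence identities; so its two rows, the end points of the edge, coincide.\<close>

lemma mapping_space_joined:
  assumes x: "x \<in> cel 0 0" and y: "y \<in> cel 0 0"
  shows "joined (mapping_space NC [x, y]) = Id_on (cells (mapping_space NC [x, y]) 0)"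
proof (rule joined_eq_Id_on)
  fix e assume "e \<in> cells (mapping_space NC [x, y]) 1"
  then have e: "e \<in> cel 1 1"
    and e0: "oper NC 0 1 (vert 0) 1 e = act (space_at NC 0) 1 0 (\<lambda>j\<in>{..1}. 0) x"
    and e1: "oper NC 0 1 (vert 1) 1 e = act (space_at NC 0) 1 0 (\<lambda>j\<in>{..1}. 0) y"
    by (auto simp: mapping_space_def)
  have c: "(\<lambda>j\<in>{..1::nat}. 0) \<in> Delta 1 0" by (auto simp: Delta_def mono_on_def)
  have v: "vert j \<in> Delta 0 1" if "j \<le> 1" for j using vert_in_Delta that by simp
  have ver: "arrow e 0 j 1 j = Ident C (vob e 0 j)" "vob e 0 j = vob e 1 j" if "j \<le> 1" for j
  proof -
    \<comment> \<open>Column 0 is degenerate on \<open>x\<close> and column 1 on \<open>y\<close>;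
      calling either point \<open>z\<close> treats both at once.\<close>
    have "\<exists>z\<in>cel 0 0. oper NC 0 1 (vert j) 1 e = act (space_at NC 0) 1 0 (\<lambda>j\<in>{..1}. 0) z"
      using that e0 e1 x y by (cases "j = 0") (auto simp: le_Suc_eq)
    then obtain z where z: "z \<in> cel 0 0"
      "oper NC 0 1 (vert j) 1 e = act (space_at NC 0) 1 0 (\<lambda>j\<in>{..1}. 0) z" by blast
    have "arrow e 0 j 1 j = arrow z 0 0 0 0"
      using arg_cong[OF z(2), of "\<lambda>z. arrow z 0 0 1 0"] arrow_oper[OF e v[OF that], of 0 1 0 0]
        arrow_act[OF z(1) c, of 0 1 0 0] by simp
    also have "\<dots> = Ident C (vob z 0 0)" using arrow_Ident[OF z(1)] by simp
    finally have 1: "arrow e 0 j 1 j = Ident C (vob z 0 0)" .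
    then have "hom (Ident C (vob z 0 0)) (vob e 0 j) (vob e 1 j)"
      using arrow_hom[OF e, of 0 1 j j] that by simp
    then have "vob e 0 j = vob z 0 0" "vob e 1 j = vob z 0 0"
      using hom_Ident[OF vob_Obj[OF z(1), of 0 0]] by (auto simp: hom_def)
    then show "arrow e 0 j 1 j = Ident C (vob e 0 j)" "vob e 0 j = vob e 1 j" using 1 by auto
  qed
  have "act (space_at NC 1) 0 1 (vert 0) e = act (space_at NC 1) 0 1 (vert 1) e"
  proof (rule edge_eqI)
    have "arrow e 0 0 0 1 = arrow e 0 1 1 1 \<cdot> arrow e 0 0 0 1"
      using ver(1)[of 1] hom_comp_Ident(2)[OF arrow_hom[OF e, of 0 0 0 1]] by simp
    also have "\<dots> = arrow e 0 0 1 1" using arrow_comp[OF e, of 0 0 1 0 1 1] by simp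
    also have "\<dots> = arrow e 1 0 1 1 \<cdot> arrow e 0 0 1 0" using arrow_comp[OF e, of 0 1 1 0 0 1] by simp
    also have "\<dots> = arrow e 1 0 1 1"
      using ver[of 0] hom_comp_Ident(1)[OF arrow_hom[OF e, of 1 1 0 1]] by simp
    finally show "edge_arrow (act (space_at NC 1) 0 1 (vert 0) e) =
        edge_arrow (act (space_at NC 1) 0 1 (vert 1) e)"
      using arrow_act[OF e v, of 0 0 0 0 1] arrow_act[OF e v, of 1 0 0 0 1] by simp
  qed (rule act_in_cel[OF e vert_in_Delta], simp)+
  then show "act (mapping_space NC [x, y]) 0 1 (vert 0) e = act (mapping_space NC [x, y]) 0 1 (vert 1) e"
    by (simp add: mapping_space_def)
qed

lemma pi0_mapping_space:
  assumes "x \<in> cel 0 0" "y \<in> cel 0 0"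
  shows "pi0 (mapping_space NC [x, y]) = (\<lambda>g. {g}) ` cells (mapping_space NC [x, y]) 0"
    and "g \<in> cells (mapping_space NC [x, y]) 0 \<Longrightarrow> pi0_class (mapping_space NC [x, y]) g = {g}"
proof -
  let ?A = "cells (mapping_space NC [x, y]) 0"
  have *: "Id_on ?A `` {g} = {g}" if "g \<in> ?A" for g using that by blast
  have "pi0 (mapping_space NC [x, y]) = (\<Union>g\<in>?A. {Id_on ?A `` {g}})"
    unfolding pi0_def mapping_space_joined[OF assms] quotient_def ..
  also have "\<dots> = (\<Union>g\<in>?A. {{g}})" by (rule SUP_cong) (simp_all only: *)
  also have "\<dots> = (\<lambda>g. {g}) ` ?A" by (rule UNION_singleton_eq_range)
  finally show "pi0 (mapping_space NC [x, y]) = (\<lambda>g. {g}) ` ?A" .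
  show "pi0_class (mapping_space NC [x, y]) g = {g}" if "g \<in> ?A"
    unfolding pi0_class_def mapping_space_joined[OF assms] using *[OF that] .
qed

text \<open>Once the outer edges of the triangle are \<open>f\<close> and \<open>g\<close>, its
  three vertices are fixed by the end points of these edges. What remains of a composition is a
  preimage of \<open>(f, g)\<close> under the Segal map.\<close>

lemma is_composition_iff:
  assumes "x \<in> cel 0 0" "y \<in> cel 0 0" "z \<in> cel 0 0"
    and f: "f \<in> cells (mapping_space NC [x, y]) 0" and g: "g \<in> cells (mapping_space NC [y, z]) 0"
  shows "is_composition NC x y z g f k \<longleftrightarrow>
     k \<in> cel 2 0 \<and> segal_map NC 2 0 k = (\<lambda>i\<in>{..<2}. if i = 0 then f else g)"
proof -
  \<comment> \<open>\<open>d\<^sub>2\<close> of a triangle is its first spine edge and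
    \<open>d\<^sub>0\<close> the second, hence the reversed numbering.\<close>
  have co: "coface 1 0 = segment 1" "coface 1 2 = segment 0"
    by (auto simp: coface_def segment_def)
  have f': "f \<in> cel 1 0" "src f = x" "tgt f = y" and g': "g \<in> cel 1 0" "src g = y" "tgt g = z"
    using f g assms(1-3) by (auto simp: mapping_space_vertices)
  have vs: "oper NC 0 2 (vert i) 0 k = [x, y, z] ! i"
    if k: "k \<in> cel 2 0" and kg: "oper NC 1 2 (segment 1) 0 k = g" and kf: "oper NC 1 2 (segment 0) 0 k = f"
      and "i < 3" for i
  proof (rule point_eqI)
    have "vob f 0 j = vob k 0 j" "vob g 0 j = vob k 0 (Suc j)" if "j \<le> 1" for j
      using vob_oper[OF k segment_in_Delta, of 0 0 j] vob_oper[OF k segment_in_Delta, of 1 0 j] kf kg that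
      by auto
    note vv = this[of 0] this[of 1]
    have "i = 0 \<or> i = 1 \<or> i = 2" using \<open>i < 3\<close> by auto
    then show "vob (oper NC 0 2 (vert i) 0 k) 0 0 = vob ([x, y, z] ! i) 0 0"
      using vv src_tgt(3,4)[OF f'(1)] src_tgt(3,4)[OF g'(1)] f'(2,3) g'(2,3)
        vob_oper[OF k vert_in_Delta, of i 0 0]
      by (elim disjE) (simp_all add: numeral_2_eq_2)
    show "oper NC 0 2 (vert i) 0 k \<in> cel 0 0"
      using oper_in_cel[OF k vert_in_Delta, of i] \<open>i < 3\<close> by simp
    show "[x, y, z] ! i \<in> cel 0 0"
      using \<open>i = 0 \<or> i = 1 \<or> i = 2\<close> assms(1-3) by auto
  qed
  have lam: "(\<lambda>i\<in>{..<2}. a i) = (\<lambda>i\<in>{..<2}. if i = 0 then f else g) \<longleftrightarrow> a 0 = f \<and> a 1 = g"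
    for a :: "nat \<Rightarrow> _"
    by (auto simp: fun_eq_iff less_2_cases_iff)
  have "segal_map NC 2 0 k = (\<lambda>i\<in>{..<2}. if i = 0 then f else g) \<longleftrightarrow>
     oper NC 1 2 (segment 1) 0 k = g \<and> oper NC 1 2 (segment 0) 0 k = f"
    unfolding segal_map_eq lam by blast
  moreover have "is_composition NC x y z g f k \<longleftrightarrow> (k \<in> cel 2 0 \<and>
     (\<forall>i<3. oper NC 0 2 (vert i) 0 k = act (space_at NC 0) 0 0 (\<lambda>j\<in>{..0}. 0) ([x, y, z] ! i))) \<and>
     oper NC 1 2 (segment 1) 0 k = g \<and> oper NC 1 2 (segment 0) 0 k = f"
    unfolding is_composition_def mapping_space_def face_def co
    by (simp add: numeral_2_eq_2 numeral_3_eq_3)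
  moreover have "[x, y, z] ! i \<in> cel 0 0" if "i < 3" for i
    using that assms(1-3) by (auto simp: less_Suc_eq numeral_3_eq_3)
  then have "(\<forall>i<3. oper NC 0 2 (vert i) 0 k = act (space_at NC 0) 0 0 (\<lambda>j\<in>{..0}. 0) ([x, y, z] ! i)) \<longleftrightarrow>
      (\<forall>i<3. oper NC 0 2 (vert i) 0 k = [x, y, z] ! i)"
    using act_point(1) by metis
  ultimately show ?thesis using vs by blast
qed

lemma edge_arrow_triangle:
  assumes k: "k \<in> cel 2 0" and s: "segal_map NC 2 0 k = (\<lambda>i\<in>{..<2}. if i = 0 then f else g)"
  shows "oper NC 1 2 (coface 1 1) 0 k \<in> cel 1 0"
    and "edge_arrow (oper NC 1 2 (coface 1 1) 0 k) = edge_arrow g \<cdot> edge_arrow f"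
    and "vob (oper NC 1 2 (coface 1 1) 0 k) 0 0 = vob f 0 0"
    and "vob (oper NC 1 2 (coface 1 1) 0 k) 0 1 = vob g 0 1"
proof -
  have c: "coface 1 1 \<in> Delta 1 2" by (auto simp: coface_def Delta_def mono_on_def)
  have co: "coface 1 1 0 = 0" "coface 1 1 1 = 2" by (auto simp: coface_def)
  have fg: "f = oper NC 1 2 (segment 0) 0 k" "g = oper NC 1 2 (segment 1) 0 k"
    using fun_cong[OF s, of 0] fun_cong[OF s, of 1] by (auto simp: segal_map_eq)
  show "oper NC 1 2 (coface 1 1) 0 k \<in> cel 1 0" by (rule oper_in_cel[OF k c])
  show "edge_arrow (oper NC 1 2 (coface 1 1) 0 k) = edge_arrow g \<cdot> edge_arrow f"
    unfolding fg using arrow_oper[OF k c, of 0 0 0 1] arrow_oper[OF k segment_in_Delta, of 0 0 0 0 1]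
      arrow_oper[OF k segment_in_Delta, of 1 0 0 0 1] arrow_comp[OF k, of 0 0 0 0 1 2] co
    by (simp add: numeral_2_eq_2)
  show "vob (oper NC 1 2 (coface 1 1) 0 k) 0 0 = vob f 0 0"
    "vob (oper NC 1 2 (coface 1 1) 0 k) 0 1 = vob g 0 1"
    unfolding fg using vob_oper[OF k c, of 0 0] vob_oper[OF k c, of 0 1] co
      vob_oper[OF k segment_in_Delta, of 0 0 0] vob_oper[OF k segment_in_Delta, of 1 0 1]
    by (simp_all add: numeral_2_eq_2)
qed

text \<open>The Segal map for \<open>k = 2\<close> is bijective on vertices, so there is exactly one
  composition, and the union in the definition of \<open>Ho\<close> has the single member
  \<open>{h}\<close>.\<close>

lemma Comp_Ho:
  assumes xyz: "x \<in> cel 0 0" "y \<in> cel 0 0" "z \<in> cel 0 0"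
    and f: "f \<in> cells (mapping_space NC [x, y]) 0" and g: "g \<in> cells (mapping_space NC [y, z]) 0"
  obtains h where "h \<in> cells (mapping_space NC [x, z]) 0" "edge_arrow h = edge_arrow g \<cdot> edge_arrow f"
    "Comp (Ho NC) (y, z, {g}) (x, y, {f}) = (x, z, {h})"
proof -
  have f': "f \<in> cel 1 0" "src f = x" "tgt f = y" and g': "g \<in> cel 1 0" "src g = y" "tgt g = z"
    using f g xyz by (auto simp: mapping_space_vertices)
  let ?fg = "\<lambda>i\<in>{..<2::nat}. if i = 0 then f else g"
  have "?fg \<in> cells (segal_product NC 2) 0"
    unfolding segal_product_cells using f' g' by auto
  then obtain k where k: "k \<in> cel 2 0" "segal_map NC 2 0 k = ?fg"
    by (rule segal_map_surj[of 2, rotated]) simp_all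
  have uniq: "k' = k" if "k' \<in> cel 2 0" "segal_map NC 2 0 k' = ?fg" for k'
    using segal_map_inj[of 2 k' 0 k] that k by simp
  define h where "h = oper NC 1 2 (coface 1 1) 0 k"
  note h = edge_arrow_triangle[OF k, folded h_def]
  have hm: "h \<in> cells (mapping_space NC [x, z]) 0"
    unfolding mapping_space_vertices[OF xyz(1,3)]
    using h src_tgt[OF f'(1)] src_tgt[OF g'(1)] src_tgt[OF h(1)] f' g' xyz
    by (auto intro!: point_eqI)
  have fh: "face NC 1 1 0 k = h" by (simp add: face_def h_def numeral_2_eq_2)
  have ic: "is_composition NC x y z g f k' \<longleftrightarrow> k' = k" for k'
    using is_composition_iff[OF xyz f g] k uniq by blast
  have S: "{pi0_class (mapping_space NC [x, z]) (face NC 1 1 0 k') |k' f' g'.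
            f' \<in> {f} \<and> g' \<in> {g} \<and> is_composition NC x y z g' f' k'} = {{h}}"
    (is "?S = _")
  proof -
    have "c \<in> ?S \<longleftrightarrow> c = pi0_class (mapping_space NC [x, z]) (face NC 1 1 0 k)" for c
      unfolding mem_Collect_eq singleton_iff using ic by metis
    then have "?S = {pi0_class (mapping_space NC [x, z]) (face NC 1 1 0 k)}" by blast
    then show ?thesis using fh pi0_mapping_space(2)[OF xyz(1,3) hm] by simp
  qed
  have "Comp (Ho NC) (y, z, {g}) (x, y, {f}) = (x, z, {h})"
    unfolding Ho_def cat.simps prod.case S by (simp only: cSup_singleton)
  then show thesis by (rule that[OF hm h(2)])
qed

lemma Ident_Ho:
  assumes x: "x \<in> cel 0 0"
  obtains i where "i \<in> cells (mapping_space NC [x, x]) 0" "edge_arrow i = Ident C (vob x 0 0)"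
    "Ident (Ho NC) x = (x, x, {i})"
proof -
  define i where "i = degen NC 0 0 0 x"
  have c: "codegeneracy 0 0 \<in> Delta 1 0" by (auto simp: codegeneracy_def Delta_def mono_on_def)
  have cs: "codegeneracy 0 0 0 = 0" "codegeneracy 0 0 1 = 0" by (auto simp: codegeneracy_def)
  have i: "i \<in> cel 1 0" "edge_arrow i = Ident C (vob x 0 0)" "vob i 0 0 = vob x 0 0" "vob i 0 1 = vob x 0 0"
    using oper_in_cel[OF x c] arrow_oper[OF x c, of 0 0 0 1] vob_oper[OF x c, of 0 0] vob_oper[OF x c, of 0 1]
      arrow_Ident[OF x, of 0 0] by (auto simp: i_def degen_def cs cs[simplified])
  then have im: "i \<in> cells (mapping_space NC [x, x]) 0"
    unfolding mapping_space_vertices[OF x x] using src_tgt[OF i(1)] x by (auto intro!: point_eqI)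
  then have "Ident (Ho NC) x = (x, x, {i})"
    using pi0_mapping_space(2)[OF x x im] by (simp add: Ho_def i_def)
  then show thesis using im i that by blast
qed

text \<open>\<open>edge_arrow\<close> turns composites and identities of \<open>Ho NC\<close> into
  those of \<open>C\<close>, and every arrow comes from exactly one edge. Inverses can therefore be
  carried over in both directions.\<close>

lemma homotopy_equiv_point_NC:
  "homotopy_equiv_point NC g \<longleftrightarrow> g \<in> cel 1 0 \<and> invertible_arrow C (edge_arrow g)"
proof (cases "g \<in> cel 1 0")
  case g: True
  define x where "x = src g" define y where "y = tgt g"
  have x: "x \<in> cel 0 0" and y: "y \<in> cel 0 0" and vx: "vob x 0 0 = vob g 0 0" and vy: "vob y 0 0 = vob g 0 1"
    using src_tgt[OF g] by (auto simp: x_def y_def)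
  have gm: "g \<in> cells (mapping_space NC [x, y]) 0"
    unfolding mapping_space_vertices[OF x y] using g by (simp add: x_def y_def)
  have gh: "hom (edge_arrow g) (vob x 0 0) (vob y 0 0)"
    using arrow_hom[OF g, of 0 0 0 1] vx vy by simp
  have eq: "homotopy_equiv_point NC g \<longleftrightarrow> invertible_arrow (Ho NC) (x, y, {g})"
    unfolding homotopy_equiv_point_def using g pi0_mapping_space(2)[OF x y gm]
    by (simp add: x_def y_def face_def coface_0)
  obtain ix where ix: "edge_arrow ix = Ident C (vob x 0 0)" "Ident (Ho NC) x = (x, x, {ix})"
    "ix \<in> cells (mapping_space NC [x, x]) 0" using Ident_Ho[OF x] by blast
  obtain iy where iy: "edge_arrow iy = Ident C (vob y 0 0)" "Ident (Ho NC) y = (y, y, {iy})"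
    "iy \<in> cells (mapping_space NC [y, y]) 0" using Ident_Ho[OF y] by blast
  have Arr: "(x', y', {h}) \<in> Arr (Ho NC)"
    if "x' \<in> cel 0 0" "y' \<in> cel 0 0" "h \<in> cells (mapping_space NC [x', y']) 0" for x' y' h
    using that pi0_mapping_space(1)[of x' y'] by (simp add: Ho_def ob_NC)
  have hom_map: "hom (edge_arrow h) (vob x' 0 0) (vob y' 0 0)"
    if "x' \<in> cel 0 0" "y' \<in> cel 0 0" "h \<in> cells (mapping_space NC [x', y']) 0" for x' y' h
  proof -
    have "h \<in> cel 1 0" "src h = x'" "tgt h = y'"
      using that mapping_space_vertices by blast+
    then show ?thesis using arrow_hom[of h 1 0 0 0 0 1] src_tgt[of h] by auto
  qed
  have "invertible_arrow (Ho NC) (x, y, {g}) \<longleftrightarrow> (\<exists>h\<in>cells (mapping_space NC [y, x]) 0.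
      Comp (Ho NC) (y, x, {h}) (x, y, {g}) = Ident (Ho NC) x \<and>
      Comp (Ho NC) (x, y, {g}) (y, x, {h}) = Ident (Ho NC) y)"
    (is "?L \<longleftrightarrow> ?R")
  proof
    assume ?L
    then obtain c where c: "c \<in> pi0 (mapping_space NC [y, x])"
      "Comp (Ho NC) (y, x, c) (x, y, {g}) = Ident (Ho NC) x"
      "Comp (Ho NC) (x, y, {g}) (y, x, c) = Ident (Ho NC) y"
      by (auto simp: invertible_arrow_def Ho_def)
    then show ?R using pi0_mapping_space(1)[OF y x] by auto
  next
    assume ?R
    then obtain h where h: "h \<in> cells (mapping_space NC [y, x]) 0"
      "Comp (Ho NC) (y, x, {h}) (x, y, {g}) = Ident (Ho NC) x"
      "Comp (Ho NC) (x, y, {g}) (y, x, {h}) = Ident (Ho NC) y" by blast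
    have "Dom (Ho NC) (a, b, c) = a" "Cod (Ho NC) (a, b, c) = b" for a b c by (simp_all add: Ho_def)
    then show ?L
      unfolding invertible_arrow_def using Arr[OF x y gm] Arr[OF y x h(1)] h(2,3)
      by (intro conjI bexI[of _ "(y, x, {h})"]) simp_all
  qed
  also have "\<dots> \<longleftrightarrow> invertible_arrow C (edge_arrow g)"
  proof
    assume "\<exists>h\<in>cells (mapping_space NC [y, x]) 0.
      Comp (Ho NC) (y, x, {h}) (x, y, {g}) = Ident (Ho NC) x \<and>
      Comp (Ho NC) (x, y, {g}) (y, x, {h}) = Ident (Ho NC) y"
    then obtain h where h: "h \<in> cells (mapping_space NC [y, x]) 0"
      "Comp (Ho NC) (y, x, {h}) (x, y, {g}) = Ident (Ho NC) x"
      "Comp (Ho NC) (x, y, {g}) (y, x, {h}) = Ident (Ho NC) y" by blast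
    obtain p where "edge_arrow p = edge_arrow h \<cdot> edge_arrow g"
      "Comp (Ho NC) (y, x, {h}) (x, y, {g}) = (x, x, {p})"
      using Comp_Ho[OF x y x gm h(1)] by blast
    then have 1: "edge_arrow h \<cdot> edge_arrow g = Ident C (vob x 0 0)" using h(2) ix by simp
    obtain q where "edge_arrow q = edge_arrow g \<cdot> edge_arrow h"
      "Comp (Ho NC) (x, y, {g}) (y, x, {h}) = (y, y, {q})"
      using Comp_Ho[OF y x y h(1) gm] by blast
    then have 2: "edge_arrow g \<cdot> edge_arrow h = Ident C (vob y 0 0)" using h(3) iy by simp
    show "invertible_arrow C (edge_arrow g)"
      using isoI[OF gh hom_map[OF y x h(1)] 1 2] by (simp add: iso_def)
  next
    assume "invertible_arrow C (edge_arrow g)"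
    then have gi: "iso (edge_arrow g) (vob x 0 0) (vob y 0 0)" using gh by (simp add: iso_def)
    note inv = inverse_arrow[OF gi]
    obtain h where h: "h \<in> cel 1 0" "edge_arrow h = inverse_arrow (edge_arrow g)"
      "vob h 0 0 = vob y 0 0" "vob h 0 1 = vob x 0 0"
      using edge_exists[OF inv(1)] by blast
    have hm: "h \<in> cells (mapping_space NC [y, x]) 0"
      unfolding mapping_space_vertices[OF y x] using src_tgt[OF h(1)] h x y by (auto intro!: point_eqI)
    obtain p where p: "p \<in> cells (mapping_space NC [x, x]) 0" "edge_arrow p = edge_arrow h \<cdot> edge_arrow g"
      "Comp (Ho NC) (y, x, {h}) (x, y, {g}) = (x, x, {p})"
      using Comp_Ho[OF x y x gm hm] by blast
    obtain q where q: "q \<in> cells (mapping_space NC [y, y]) 0" "edge_arrow q = edge_arrow g \<cdot> edge_arrow h"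
      "Comp (Ho NC) (x, y, {g}) (y, x, {h}) = (y, y, {q})"
      using Comp_Ho[OF y x y hm gm] by blast
    have "p = ix" "q = iy"
      using p(1,2) q(1,2) ix iy inv h(2) x y by (auto intro!: edge_eqI simp: mapping_space_vertices)
    then show "\<exists>h\<in>cells (mapping_space NC [y, x]) 0.
      Comp (Ho NC) (y, x, {h}) (x, y, {g}) = Ident (Ho NC) x \<and>
      Comp (Ho NC) (x, y, {g}) (y, x, {h}) = Ident (Ho NC) y"
      using hm p(3) q(3) ix(2) iy(2) by auto
  qed
  finally show ?thesis using eq g by simp
qed (simp add: homotopy_equiv_point_def)

section \<open>The space of homotopy equivalences\<close>

lemma invertible_columns:
  assumes w: "w \<in> cel 1 p" and i: "i \<le> i'" "i' \<le> p"
  shows "invertible_arrow C (arrow w i 0 i 1) \<longleftrightarrow> invertible_arrow C (arrow w i' 0 i' 1)"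
proof -
  have ip: "i \<le> p" using i by simp
  note u = arrow_iso[OF w i, of 0] and v = arrow_iso[OF w i, of 1]
  have a: "hom (arrow w i 0 i 1) (vob w i 0) (vob w i 1)" and b: "hom (arrow w i' 0 i' 1) (vob w i' 0) (vob w i' 1)"
    using arrow_hom[OF w] i by auto
  \<comment> \<open>The column arrows \<open>u\<close> and \<open>v\<close> of this square are
    isomorphisms, so each row arrow is the other one composed with isomorphisms.\<close>
  have sq: "arrow w i' 0 i' 1 \<cdot> arrow w i 0 i' 0 = arrow w i 1 i' 1 \<cdot> arrow w i 0 i 1"
    using arrow_comp[OF w i(1) order_refl i(2), of 0 0 1] arrow_comp[OF w order_refl i(1,2), of 0 1 1] by simp
  show ?thesis
  proof
    assume "invertible_arrow C (arrow w i 0 i 1)"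
    then have "iso (arrow w i 0 i 1) (vob w i 0) (vob w i 1)" using a by (simp add: iso_def)
    then have "iso ((arrow w i 1 i' 1 \<cdot> arrow w i 0 i 1) \<cdot> inverse_arrow (arrow w i 0 i' 0)) (vob w i' 0) (vob w i' 1)"
      using u v by (intro iso_comp[OF iso_inverse_arrow] iso_comp[of "arrow w i 0 i 1"]) auto
    moreover have "(arrow w i 1 i' 1 \<cdot> arrow w i 0 i 1) \<cdot> inverse_arrow (arrow w i 0 i' 0) = arrow w i' 0 i' 1"
      unfolding sq[symmetric] using u comp_inverse_cancel(2)[OF _ b] by simp
    ultimately show "invertible_arrow C (arrow w i' 0 i' 1)" by (simp add: iso_def)
  next
    assume "invertible_arrow C (arrow w i' 0 i' 1)"
    then have "iso (arrow w i' 0 i' 1) (vob w i' 0) (vob w i' 1)" using b by (simp add: iso_def)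
    then have "iso (inverse_arrow (arrow w i 1 i' 1) \<cdot> arrow w i' 0 i' 1 \<cdot> arrow w i 0 i' 0) (vob w i 0) (vob w i 1)"
      using u v by (intro iso_comp[OF _ iso_inverse_arrow] iso_comp[of "arrow w i 0 i' 0"]) auto
    moreover have "inverse_arrow (arrow w i 1 i' 1) \<cdot> arrow w i' 0 i' 1 \<cdot> arrow w i 0 i' 0 = arrow w i 0 i 1"
      unfolding sq using v comp_inverse_cancel(4)[OF _ a] by simp
    ultimately show "invertible_arrow C (arrow w i 0 i 1)" by (simp add: iso_def)
  qed
qed

text \<open>By \<open>invertible_columns\<close> an edge of the space in degree 1 joins two homotopy
  equivalences or two points that are not. A component with one homotopy equivalence thus contains
  nothing else, and vertex 0 decides.\<close>

lemma hoequiv_space_cells: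
  "cells (hoequiv_space NC) p = {w \<in> cel 1 p. invertible_arrow C (arrow w 0 0 0 1)}"
proof (intro equalityI subsetI)
  fix w assume "w \<in> cells (hoequiv_space NC) p"
  then have w: "w \<in> cel 1 p" and "homotopy_equiv_point NC (act (space_at NC 1) 0 p (vert 0) w)"
    by (auto simp: hoequiv_space_def)
  then show "w \<in> {w \<in> cel 1 p. invertible_arrow C (arrow w 0 0 0 1)}"
    using arrow_act[OF w vert_in_Delta, of 0 0 0 0 1] by (simp add: homotopy_equiv_point_NC)
next
  fix w assume "w \<in> {w \<in> cel 1 p. invertible_arrow C (arrow w 0 0 0 1)}"
  then have w: "w \<in> cel 1 p" and inv: "invertible_arrow C (arrow w 0 0 0 1)" by auto
  define w0 where "w0 = act (space_at NC 1) 0 p (vert 0) w"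
  have w0: "w0 \<in> cel 1 0" "invertible_arrow C (edge_arrow w0)"
    using act_in_cel[OF w vert_in_Delta] arrow_act[OF w vert_in_Delta, of 0 0 0 0 1] inv
    by (simp_all add: w0_def)
  let ?E = "{(act (space_at NC 1) 0 1 (vert 0) e, act (space_at NC 1) 0 1 (vert 1) e) |e. e \<in> cel 1 1}"
  have step: "homotopy_equiv_point NC g \<longleftrightarrow> homotopy_equiv_point NC h" if gh: "(g, h) \<in> ?E" for g h
  proof -
    obtain e where e: "e \<in> cel 1 1" and g: "g = act (space_at NC 1) 0 1 (vert 0) e"
      and h: "h = act (space_at NC 1) 0 1 (vert 1) e"
      using gh by blast
    have "g \<in> cel 1 0" "h \<in> cel 1 0" unfolding g h using act_in_cel[OF e vert_in_Delta] by auto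
    moreover have "edge_arrow g = arrow e 0 0 0 1" "edge_arrow h = arrow e 1 0 1 1"
      unfolding g h using arrow_act[OF e vert_in_Delta, of _ 0 0 0 1] by auto
    ultimately show ?thesis
      using invertible_columns[OF e, of 0 1] by (simp add: homotopy_equiv_point_NC)
  qed
  have "homotopy_equiv_point NC g" if "(w0, g) \<in> (?E \<union> ?E\<inverse>)\<^sup>*" for g
    using that
  proof (induction rule: rtrancl_induct)
    case base
    then show ?case using w0 by (simp add: homotopy_equiv_point_NC)
  next
    case (step g h)
    then show ?case using \<open>\<And>h g. (g, h) \<in> ?E \<Longrightarrow> homotopy_equiv_point NC g \<longleftrightarrow> homotopy_equiv_point NC h\<close>
      by (metis (lifting) UnE converseD)
  qed
  moreover have "joined (space_at NC 1) \<subseteq> (?E \<union> ?E\<inverse>)\<^sup>*"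
    unfolding joined_def Let_def by (rule Int_lower1)
  ultimately have 1: "\<forall>g\<in>joined (space_at NC 1) `` {w0}. homotopy_equiv_point NC g"
    by blast
  have 2: "joined (space_at NC 1) `` {w0} \<in> pi0 (space_at NC 1)"
    unfolding pi0_def using w0(1) by (rule quotientI)
  have 3: "w0 \<in> joined (space_at NC 1) `` {w0}"
    using w0 by (simp add: joined_def Let_def)
  have "\<exists>c\<in>pi0 (space_at NC 1). (\<forall>g\<in>c. homotopy_equiv_point NC g) \<and> w0 \<in> c"
    using 1 2 3 by (intro bexI[of _ "joined (space_at NC 1) `` {w0}"] conjI)
  then show "w \<in> cells (hoequiv_space NC) p"
    using w by (simp add: hoequiv_space_def w0_def)
qed

lemma simplicial_set_hoequiv_space: "simplicial_set (hoequiv_space NC)"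
proof -
  have S: "act (hoequiv_space NC) = act (space_at NC 1)" by (simp add: hoequiv_space_def)
  have closed: "act (space_at NC 1) m n \<theta> w \<in> cells (hoequiv_space NC) m"
    if \<theta>: "\<theta> \<in> Delta m n" and w: "w \<in> cells (hoequiv_space NC) n" for m n \<theta> w
  proof -
    have w': "w \<in> cel 1 n" "invertible_arrow C (arrow w 0 0 0 1)" using w by (auto simp: hoequiv_space_cells)
    then show ?thesis
      using act_in_cel[OF w'(1) \<theta>] arrow_act[OF w'(1) \<theta>, of 0 0 0 1]
        invertible_columns[OF w'(1), of 0 "\<theta> 0"] DeltaD(1)[OF \<theta>, of 0]
      by (simp add: hoequiv_space_cells)
  qed
  show ?thesis
    using simplicial_set_NC[of 1] closed unfolding simplicial_set_def S
    by (auto simp: hoequiv_space_cells)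
qed

section \<open>Deforming an isomorphism to an identity\<close>

lemma const_diagram:
  assumes b: "b \<in> Obj C"
  shows "diagram m 0 (\<lambda>_ _ _ _. Ident C b)"
  using hom_Ident[OF b] iso_Ident[OF b] hom_comp_Ident(1)[OF hom_Ident[OF b]]
  by (simp add: diagram_def vertex_obj_def Dom_Ident[OF b] iso_def)

text \<open>Isomorphisms from the corner \<open>(0, 0)\<close> of \<open>w\<close> to the objects of
  the doubled simplex. The block \<open>i \<le> p\<close> uses column 0 for both values of
  \<open>j\<close>, as in \<open>s\<^sub>0 d\<^sub>1 w\<close>; the block from \<open>Suc p\<close>
  on follows \<open>w\<close> itself.\<close>

definition frame where
  "frame p w i j = (if i \<le> p then arrow w 0 0 i 0 else arrow w 0 0 (i - Suc p) j)"

text \<open>The transported row is constant at the corner, so any two grid points are joined by the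
  one arrow compatible with the frame, including across the boundary between the two blocks.\<close>

definition deformation where
  "deformation p w = cell_of 1 (2 * p + 1) (star (frame p w) (\<lambda>_ _. Ident C (vob w 0 0)))"

context
  fixes p w
  assumes w: "w \<in> cells (hoequiv_space NC) p"
begin

lemma hoequiv_cel: "w \<in> cel 1 p"
  using w by (simp add: hoequiv_space_cells)

lemma hoequiv_iso:
  assumes "i \<le> p" "j \<le> 1"
  shows "iso (arrow w 0 0 i j) (vob w 0 0) (vob w i j)"
proof (cases "j = 0")
  case True
  then show ?thesis using arrow_iso[OF hoequiv_cel, of 0 i 0] assms by simp
next
  case False
  then have j: "j = 1" using assms by simp
  have "iso (arrow w 0 0 0 1) (vob w 0 0) (vob w 0 1)"
    using w arrow_hom[OF hoequiv_cel, of 0 0 0 1] by (simp add: hoequiv_space_cells iso_def)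
  then have "iso (arrow w 0 1 i 1 \<cdot> arrow w 0 0 0 1) (vob w 0 0) (vob w i 1)"
    using arrow_iso[OF hoequiv_cel, of 0 i 1] assms by (auto intro: iso_comp)
  then show ?thesis
    using arrow_comp[OF hoequiv_cel, of 0 0 i 0 1 1] assms j by simp
qed

lemma frame_iso:
  assumes "i \<le> 2 * p + 1" "j \<le> 1"
  shows "iso (frame p w i j) (vob w 0 0) (Cod C (frame p w i j))"
proof -
  have "\<exists>c. iso (frame p w i j) (vob w 0 0) c"
  proof (cases "i \<le> p")
    case False
    then have "i - Suc p \<le> p" using assms(1) by simp
    then show ?thesis using hoequiv_iso[of "i - Suc p" j] assms(2) False by (auto simp: frame_def)
  qed (use hoequiv_iso[of i 0] in \<open>auto simp: frame_def\<close>)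
  then show ?thesis by (auto simp: iso_def hom_def)
qed

lemma deformation_diagram: "diagram 1 (2 * p + 1) (star (frame p w) (\<lambda>_ _. Ident C (vob w 0 0)))"
proof (rule star_diagram)
  have b: "vob w 0 0 \<in> Obj C" using vob_Obj[OF hoequiv_cel, of 0 0] by simp
  show "diagram 1 0 (\<lambda>_ _ _ _. Ident C (vob w 0 0))"
    by (rule const_diagram[OF b])
  show "iso (frame p w i j) (Dom C (Ident C (vob w 0 0))) (Cod C (frame p w i j))"
    if "i \<le> 2 * p + 1" "j \<le> 1" for i j
    unfolding Dom_Ident[OF b] by (rule frame_iso[OF that])
qed

lemma deformation_in_cel: "deformation p w \<in> cel 1 (2 * p + 1)"
  unfolding deformation_def by (rule cell_of_in_cel[OF deformation_diagram])

text \<open>The frame is invertible, so composing with it determines an arrow. The faces and the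
  naturality of the deformation are checked through this property.\<close>

lemma deformation_arrow:
  assumes *: "i \<le> i'" "i' \<le> 2 * p + 1" "j \<le> j'" "j' \<le> 1"
  shows deformation_arrow_hom:
      "hom (arrow (deformation p w) i j i' j') (Cod C (frame p w i j)) (Cod C (frame p w i' j'))"
    and deformation_arrow_comp: "arrow (deformation p w) i j i' j' \<cdot> frame p w i j = frame p w i' j'"
    and deformation_arrow_eqI: "hom x (Cod C (frame p w i j)) (Cod C (frame p w i' j')) \<Longrightarrow>
        x \<cdot> frame p w i j = frame p w i' j' \<Longrightarrow> arrow (deformation p w) i j i' j' = x"
proof -
  have b: "vob w 0 0 \<in> Obj C" using vob_Obj[OF hoequiv_cel, of 0 0] by simp
  have f: "iso (frame p w i j) (vob w 0 0) (Cod C (frame p w i j))"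
    "iso (frame p w i' j') (vob w 0 0) (Cod C (frame p w i' j'))"
    using frame_iso[of i j] frame_iso[of i' j'] * by auto
  note eq = arrow_cell_of[OF deformation_diagram *, folded deformation_def]
  note h = star_hom[where \<phi> = "frame p w" and A = "\<lambda>_ _. Ident C (vob w 0 0)" and j = j and j' = j', OF f(1) hom_Ident[OF b] iso_hom[OF f(2)]]
  have I: "frame p w i' j' \<cdot> Ident C (vob w 0 0) = frame p w i' j'"
    by (rule hom_comp_Ident(1)[OF iso_hom[OF f(2)]])
  show "hom (arrow (deformation p w) i j i' j') (Cod C (frame p w i j)) (Cod C (frame p w i' j'))"
    "arrow (deformation p w) i j i' j' \<cdot> frame p w i j = frame p w i' j'"
    unfolding eq using h I by auto
  show "arrow (deformation p w) i j i' j' = x"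
    if x: "hom x (Cod C (frame p w i j)) (Cod C (frame p w i' j'))" "x \<cdot> frame p w i j = frame p w i' j'"
    unfolding eq
    by (rule star_eqI[where \<phi> = "frame p w" and A = "\<lambda>_ _. Ident C (vob w 0 0)", OF f(1) hom_Ident[OF b] iso_hom[OF f(2)] x(1)])
      (simp add: x(2) I)
qed

text \<open>Row 0 lies in the front block, where both columns carry the same objects; its arrow is
  an identity.\<close>

lemma deformation_in_hoequiv: "deformation p w \<in> cells (hoequiv_space NC) (2 * p + 1)"
proof -
  let ?a = "arrow (deformation p w) 0 0 0 1"
  have f: "frame p w 0 0 = Ident C (vob w 0 0)" "frame p w 0 1 = Ident C (vob w 0 0)"
    using arrow_Ident[OF hoequiv_cel, of 0 0] by (auto simp: frame_def)
  have b: "vob w 0 0 \<in> Obj C" using vob_Obj[OF hoequiv_cel, of 0 0] by simp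
  have "?a = Ident C (vob w 0 0)"
    using b hom_Ident[OF b] hom_comp_Ident(1)[OF hom_Ident[OF b]]
    by (intro deformation_arrow_eqI) (simp_all add: f f[simplified] Cod_Ident)
  then show ?thesis
    using deformation_in_cel iso_Ident[OF b] by (simp add: hoequiv_space_cells iso_def)
qed

end

text \<open>Applying \<open>\<theta>\<close> moves the corner of \<open>w\<close> from
  \<open>(0, 0)\<close> to \<open>(\<theta> 0, 0)\<close>. The two frames then differ by the common
  isomorphism \<open>t\<close> on the right, which conjugation cancels.\<close>

lemma deformation_natural:
  assumes \<theta>: "\<theta> \<in> Delta m n" and w: "w \<in> cells (hoequiv_space NC) n"
  shows "deformation m (act (space_at NC 1) m n \<theta> w) =
     act (space_at NC 1) (2 * m + 1) (2 * n + 1) (ordinal_double m n \<theta>) (deformation n w)"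
proof -
  define w' where "w' = act (space_at NC 1) m n \<theta> w"
  define d where "d = ordinal_double m n \<theta>"
  have d: "d \<in> Delta (2 * m + 1) (2 * n + 1)"
    unfolding d_def by (rule ordinal_double_in_Delta[OF \<theta>])
  have wc: "w \<in> cel 1 n" by (rule hoequiv_cel[OF w])
  have w': "w' \<in> cells (hoequiv_space NC) m"
    using simplicial_set_act[OF simplicial_set_hoequiv_space \<theta> w] by (simp add: w'_def hoequiv_space_def)
  define t where "t = arrow w 0 0 (\<theta> 0) 0"
  have t: "iso t (vob w 0 0) (vob w (\<theta> 0) 0)"
    unfolding t_def using arrow_iso[OF wc, of 0 "\<theta> 0" 0] DeltaD(1)[OF \<theta>, of 0] by simp
  have v: "vob w' 0 0 = vob w (\<theta> 0) 0"
    unfolding w'_def using vob_act[OF wc \<theta>, of 0 0] by simp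
  have frm: "frame n w (d i) j = frame m w' i j \<cdot> t" if "i \<le> 2 * m + 1" "j \<le> 1" for i j
  proof -
    have *: "arrow w 0 0 (\<theta> l) j = arrow w' 0 0 l j \<cdot> t" if "l \<le> m" "j \<le> 1" for l j
      unfolding w'_def t_def using that arrow_act[OF wc \<theta>, of 0 l 0 j] DeltaD[OF \<theta>]
        arrow_comp[OF wc, of 0 "\<theta> 0" "\<theta> l" 0 0 j] by simp
    show ?thesis
    proof (cases "i \<le> m")
      case True
      then show ?thesis using *[of i 0] DeltaD(1)[OF \<theta>, of i] by (simp add: frame_def d_def ordinal_double_def)
    next
      case False
      then show ?thesis using *[of "i - Suc m" j] that by (simp add: frame_def d_def ordinal_double_def)
    qed
  qed
  show ?thesis
    unfolding w'_def[symmetric] d_def[symmetric]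
  proof (rule cel_eqI[OF deformation_in_cel[OF w'] act_in_cel[OF deformation_in_cel[OF w] d]])
    fix i i' j j' :: nat assume *: "i \<le> i'" "i' \<le> 2 * m + 1" "j \<le> j'" "j' \<le> 1"
    have di: "d i \<le> d i'" "d i' \<le> 2 * n + 1" using DeltaD[OF d] * by auto
    define x where "x = arrow (deformation n w) (d i) j (d i') j'"
    have f: "iso (frame m w' i j) (vob w' 0 0) (Cod C (frame m w' i j))"
      "iso (frame m w' i' j') (vob w' 0 0) (Cod C (frame m w' i' j'))"
      using frame_iso[OF w', of i j] frame_iso[OF w', of i' j'] * by auto
    have fr: "frame n w (d i) j = frame m w' i j \<cdot> t" "frame n w (d i') j' = frame m w' i' j' \<cdot> t"
      using frm * by auto
    have cod: "Cod C (frame n w (d i) j) = Cod C (frame m w' i j)"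
      "Cod C (frame n w (d i') j') = Cod C (frame m w' i' j')"
      unfolding fr using hom_comp[OF iso_hom[OF t] iso_hom[OF f(1)[unfolded v]]]
        hom_comp[OF iso_hom[OF t] iso_hom[OF f(2)[unfolded v]]] by (auto simp: hom_def)
    have x: "hom x (Cod C (frame m w' i j)) (Cod C (frame m w' i' j'))"
      using deformation_arrow_hom[OF w di(1,2) *(3,4)] cod by (simp add: x_def)
    have "(x \<cdot> frame m w' i j) \<cdot> t = frame m w' i' j' \<cdot> t"
      using deformation_arrow_comp[OF w di(1,2) *(3,4)] fr
        hom_assoc[OF iso_hom[OF t] iso_hom[OF f(1)[unfolded v]] x] by (simp add: x_def)
    then have "x \<cdot> frame m w' i j = frame m w' i' j'"
      using iso_cancel_right[OF t hom_comp[OF iso_hom[OF f(1)[unfolded v]] x] iso_hom[OF f(2)[unfolded v]]]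
      by simp
    then have "arrow (deformation m w') i j i' j' = x"
      by (rule deformation_arrow_eqI[OF w' * x])
    then show "arrow (deformation m w') i j i' j' =
        arrow (act (space_at NC 1) (2 * m + 1) (2 * n + 1) d (deformation n w)) i j i' j'"
      using arrow_act[OF deformation_in_cel[OF w] d *] by (simp add: x_def)
  qed
qed

lemma degen_NC: "degen NC 0 0 = oper NC 1 0 (codegeneracy 0 0)"
  by (simp add: degen_def)

lemma arrow_degen:
  assumes "x \<in> cel 0 p" "i \<le> i'" "i' \<le> p" "j \<le> j'" "j' \<le> 1"
  shows "arrow (degen NC 0 0 p x) i j i' j' = arrow x i 0 i' 0"
  unfolding degen_NC using arrow_oper[OF assms(1) codegeneracy_Delta assms(2-5)] assms(4,5)
  by (simp add: codegeneracy_0)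

lemma degen_in_hoequiv:
  assumes x: "x \<in> cel 0 p"
  shows "degen NC 0 0 p x \<in> cells (hoequiv_space NC) p"
proof -
  have "degen NC 0 0 p x \<in> cel 1 p"
    unfolding degen_NC by (rule oper_in_cel[OF x codegeneracy_Delta])
  then show ?thesis
    using arrow_degen[OF x, of 0 0 0 1] arrow_iso[OF x, of 0 0 0] by (simp add: hoequiv_space_cells iso_def)
qed

lemma degen_weak_equivalence:
  "weak_equivalence (space_at NC 0) (hoequiv_space NC) (degen NC 0 0)"
proof (rule weak_equivalence_deformation[OF simplicial_set_NC simplicial_set_hoequiv_space])
  have S: "act (hoequiv_space NC) = act (space_at NC 1)" by (simp add: hoequiv_space_def)
  \<comment> \<open>This is \<open>d\<^sub>1\<close>, as \<open>coface 0 1\<close> is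
    \<open>vert 0\<close>; it sends an isomorphism to its source.\<close>
  let ?g = "oper NC 0 1 (vert 0)"
  have v0: "vert 0 \<in> Delta 0 1" by (simp add: vert_in_Delta)
  note cel = hoequiv_cel
  show f: "simplicial_map (space_at NC 0) (hoequiv_space NC) (degen NC 0 0)"
    unfolding simplicial_map_def S
    using degen_in_hoequiv oper_act[OF codegeneracy_Delta] by (auto simp: degen_NC)
  show g: "simplicial_map (hoequiv_space NC) (space_at NC 0) ?g"
    unfolding simplicial_map_def S
    using oper_in_cel[OF cel v0] oper_act[OF v0 _ cel] by auto
  show "?g n (degen NC 0 0 n x) = x" if x: "x \<in> cel 0 n" for n x
  proof (rule cel_eqI[OF _ x])
    have d: "degen NC 0 0 n x \<in> cel 1 n" using cel[OF degen_in_hoequiv[OF x]] .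
    show "?g n (degen NC 0 0 n x) \<in> cel 0 n" by (rule oper_in_cel[OF d v0])
    fix i i' j j' assume *: "i \<le> i'" "i' \<le> n" "j \<le> j'" "j' \<le> (0::nat)"
    then show "arrow (?g n (degen NC 0 0 n x)) i j i' j' = arrow x i j i' j'"
      using arrow_oper[OF d v0 *] arrow_degen[OF x *(1,2), of 0 0] by simp
  qed
  have ends: "act (hoequiv_space NC) n (2 * n + 1) (ordinal_front n) (deformation n w) = degen NC 0 0 n (?g n w)"
    "act (hoequiv_space NC) n (2 * n + 1) (ordinal_back n) (deformation n w) = w"
    if w: "w \<in> cells (hoequiv_space NC) n" for n w
    unfolding S
  proof -
    note wc = cel[OF w] and K = deformation_in_cel[OF w]
    have gw: "?g n w \<in> cel 0 n" by (rule oper_in_cel[OF wc v0])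
    show "act (space_at NC 1) n (2 * n + 1) (ordinal_front n) (deformation n w) = degen NC 0 0 n (?g n w)"
    proof (rule cel_eqI[OF act_in_cel[OF K ordinal_front_in_Delta] cel[OF degen_in_hoequiv[OF gw]]])
      fix i i' j j' :: nat assume *: "i \<le> i'" "i' \<le> n" "j \<le> j'" "j' \<le> 1"
      have fr: "frame n w i j = arrow w 0 0 i 0" "frame n w i' j' = arrow w 0 0 i' 0"
        using * by (auto simp: frame_def)
      have "arrow (deformation n w) i j i' j' = arrow w i 0 i' 0"
        using * arrow_hom[OF wc, of i i' 0 0] arrow_hom[OF wc, of 0 i 0 0] arrow_hom[OF wc, of 0 i' 0 0]
          arrow_comp[OF wc, of 0 i i' 0 0 0]
        by (intro deformation_arrow_eqI[OF w]) (auto simp: fr hom_def)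
      then show "arrow (act (space_at NC 1) n (2 * n + 1) (ordinal_front n) (deformation n w)) i j i' j' =
          arrow (degen NC 0 0 n (?g n w)) i j i' j'"
        using arrow_act[OF K ordinal_front_in_Delta *] arrow_degen[OF gw *]
          arrow_oper[OF wc v0, of i i' 0 0] * by (simp add: ordinal_front_def)
    qed
    show "act (space_at NC 1) n (2 * n + 1) (ordinal_back n) (deformation n w) = w"
    proof (rule cel_eqI[OF act_in_cel[OF K ordinal_back_in_Delta] wc])
      fix i i' j j' :: nat assume *: "i \<le> i'" "i' \<le> n" "j \<le> j'" "j' \<le> 1"
      have fr: "frame n w (Suc n + i) j = arrow w 0 0 i j" "frame n w (Suc n + i') j' = arrow w 0 0 i' j'"
        using * by (auto simp: frame_def)
      have "arrow (deformation n w) (Suc n + i) j (Suc n + i') j' = arrow w i j i' j'"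
        using * arrow_hom[OF wc, of i i' j j'] arrow_hom[OF wc, of 0 i 0 j] arrow_hom[OF wc, of 0 i' 0 j']
          arrow_comp[OF wc, of 0 i i' 0 j j']
        by (intro deformation_arrow_eqI[OF w]) (auto simp: fr fr[simplified] hom_def)
      then show "arrow (act (space_at NC 1) n (2 * n + 1) (ordinal_back n) (deformation n w)) i j i' j' =
          arrow w i j i' j'"
        using arrow_act[OF K ordinal_back_in_Delta *] * by (simp add: ordinal_back_def)
    qed
  qed
  show "homotopic_with (\<lambda>_. True) (realization (hoequiv_space NC)) (realization (hoequiv_space NC))
     (realization_map (hoequiv_space NC) (\<lambda>n y. degen NC 0 0 n (?g n y)))
     (realization_map (hoequiv_space NC) (\<lambda>n y. y))"
    by (rule homotopic_realization_maps[OF simplicial_set_hoequiv_space simplicial_set_hoequiv_space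
          simplicial_map_comp[OF g f] _ deformation_in_hoequiv deformation_natural[folded S] ends])
      (simp_all add: simplicial_map_def)
qed

subsection \<open>Reedy fibrancy\<close>

text \<open>\<open>A\<close> is discrete in the space direction and the standard simplex is constant
  in the other. Naturality therefore splits into one law acting on \<open>\<sigma>\<close> alone and
  one acting on \<open>\<psi>\<close> alone.\<close>

lemma map_space_cells:
  assumes "represents A T"
  shows "f \<in> cells (map_space A NC) n \<longleftrightarrow>
     (\<forall>i p. f i p \<in> extensional (T i \<times> Delta p n)) \<and>
     (\<forall>i p. \<forall>\<psi>\<in>T i. \<forall>\<sigma>\<in>Delta p n. f i p (\<psi>, \<sigma>) \<in> cel i p) \<and>
     (\<forall>i p q. \<forall>\<tau>\<in>Delta p q. \<forall>\<psi>\<in>T i. \<forall>\<sigma>\<in>Delta q n.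
        f i p (\<psi>, compose {..p} \<sigma> \<tau>) = act (space_at NC i) p q \<tau> (f i q (\<psi>, \<sigma>))) \<and>
     (\<forall>m i. \<forall>\<theta>\<in>Delta m i. \<forall>p. \<forall>\<psi>\<in>T i. \<forall>\<sigma>\<in>Delta p n.
        f m p (compose {..m} \<psi> \<theta>, \<sigma>) = oper NC m i \<theta> p (f i p (\<psi>, \<sigma>)))"
proof -
  let ?P = "prod_sspace A (const_sspace (std_simplex n))"
  have c: "cells (space_at ?P i) p = T i \<times> Delta p n" for i p
    using assms by (simp add: represents_def prod_sspace_def prod_sset_def const_sspace_def std_simplex_def)
  have a: "act (space_at ?P i) p q \<tau> (\<psi>, \<sigma>) = (\<psi>, compose {..p} \<sigma> \<tau>)" for i p q \<tau> \<psi> \<sigma>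
    using assms by (simp add: represents_def prod_sspace_def prod_sset_def const_sspace_def std_simplex_def)
  have o: "oper ?P m i \<theta> p (\<psi>, \<sigma>) = (compose {..m} \<psi> \<theta>, \<sigma>)" for m i \<theta> p \<psi> \<sigma>
    using assms by (simp add: represents_def prod_sspace_def const_sspace_def)
  have B: "(\<forall>z\<in>X \<times> Y. Q z) \<longleftrightarrow> (\<forall>x\<in>X. \<forall>y\<in>Y. Q (x, y))" for X Y and Q :: "_ \<times> _ \<Rightarrow> bool"
    by auto
  have "f \<in> cells (map_space A NC) n \<longleftrightarrow> f \<in> sspace_maps ?P NC"
    by (simp add: map_space_def)
  also have "\<dots> \<longleftrightarrow> (\<forall>i p. f i p \<in> extensional (T i \<times> Delta p n)) \<and>
     (\<forall>i p. \<forall>\<psi>\<in>T i. \<forall>\<sigma>\<in>Delta p n. f i p (\<psi>, \<sigma>) \<in> cel i p) \<and>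
     (\<forall>i p q. \<forall>\<tau>\<in>Delta p q. \<forall>\<psi>\<in>T i. \<forall>\<sigma>\<in>Delta q n.
        f i p (\<psi>, compose {..p} \<sigma> \<tau>) = act (space_at NC i) p q \<tau> (f i q (\<psi>, \<sigma>))) \<and>
     (\<forall>m i. \<forall>\<theta>\<in>Delta m i. \<forall>p. \<forall>\<psi>\<in>T i. \<forall>\<sigma>\<in>Delta p n.
        f m p (compose {..m} \<psi> \<theta>, \<sigma>) = oper NC m i \<theta> p (f i p (\<psi>, \<sigma>)))"
    unfolding sspace_maps_def mem_Collect_eq simplicial_map_def c Pi_iff B a o by blast
  finally show ?thesis .
qed

lemma map_space_act:
  assumes "represents A T"
  shows "act (map_space A NC) m n \<theta> f =
     (\<lambda>i p. \<lambda>(\<psi>, \<sigma>)\<in>T i \<times> Delta p m. f i p (\<psi>, compose {..p} \<theta> \<sigma>))"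
  using assms by (simp add: map_space_def represents_def)

lemma map_restrict_eq:
  assumes "represents A T"
  shows "map_restrict A n f = (\<lambda>i p. restrict (f i p) (T i \<times> Delta p n))"
  using assms by (simp add: map_restrict_def represents_def)

lemma simplicial_map_map_restrict:
  "simplicial_map (map_space (rep_F k) NC) (map_space (rep_F_dot k) NC) (map_restrict (rep_F_dot k))"
  unfolding simplicial_map_def
proof (intro conjI allI ballI funcsetI)
  note F = represents_rep_F[of k] and F' = represents_rep_F_dot[of k]
  have D: "\<psi> \<in> Delta n k" if "\<psi> \<in> nonsurjections k n" for \<psi> n
    using that by (simp add: nonsurjections_def)
  fix n f assume f: "f \<in> cells (map_space (rep_F k) NC) n"
  show "map_restrict (rep_F_dot k) n f \<in> cells (map_space (rep_F_dot k) NC) n"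
    using f unfolding map_space_cells[OF F] map_space_cells[OF F'] map_restrict_eq[OF F']
    by (simp add: D Delta_compose nonsurjections_compose)
  fix m \<theta> assume \<theta>: "\<theta> \<in> Delta m n"
  show "map_restrict (rep_F_dot k) m (act (map_space (rep_F k) NC) m n \<theta> f) =
      act (map_space (rep_F_dot k) NC) m n \<theta> (map_restrict (rep_F_dot k) n f)"
    unfolding map_restrict_eq[OF F'] map_space_act[OF F] map_space_act[OF F']
    by (intro ext) (auto simp: restrict_def D Delta_compose[OF _ \<theta>])
qed

section \<open>Uniqueness and existence of horn fillers\<close>

lemma cel_eq_of_columns:
  assumes x: "x \<in> cel m p" and y: "y \<in> cel m p" and s: "s \<le> p"
    and col: "\<And>i i' j. i \<le> i' \<Longrightarrow> i' \<le> p \<Longrightarrow> j \<le> m \<Longrightarrow> arrow x i j i' j = arrow y i j i' j"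
    and row: "\<And>j j'. j \<le> j' \<Longrightarrow> j' \<le> m \<Longrightarrow> arrow x s j s j' = arrow y s j s j'"
  shows "x = y"
proof (rule cel_eqI[OF x y])
  have v: "vob x i j = vob y i j" if "i \<le> p" "j \<le> m" for i j
    using col[OF order_refl that] by (simp add: vertex_obj_def)
  \<comment> \<open>Rows \<open>i\<close> and \<open>s\<close> are joined by column isomorphisms
    common to \<open>x\<close> and \<open>y\<close>. They cancel on the right if \<open>s\<close>
    comes first and on the left if \<open>i\<close> does.\<close>
  have h: "arrow x i j i j' = arrow y i j i j'" if i: "i \<le> p" and j: "j \<le> j'" "j' \<le> m" for i j j'
  proof (cases "s \<le> i")
    case True
    have "arrow x i j i j' \<cdot> arrow x s j i j = arrow x s j' i j' \<cdot> arrow x s j s j'"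
      using arrow_comp[OF x True order_refl i, of j j j'] arrow_comp[OF x order_refl True i, of j j' j'] j by simp
    also have "\<dots> = arrow y i j i j' \<cdot> arrow y s j i j"
      using arrow_comp[OF y True order_refl i, of j j j'] arrow_comp[OF y order_refl True i, of j j' j'] j
        col[OF True i, of j'] row[OF j] by simp
    finally show ?thesis
      using iso_cancel_right[OF arrow_iso[OF x True i, of j] arrow_hom[OF x order_refl i j]]
        arrow_hom[OF y order_refl i j] v i j col[OF True i, of j] by simp
  next
    case False
    then have is': "i \<le> s" by simp
    have "arrow x i j' s j' \<cdot> arrow x i j i j' = arrow x s j s j' \<cdot> arrow x i j s j"
      using arrow_comp[OF x is' order_refl s, of j j j'] arrow_comp[OF x order_refl is' s, of j j' j'] j by simp
    also have "\<dots> = arrow y i j' s j' \<cdot> arrow y i j i j'"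
      using arrow_comp[OF y is' order_refl s, of j j j'] arrow_comp[OF y order_refl is' s, of j j' j'] j
        col[OF is' s, of j] row[OF j] by simp
    finally show ?thesis
      using iso_cancel_left[OF arrow_iso[OF x is' s, of j'] arrow_hom[OF x order_refl i j]]
        arrow_hom[OF y order_refl i j] v i j col[OF is' s, of j'] by simp
  qed
  fix i i' j j' assume *: "i \<le> i'" "i' \<le> p" "j \<le> j'" "j' \<le> m"
  show "arrow x i j i' j' = arrow y i j i' j'"
    using arrow_comp[OF x order_refl *(1,2,3) order_refl *(4)] arrow_comp[OF y order_refl *(1,2,3) order_refl *(4)]
      h[of i j j'] col[of i i' j'] * by simp
qed

text \<open>Every face of the horn opposite a vertex other than \<open>r\<close> contains
  \<open>r\<close>. The edges at \<open>r\<close>, inverted where necessary, therefore connect the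
  vertices to \<open>r\<close>, and transporting the constant diagram on \<open>v r\<close> along
  them fills the horn.\<close>

lemma horn_filler_0:
  assumes n: "n \<ge> 1" and r: "r \<le> n"
    and U: "\<And>p \<sigma>. \<sigma> \<in> cells (horn n r) p \<Longrightarrow> U p \<sigma> \<in> cel 0 p"
    and nat_U: "\<And>p q \<sigma> \<tau>. \<sigma> \<in> cells (horn n r) q \<Longrightarrow> \<tau> \<in> Delta p q \<Longrightarrow>
        U p (compose {..p} \<sigma> \<tau>) = act (space_at NC 0) p q \<tau> (U q \<sigma>)"
  obtains E where "E \<in> cel 0 n" "\<And>p \<sigma>. \<sigma> \<in> cells (horn n r) p \<Longrightarrow> act (space_at NC 0) p n \<sigma> E = U p \<sigma>"
proof -
  \<comment> \<open>\<open>misses S\<close> says that the vertices in \<open>S\<close> lie in a face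
    opposite some vertex other than \<open>r\<close>, so a simplex on them belongs to the
    horn.\<close>
  define misses where "misses S \<longleftrightarrow> (\<exists>j\<le>n. j \<noteq> r \<and> j \<notin> S)" for S
  define e where "e a b = arrow (U 1 (edge a b)) 0 0 1 0" for a b
  define v where "v a = vob (U 0 (vert a)) 0 0" for a
  have horn_edge: "edge a b \<in> cells (horn n r) 1" if "a \<le> b" "b \<le> n" "misses {a, b}" for a b
    using that edge_in_Delta[OF that(1,2)] by (auto simp: horn_cells misses_def le_Suc_eq)
  have Uarr: "arrow (U p \<sigma>) a 0 b 0 = e (\<sigma> a) (\<sigma> b)" "vob (U p \<sigma>) a 0 = v (\<sigma> a)"
    if \<sigma>: "\<sigma> \<in> cells (horn n r) p" and ab: "a \<le> b" "b \<le> p" for p \<sigma> a b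
  proof -
    have "U 1 (edge (\<sigma> a) (\<sigma> b)) = act (space_at NC 0) 1 p (edge a b) (U p \<sigma>)"
      using nat_U[OF \<sigma> edge_in_Delta[OF ab]] compose_edge by simp
    then show "arrow (U p \<sigma>) a 0 b 0 = e (\<sigma> a) (\<sigma> b)"
      using arrow_act[OF U[OF \<sigma>] edge_in_Delta[OF ab], of 0 1 0 0] by (simp add: e_def)
    have "U 0 (vert (\<sigma> a)) = act (space_at NC 0) 0 p (vert a) (U p \<sigma>)"
      using nat_U[OF \<sigma> vert_in_Delta[of a p]] compose_vert[of a p \<sigma>] ab by simp
    then show "vob (U p \<sigma>) a 0 = v (\<sigma> a)"
      using vob_act[OF U[OF \<sigma>] vert_in_Delta[of a p], of 0 0] ab by (simp add: v_def)
  qed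
  have e_iso: "iso (e a b) (v a) (v b)" if "a \<le> b" "b \<le> n" "misses {a, b}" for a b
    using arrow_iso[OF U[OF horn_edge[OF that]], of 0 1 0] Uarr[OF horn_edge[OF that], of 0 1]
      Uarr(2)[OF horn_edge[OF that], of 1 1] by simp
  have e_comp: "e b c \<cdot> e a b = e a c" if "a \<le> b" "b \<le> c" "c \<le> n" "misses {a, b, c}" for a b c
  proof -
    define \<tau> where "\<tau> = (\<lambda>j\<in>{..2::nat}. if j = 0 then a else if j = 1 then b else c)"
    have \<tau>s: "\<tau> 0 = a" "\<tau> 1 = b" "\<tau> 2 = c" by (auto simp: \<tau>_def)
    have "\<tau> \<in> Delta 2 n"
      using that by (auto simp: \<tau>_def Delta_def mono_on_def)
    moreover have "\<exists>j\<le>n. j \<noteq> r \<and> (\<forall>i\<le>2. \<tau> i \<noteq> j)"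
      using that(4) by (auto simp: misses_def \<tau>_def)
    ultimately have \<tau>: "\<tau> \<in> cells (horn n r) 2" by (simp add: horn_cells)
    show ?thesis
      using arrow_comp[OF U[OF \<tau>], of 0 1 2 0 0 0] Uarr(1)[OF \<tau>, of 0 1] Uarr(1)[OF \<tau>, of 1 2]
        Uarr(1)[OF \<tau>, of 0 2] \<tau>s by simp
  qed
  have mr: "misses {r}"
  proof -
    have "(if r = 0 then 1 else 0) \<le> n" "(if r = 0 then 1 else 0) \<noteq> r" using n by auto
    then show ?thesis unfolding misses_def by (metis singletonD)
  qed
  have b: "v r \<in> Obj C"
    using hom_Obj[OF iso_hom[OF e_iso[of r r]]] mr r by simp
  \<comment> \<open>The default applies only for \<open>n = 1\<close> and
    \<open>i \<noteq> r\<close>: the horn is then the single vertex \<open>r\<close>, the other end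
    is free, and an identity is chosen.\<close>
  define \<phi> where "\<phi> i j = (if misses {i, r} then if r \<le> i then e r i else inverse_arrow (e i r)
      else Ident C (v r))" for i and j :: nat
  have \<phi>_iso: "iso (\<phi> i j) (v r) (Cod C (\<phi> i j))" if "i \<le> n" for i j
  proof -
    have "\<exists>c. iso (\<phi> i j) (v r) c"
      using e_iso[of r i] iso_inverse_arrow[OF e_iso[of i r]] iso_Ident[OF b] that r
      by (auto simp: \<phi>_def insert_commute)
    then show ?thesis by (auto simp: iso_def hom_def)
  qed
  have D: "diagram 0 n (star \<phi> (\<lambda>_ _. Ident C (v r)))"
    by (rule star_diagram[where c = "\<lambda>i j. Cod C (\<phi> i j)", OF const_diagram[OF b]])
      (simp add: Dom_Ident[OF b] \<phi>_iso)
  define E where "E = cell_of 0 n (star \<phi> (\<lambda>_ _. Ident C (v r)))"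
  have E: "E \<in> cel 0 n" unfolding E_def by (rule cell_of_in_cel[OF D])
  have "act (space_at NC 0) p n \<sigma> E = U p \<sigma>" if \<sigma>: "\<sigma> \<in> cells (horn n r) p" for p \<sigma>
  proof (rule cel_eqI)
    have \<sigma>D: "\<sigma> \<in> Delta p n" using \<sigma> by (simp add: horn_cells)
    show "act (space_at NC 0) p n \<sigma> E \<in> cel 0 p" by (rule act_in_cel[OF E \<sigma>D])
    show "U p \<sigma> \<in> cel 0 p" by (rule U[OF \<sigma>])
    fix a a' j j' assume *: "a \<le> a'" "a' \<le> p" "j \<le> j'" "j' \<le> (0::nat)"
    define s where "s = \<sigma> a" define t where "t = \<sigma> a'"
    have st: "s \<le> t" "t \<le> n" using DeltaD[OF \<sigma>D] * by (auto simp: s_def t_def)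
    obtain l where l: "l \<le> n" "l \<noteq> r" "\<forall>i\<le>p. \<sigma> i \<noteq> l"
      using \<sigma> by (auto simp: horn_cells)
    then have "l \<noteq> s" "l \<noteq> t" unfolding s_def t_def using *(2) order_trans[OF *(1,2)] by blast+
    \<comment> \<open>The omitted vertex \<open>l\<close> differs from \<open>r\<close>, so
      adjoining \<open>r\<close> to the edge from \<open>s\<close> to \<open>t\<close> stays inside
      the horn and the triangle commutes; its form depends on the position of
      \<open>r\<close>.\<close>
    with l have m: "misses {r, s, t}" unfolding misses_def by blast
    then have m': "misses {s, r}" "misses {t, r}" "misses {r, s}" "misses {r, t}" "misses {s, t}"
      "misses {s, r, t}" "misses {s, t, r}"
      by (auto simp: misses_def)
    note x = iso_hom[OF e_iso[OF st m'(5)]]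
    have "e s t \<cdot> \<phi> s j = \<phi> t j' \<and> hom (\<phi> s j) (v r) (v s) \<and> hom (\<phi> t j') (v r) (v t)"
    proof -
      consider "r \<le> s" | "s < r" "r \<le> t" | "t < r" by linarith
      then show ?thesis
      proof cases
        case 1
        then show ?thesis
          using e_comp[of r s t] e_iso[of r s, THEN iso_hom] e_iso[of r t, THEN iso_hom] st m m'
          by (simp add: \<phi>_def)
      next
        case 2
        then have i: "iso (e s r) (v s) (v r)" "iso (e r t) (v r) (v t)" using e_iso m' st r by auto
        have "e s t \<cdot> inverse_arrow (e s r) = e r t"
          using e_comp[of s r t] comp_inverse_cancel(2)[OF i(1) iso_hom[OF i(2)]] 2 st m' by simp
        then show ?thesis
          using 2 m' i inverse_arrow(1)[OF i(1)] by (simp add: \<phi>_def iso_hom)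
      next
        case 3
        then have i: "iso (e s r) (v s) (v r)" "iso (e t r) (v t) (v r)" using e_iso m' st r by auto
        have "e t r \<cdot> e s t \<cdot> inverse_arrow (e s r) = Ident C (v r)"
          using e_comp[of s t r] inverse_arrow[OF i(1)] hom_assoc[OF inverse_arrow(1)[OF i(1)] x iso_hom[OF i(2)]]
            3 st m' r by simp
        also have "\<dots> = e t r \<cdot> inverse_arrow (e t r)" using inverse_arrow[OF i(2)] by simp
        finally have "e s t \<cdot> inverse_arrow (e s r) = inverse_arrow (e t r)"
          using iso_cancel_left[OF i(2) hom_comp[OF inverse_arrow(1)[OF i(1)] x] inverse_arrow(1)[OF i(2)]] by simp
        then show ?thesis
          using 3 st m' inverse_arrow(1)[OF i(1)] inverse_arrow(1)[OF i(2)] by (simp add: \<phi>_def)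
      qed
    qed
    then have "star \<phi> (\<lambda>_ _. Ident C (v r)) s j t j' = e s t"
      using x hom_Ident[OF b] \<phi>_iso[of s j] st hom_comp_Ident(1)[of "\<phi> t j'"]
      by (intro star_eqI[where \<phi> = \<phi> and A = "\<lambda>_ _. Ident C (v r)" and a = "v r" and b = "v s" and a' = "v r" and b' = "v t"])
        (auto simp: iso_def hom_def)
    then show "arrow (act (space_at NC 0) p n \<sigma> E) a j a' j' = arrow (U p \<sigma>) a j a' j'"
      using arrow_act[OF E \<sigma>D *] arrow_cell_of[OF D st *(3,4)] Uarr(1)[OF \<sigma> *(1,2)] *
      by (simp add: E_def s_def t_def)
  qed
  with E show thesis by (rule that)
qed

text \<open>For \<open>k \<ge> 1\<close> the vertices of \<open>F(k)\<close> lie in its boundary, so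
  \<open>V\<close> gives every column of the filler on all of \<open>[n]\<close>. A horn vertex
  \<open>i\<close> lies together with \<open>r\<close> on an edge of the horn; that edge shares row
  \<open>r\<close> with \<open>E\<close>, so it is a face of \<open>E\<close>, and hence row
  \<open>i\<close> agrees too.\<close>

lemma horn_filler:
  assumes n: "n \<ge> 1" and r: "r \<le> n"
    and U: "\<And>p \<sigma>. \<sigma> \<in> cells (horn n r) p \<Longrightarrow> U p \<sigma> \<in> cel k p"
    and nat_U: "\<And>p q \<sigma> \<tau>. \<sigma> \<in> cells (horn n r) q \<Longrightarrow> \<tau> \<in> Delta p q \<Longrightarrow>
        U p (compose {..p} \<sigma> \<tau>) = act (space_at NC k) p q \<tau> (U q \<sigma>)"
    and V: "\<And>i \<psi>. \<psi> \<in> nonsurjections k i \<Longrightarrow> V i \<psi> \<in> cel i n"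
    and nat_V: "\<And>m i \<psi> \<theta>. \<psi> \<in> nonsurjections k i \<Longrightarrow> \<theta> \<in> Delta m i \<Longrightarrow>
        V m (compose {..m} \<psi> \<theta>) = oper NC m i \<theta> n (V i \<psi>)"
    and compat: "\<And>p \<sigma> i \<psi>. \<sigma> \<in> cells (horn n r) p \<Longrightarrow> \<psi> \<in> nonsurjections k i \<Longrightarrow>
        oper NC i k \<psi> p (U p \<sigma>) = act (space_at NC i) p n \<sigma> (V i \<psi>)"
  obtains E where "E \<in> cel k n"
    "\<And>p \<sigma>. \<sigma> \<in> cells (horn n r) p \<Longrightarrow> act (space_at NC k) p n \<sigma> E = U p \<sigma>"
    "\<And>i \<psi>. \<psi> \<in> nonsurjections k i \<Longrightarrow> oper NC i k \<psi> n E = V i \<psi>"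
proof (cases "k = 0")
  case True
  have "nonsurjections 0 i = {}" for i
    by (auto simp: nonsurjections_def Delta_def)
  moreover obtain E where "E \<in> cel 0 n"
    "\<And>p \<sigma>. \<sigma> \<in> cells (horn n r) p \<Longrightarrow> act (space_at NC 0) p n \<sigma> E = U p \<sigma>"
    using horn_filler_0[OF n r, of U] U nat_U unfolding True by metis
  ultimately show ?thesis using that unfolding True by blast
next
  case False
  define G where "G j = V 0 (vert j)" for j
  have vert_ns: "vert j \<in> nonsurjections k 0" if "j \<le> k" for j
  proof -
    have "vert j ` {..0} = {j}" by auto
    moreover have "{j} \<noteq> {..k}" using False by (metis atMost_iff bot_nat_0.extremum order_refl singletonD)
    ultimately show ?thesis using vert_in_Delta[OF that] by (simp add: nonsurjections_def)
  qed
  have G: "G j \<in> cel 0 n" if "j \<le> k" for j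
    unfolding G_def by (rule V[OF vert_ns[OF that]])
  have UG: "arrow (U p \<sigma>) a j a' j = arrow (G j) (\<sigma> a) 0 (\<sigma> a') 0"
    if \<sigma>: "\<sigma> \<in> cells (horn n r) p" and "j \<le> k" "a \<le> a'" "a' \<le> p" for p \<sigma> j a a'
  proof -
    have \<sigma>D: "\<sigma> \<in> Delta p n" using \<sigma> by (simp add: horn_cells)
    have "arrow (oper NC 0 k (vert j) p (U p \<sigma>)) a 0 a' 0 = arrow (act (space_at NC 0) p n \<sigma> (G j)) a 0 a' 0"
      using compat[OF \<sigma> vert_ns[OF that(2)]] by (simp add: G_def)
    then show ?thesis
      using arrow_oper[OF U[OF \<sigma>] vert_in_Delta[OF that(2)] that(3,4), of 0 0]
        arrow_act[OF G[OF that(2)] \<sigma>D that(3,4), of 0 0] by simp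
  qed
  have VG: "arrow (V i \<psi>) a l a' l = arrow (G (\<psi> l)) a 0 a' 0"
    if \<psi>: "\<psi> \<in> nonsurjections k i" and "l \<le> i" "a \<le> a'" "a' \<le> n" for i \<psi> l a a'
    using nat_V[OF \<psi> vert_in_Delta[OF that(2)]] compose_vert[OF that(2), of \<psi>]
      arrow_oper[OF V[OF \<psi>] vert_in_Delta[OF that(2)] that(3,4), of 0 0] by (simp add: G_def)
  have vr: "vert r \<in> cells (horn n r) 0"
  proof -
    have "(if r = 0 then 1 else 0) \<le> n" "(if r = 0 then 1 else 0) \<noteq> r" using n by auto
    then show ?thesis using vert_in_Delta[OF r] unfolding horn_cells by (metis le_zero_eq vert_0)
  qed
  define c where "c = U 0 (vert r)"
  have c: "c \<in> cel k 0" unfolding c_def by (rule U[OF vr])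
  define A where "A j j' = arrow c 0 j 0 j'" for j j'
  \<comment> \<open>The isomorphism of column \<open>j\<close> from row \<open>r\<close> to row
    \<open>i\<close>, routed through row 0 because arrows are available in increasing order of rows
    only.\<close>
  define \<phi> where "\<phi> i j = arrow (G j) 0 0 i 0 \<cdot> inverse_arrow (arrow (G j) 0 0 r 0)" for i j
  have A: "diagram k 0 (\<lambda>_ j _ j'. A j j')"
    using diagram_reindex[OF diagram_arrow[OF c], of k "\<lambda>j. j" 0 "\<lambda>_. 0"] by (simp add: A_def)
  have cG: "vob c 0 j = vob (G j) r 0" if "j \<le> k" for j
    using UG[OF vr that, of 0 0] by (simp add: c_def vertex_obj_def)
  have A_hom: "hom (A j j') (vob (G j) r 0) (vob (G j') r 0)" if "j \<le> j'" "j' \<le> k" for j j'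
    using arrow_hom[OF c, of 0 0 j j'] cG that by (simp add: A_def)
  have A_Ident: "A j j = Ident C (vob (G j) r 0)" if "j \<le> k" for j
    using arrow_Ident[OF c, of 0 j] cG that by (simp add: A_def)
  have Dom_A: "Dom C (A j j) = vob (G j) r 0" if "j \<le> k" for j
    using A_hom[of j j] that by (simp add: hom_def)
  have \<phi>: "iso (\<phi> i j) (vob (G j) r 0) (vob (G j) i 0)" if "i \<le> n" "j \<le> k" for i j
    unfolding \<phi>_def using arrow_iso[OF G[OF that(2)], of 0 i 0] arrow_iso[OF G[OF that(2)], of 0 r 0] that r
    by (auto intro!: iso_comp iso_inverse_arrow)
  have \<phi>_step: "arrow (G j) i 0 i' 0 \<cdot> \<phi> i j = \<phi> i' j" if "i \<le> i'" "i' \<le> n" "j \<le> k" for i i' j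
  proof -
    note Gj = G[OF that(3)]
    have "hom (inverse_arrow (arrow (G j) 0 0 r 0)) (vob (G j) r 0) (vob (G j) 0 0)"
      using inverse_arrow(1)[OF arrow_iso[OF Gj, of 0 r 0]] r by simp
    from hom_assoc[OF this arrow_hom[OF Gj, of 0 i 0 0] arrow_hom[OF Gj, of i i' 0 0]] show ?thesis
      unfolding \<phi>_def using arrow_comp[OF Gj, of 0 i i' 0 0 0] that by simp
  qed
  have \<phi>_r: "\<phi> r j = Ident C (vob (G j) r 0)" if "j \<le> k" for j
    unfolding \<phi>_def using inverse_arrow(3)[OF arrow_iso[OF G[OF that], of 0 r 0]] r by simp
  have D: "diagram k n (star \<phi> A)"
    by (rule star_diagram[OF A]) (use \<phi> Dom_A in auto)
  define E where "E = cell_of k n (star \<phi> A)"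
  have E: "E \<in> cel k n" unfolding E_def by (rule cell_of_in_cel[OF D])
  have E_col: "arrow E i j i' j = arrow (G j) i 0 i' 0" if "i \<le> i'" "i' \<le> n" "j \<le> k" for i i' j
  proof -
    have "star \<phi> A i j i' j = arrow (G j) i 0 i' 0"
    proof (rule star_eqI[where \<phi> = \<phi> and A = A])
      show "iso (\<phi> i j) (vob (G j) r 0) (vob (G j) i 0)" using \<phi> that by simp
      show "hom (A j j) (vob (G j) r 0) (vob (G j) r 0)" using A_hom that by simp
      show "hom (\<phi> i' j) (vob (G j) r 0) (vob (G j) i' 0)" using \<phi> that by (simp add: iso_hom)
      show "hom (arrow (G j) i 0 i' 0) (vob (G j) i 0) (vob (G j) i' 0)"
        using arrow_hom[OF G] that by simp
      show "arrow (G j) i 0 i' 0 \<cdot> \<phi> i j = \<phi> i' j \<cdot> A j j"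
        using \<phi>_step[OF that] A_Ident[OF that(3)] hom_comp_Ident(1)[OF iso_hom[OF \<phi>[of i' j]]] that by simp
    qed
    then show ?thesis using arrow_cell_of[OF D that(1,2) order_refl that(3)] by (simp add: E_def)
  qed
  have E_row: "arrow E r j r j' = A j j'" if "j \<le> j'" "j' \<le> k" for j j'
  proof -
    have "star \<phi> A r j r j' = A j j'"
    proof (rule star_eqI[where \<phi> = \<phi> and A = A])
      show "iso (\<phi> r j) (vob (G j) r 0) (vob (G j) r 0)" using \<phi> that r by simp
      show "hom (\<phi> r j') (vob (G j') r 0) (vob (G j') r 0)" using \<phi> that r by (simp add: iso_hom)
      show h: "hom (A j j') (vob (G j) r 0) (vob (G j') r 0)" "hom (A j j') (vob (G j) r 0) (vob (G j') r 0)"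
        using A_hom that by auto
      show "A j j' \<cdot> \<phi> r j = \<phi> r j' \<cdot> A j j'"
        using \<phi>_r that hom_comp_Ident[OF h(1)] by simp
    qed
    then show ?thesis using arrow_cell_of[OF D order_refl r that] by (simp add: E_def)
  qed
  \<comment> \<open>All columns of \<open>E\<close> are already right, so by
    \<open>cel_eq_of_columns\<close> agreement in a single row \<open>s\<close> is enough.\<close>
  have E_U: "act (space_at NC k) p n \<sigma> E = U p \<sigma>"
    if \<sigma>: "\<sigma> \<in> cells (horn n r) p" and s: "s \<le> p"
      and row: "\<And>j j'. j \<le> j' \<Longrightarrow> j' \<le> k \<Longrightarrow> arrow (U 0 (vert (\<sigma> s))) 0 j 0 j' = arrow E (\<sigma> s) j (\<sigma> s) j'"
    for p \<sigma> s
  proof (rule cel_eq_of_columns)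
    have \<sigma>D: "\<sigma> \<in> Delta p n" using \<sigma> by (simp add: horn_cells)
    show "act (space_at NC k) p n \<sigma> E \<in> cel k p" by (rule act_in_cel[OF E \<sigma>D])
    show "U p \<sigma> \<in> cel k p" by (rule U[OF \<sigma>])
    show "s \<le> p" by (rule s)
    show "arrow (act (space_at NC k) p n \<sigma> E) i j i' j = arrow (U p \<sigma>) i j i' j"
      if "i \<le> i'" "i' \<le> p" "j \<le> k" for i i' j
      using arrow_act[OF E \<sigma>D that(1,2) order_refl that(3)] UG[OF \<sigma> that(3,1,2)]
        E_col[of "\<sigma> i" "\<sigma> i'" j] DeltaD[OF \<sigma>D] that by simp
    show "arrow (act (space_at NC k) p n \<sigma> E) s j s j' = arrow (U p \<sigma>) s j s j'"
      if "j \<le> j'" "j' \<le> k" for j j'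
      using arrow_act[OF E \<sigma>D order_refl s that] row[OF that] nat_U[OF \<sigma> vert_in_Delta[OF s]]
        compose_vert[OF s, of \<sigma>] arrow_act[OF U[OF \<sigma>] vert_in_Delta[OF s] order_refl order_refl that] by simp
  qed
  have U_vert: "arrow (U 0 (vert i)) 0 j 0 j' = arrow E i j i j'"
    if i: "vert i \<in> cells (horn n r) 0" "i \<le> n" and j: "j \<le> j'" "j' \<le> k" for i j j'
  proof -
    \<comment> \<open>The edge on \<open>i\<close> and \<open>r\<close> in increasing order;
      \<open>s\<close> is its end at \<open>r\<close> and \<open>1 - s\<close> its end at
      \<open>i\<close>.\<close>
    define e where "e = edge (min i r) (max i r)"
    define s where "s = (if r \<le> i then 0 else 1 :: nat)"
    have es: "s \<le> 1" "e s = r" "1 - s \<le> 1" "e (1 - s) = i"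
      using r by (auto simp: e_def s_def)
    have eD: "e \<in> Delta 1 n" unfolding e_def using i r by (intro edge_in_Delta) auto
    have "\<exists>l\<le>n. l \<noteq> r \<and> l \<noteq> i" using i(1) unfolding horn_cells by (metis le_zero_eq vert_0)
    then have e: "e \<in> cells (horn n r) 1"
      unfolding horn_cells using eD by (auto simp: e_def le_Suc_eq min_def max_def)
    have "act (space_at NC k) 1 n e E = U 1 e"
      by (rule E_U[OF e es(1)]) (use E_row es(2) in \<open>simp add: A_def c_def\<close>)
    then have "arrow (U 1 e) (1 - s) j (1 - s) j' = arrow E i j i j'"
      using arrow_act[OF E eD order_refl es(3) j] es(4) by simp
    then show ?thesis
      using nat_U[OF e vert_in_Delta[OF es(3)]] compose_vert[OF es(3), of e] es(4)
        arrow_act[OF U[OF e] vert_in_Delta[OF es(3)] order_refl order_refl j] by simp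
  qed
  have "act (space_at NC k) p n \<sigma> E = U p \<sigma>" if \<sigma>: "\<sigma> \<in> cells (horn n r) p" for p \<sigma>
  proof (rule E_U[OF \<sigma> le0])
    have "vert (\<sigma> 0) \<in> cells (horn n r) 0"
      using horn_compose[OF \<sigma> vert_in_Delta[OF le0]] compose_vert[of 0 p \<sigma>] by simp
    moreover have "\<sigma> 0 \<le> n" using \<sigma> DeltaD(1)[of \<sigma> p n 0] by (simp add: horn_cells)
    ultimately show "arrow (U 0 (vert (\<sigma> 0))) 0 j 0 j' = arrow E (\<sigma> 0) j (\<sigma> 0) j'"
      if "j \<le> j'" "j' \<le> k" for j j'
      using U_vert that by blast
  qed
  moreover have "oper NC i k \<psi> n E = V i \<psi>" if \<psi>: "\<psi> \<in> nonsurjections k i" for i \<psi>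
  proof (rule cel_eq_of_columns)
    have \<psi>D: "\<psi> \<in> Delta i k" using \<psi> by (simp add: nonsurjections_def)
    show "oper NC i k \<psi> n E \<in> cel i n" by (rule oper_in_cel[OF E \<psi>D])
    show "V i \<psi> \<in> cel i n" by (rule V[OF \<psi>])
    show "r \<le> n" by (rule r)
    show "arrow (oper NC i k \<psi> n E) a l a' l = arrow (V i \<psi>) a l a' l"
      if "a \<le> a'" "a' \<le> n" "l \<le> i" for a a' l
      using arrow_oper[OF E \<psi>D that(1,2) order_refl that(3)] E_col[OF that(1,2), of "\<psi> l"]
        VG[OF \<psi> that(3,1,2)] DeltaD(1)[OF \<psi>D that(3)] by simp
    \<comment> \<open>Row \<open>r\<close> of \<open>E\<close> comes from \<open>U\<close> at the
      horn vertex \<open>r\<close>, where \<open>compat\<close> equates it with the boundary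
      data.\<close>
    show "arrow (oper NC i k \<psi> n E) r l r l' = arrow (V i \<psi>) r l r l'" if "l \<le> l'" "l' \<le> i" for l l'
    proof -
      have "arrow (oper NC i k \<psi> n E) r l r l' = arrow c 0 (\<psi> l) 0 (\<psi> l')"
        using arrow_oper[OF E \<psi>D order_refl r that] E_row[OF DeltaD(2)[OF \<psi>D that] DeltaD(1)[OF \<psi>D that(2)]]
        by (simp add: A_def)
      also have "\<dots> = arrow (act (space_at NC i) 0 n (vert r) (V i \<psi>)) 0 l 0 l'"
        using arrow_oper[OF c \<psi>D order_refl order_refl that] compat[OF vr \<psi>] by (simp add: c_def)
      also have "\<dots> = arrow (V i \<psi>) r l r l'"
        using arrow_act[OF V[OF \<psi>] vert_in_Delta[OF r] order_refl order_refl that] by simp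
      finally show ?thesis .
    qed
  qed
  ultimately show thesis using E that by blast
qed

section \<open>Lifting problems between mapping spaces\<close>

lemma act_compose:
  assumes "x \<in> cel m q" "\<theta> \<in> Delta l p" "\<sigma> \<in> Delta p q"
  shows "act (space_at NC m) l q (compose {..l} \<sigma> \<theta>) x = act (space_at NC m) l p \<theta> (act (space_at NC m) p q \<sigma> x)"
  using simplicial_set_NC[of m] assms unfolding simplicial_set_def by blast

lemma oper_compose:
  assumes "x \<in> cel n p" "\<theta> \<in> Delta l m" "\<psi> \<in> Delta m n"
  shows "oper NC l n (compose {..l} \<psi> \<theta>) p x = oper NC l m \<theta> p (oper NC m n \<psi> p x)"
  using simplicial_space_NC assms unfolding simplicial_space_def by blast

text \<open>By the Yoneda lemma a lifting problem between the mapping spaces amounts to compatible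
  data \<open>U\<close> on a horn and \<open>V\<close> on the boundary of \<open>F(k)\<close>, and a
  lift to one simplex \<open>E\<close> of \<open>(NC)_k\<close> restricting to both.\<close>

lemma reedy_fibrant_NC: "reedy_fibrant NC"
  unfolding reedy_fibrant_def kan_fibration_def
proof (intro allI conjI impI simplicial_map_map_restrict)
  fix k n r u v
  assume n: "1 \<le> n" and r: "r \<le> n"
    and uv: "simplicial_map (horn n r) (map_space (rep_F k) NC) u \<and>
       simplicial_map (std_simplex n) (map_space (rep_F_dot k) NC) v \<and>
       (\<forall>m. \<forall>\<sigma>\<in>cells (horn n r) m. map_restrict (rep_F_dot k) m (u m \<sigma>) = v m \<sigma>)"
  note F = represents_rep_F[of k] and F' = represents_rep_F_dot[of k]
  have ns_D: "\<psi> \<in> Delta i k" if "\<psi> \<in> nonsurjections k i" for \<psi> i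
    using that by (simp add: nonsurjections_def)
  have horn_D: "\<sigma> \<in> Delta p n" if "\<sigma> \<in> cells (horn n r) p" for \<sigma> p
    using that by (simp add: horn_cells)
  note idD = Delta_restrict_id
  have u: "u p \<sigma> \<in> cells (map_space (rep_F k) NC) p" if "\<sigma> \<in> cells (horn n r) p" for p \<sigma>
    using uv that by (auto simp: simplicial_map_def)
  have v: "v p \<sigma> \<in> cells (map_space (rep_F_dot k) NC) p" if "\<sigma> \<in> Delta p n" for p \<sigma>
    using uv that by (auto simp: simplicial_map_def std_simplex_cells)
  note u' = u[unfolded map_space_cells[OF F]] and v' = v[unfolded map_space_cells[OF F']]
  have u_act: "u p (compose {..p} \<sigma> \<tau>) i l (\<psi>, \<kappa>) = u q \<sigma> i l (\<psi>, compose {..l} \<tau> \<kappa>)"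
    if "\<sigma> \<in> cells (horn n r) q" "\<tau> \<in> Delta p q" "\<psi> \<in> Delta i k" "\<kappa> \<in> Delta l p" for p q \<sigma> \<tau> i l \<psi> \<kappa>
  proof -
    have "u p (compose {..p} \<sigma> \<tau>) = act (map_space (rep_F k) NC) p q \<tau> (u q \<sigma>)"
      using uv that(1,2) unfolding simplicial_map_def horn_act by blast
    then show ?thesis unfolding map_space_act[OF F] using that by simp
  qed
  have v_act: "v p (compose {..p} \<sigma> \<tau>) i l (\<psi>, \<kappa>) = v q \<sigma> i l (\<psi>, compose {..l} \<tau> \<kappa>)"
    if "\<sigma> \<in> Delta q n" "\<tau> \<in> Delta p q" "\<psi> \<in> nonsurjections k i" "\<kappa> \<in> Delta l p" for p q \<sigma> \<tau> i l \<psi> \<kappa>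
  proof -
    have "v p (compose {..p} \<sigma> \<tau>) = act (map_space (rep_F_dot k) NC) p q \<tau> (v q \<sigma>)"
      using uv that(1,2) unfolding simplicial_map_def std_simplex_act std_simplex_cells by blast
    then show ?thesis unfolding map_space_act[OF F'] using that by simp
  qed
  \<comment> \<open>Values at universal elements. The identity of \<open>[k]\<close> generates
    \<open>F(k)\<close>, so \<open>U\<close> carries no index \<open>\<psi>\<close>; the boundary
    lacks it, so \<open>V\<close> keeps \<open>\<psi>\<close> and evaluates only at the identity of
    \<open>[n]\<close>.\<close>
  define U where "U p \<sigma> = u p \<sigma> k p (restrict id {..k}, restrict id {..p})" for p \<sigma>
  define V where "V i \<psi> = v n (restrict id {..n}) i n (\<psi>, restrict id {..n})" for i \<psi>
  have uU: "u p \<sigma> i q (\<psi>, \<tau>) = oper NC i k \<psi> q (act (space_at NC k) q p \<tau> (U p \<sigma>))"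
    if \<sigma>: "\<sigma> \<in> cells (horn n r) p" and \<psi>: "\<psi> \<in> Delta i k" and \<tau>: "\<tau> \<in> Delta q p" for p \<sigma> i q \<psi> \<tau>
  proof -
    have "u p \<sigma> i q (compose {..i} (restrict id {..k}) \<psi>, \<tau>) = oper NC i k \<psi> q (u p \<sigma> k q (restrict id {..k}, \<tau>))"
      using u'[OF \<sigma>] \<psi> \<tau> idD by blast
    moreover have "u p \<sigma> k q (restrict id {..k}, compose {..q} (restrict id {..p}) \<tau>) =
       act (space_at NC k) q p \<tau> (U p \<sigma>)"
      unfolding U_def using u'[OF \<sigma>] \<tau> idD by blast
    ultimately show ?thesis
      by (simp add: compose_restrict_id[OF \<psi>] compose_restrict_id[OF \<tau>])
  qed
  have vV: "v p \<sigma> i q (\<psi>, \<tau>) = act (space_at NC i) q n (compose {..q} \<sigma> \<tau>) (V i \<psi>)"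
    if \<sigma>: "\<sigma> \<in> Delta p n" and \<psi>: "\<psi> \<in> nonsurjections k i" and \<tau>: "\<tau> \<in> Delta q p" for p \<sigma> i q \<psi> \<tau>
  proof -
    note st = Delta_compose[OF \<tau> \<sigma>]
    have "v p \<sigma> i q (\<psi>, \<tau>) = v n (restrict id {..n}) i q (\<psi>, compose {..q} \<sigma> \<tau>)"
      using v_act[OF idD \<sigma> \<psi> \<tau>] by (simp add: compose_restrict_id[OF \<sigma>])
    also have "\<dots> = v n (restrict id {..n}) i q (\<psi>, compose {..q} (restrict id {..n}) (compose {..q} \<sigma> \<tau>))"
      by (simp add: compose_restrict_id[OF st])
    also have "\<dots> = act (space_at NC i) q n (compose {..q} \<sigma> \<tau>) (V i \<psi>)"
      unfolding V_def using v'[OF idD] \<psi> st idD by blast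
    finally show ?thesis .
  qed
  have U: "U p \<sigma> \<in> cel k p" if "\<sigma> \<in> cells (horn n r) p" for p \<sigma>
    unfolding U_def using u'[OF that] idD by blast
  have V: "V i \<psi> \<in> cel i n" if "\<psi> \<in> nonsurjections k i" for i \<psi>
    unfolding V_def using v'[OF idD] that idD by blast
  have nat_U: "U p (compose {..p} \<sigma> \<tau>) = act (space_at NC k) p q \<tau> (U q \<sigma>)"
    if \<sigma>: "\<sigma> \<in> cells (horn n r) q" and \<tau>: "\<tau> \<in> Delta p q" for p q \<sigma> \<tau>
  proof -
    have "U p (compose {..p} \<sigma> \<tau>) = u q \<sigma> k p (restrict id {..k}, compose {..p} (restrict id {..q}) \<tau>)"
      using u_act[OF \<sigma> \<tau> idD idD] by (simp add: U_def compose_restrict_id[OF \<tau>])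
    also have "\<dots> = act (space_at NC k) p q \<tau> (U q \<sigma>)"
      unfolding U_def using u'[OF \<sigma>] \<tau> idD by blast
    finally show ?thesis .
  qed
  have nat_V: "V m (compose {..m} \<psi> \<theta>) = oper NC m i \<theta> n (V i \<psi>)"
    if "\<psi> \<in> nonsurjections k i" "\<theta> \<in> Delta m i" for m i \<psi> \<theta>
    unfolding V_def using v'[OF idD] that idD by blast
  have act_id: "act (space_at NC m) p p (restrict id {..p}) x = x" if "x \<in> cel m p" for m p x
    using simplicial_set_NC[of m] that unfolding simplicial_set_def by blast
  have compat: "oper NC i k \<psi> p (U p \<sigma>) = act (space_at NC i) p n \<sigma> (V i \<psi>)"
    if \<sigma>: "\<sigma> \<in> cells (horn n r) p" and \<psi>: "\<psi> \<in> nonsurjections k i" for p \<sigma> i \<psi>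
  proof -
    have "map_restrict (rep_F_dot k) p (u p \<sigma>) i p (\<psi>, restrict id {..p}) = v p \<sigma> i p (\<psi>, restrict id {..p})"
      using uv \<sigma> by simp
    then have "u p \<sigma> i p (\<psi>, restrict id {..p}) = v p \<sigma> i p (\<psi>, restrict id {..p})"
      unfolding map_restrict_eq[OF F'] using \<psi> idD by simp
    then show ?thesis
      using uU[OF \<sigma> ns_D[OF \<psi>] idD] vV[OF horn_D[OF \<sigma>] \<psi> idD] act_id[OF U[OF \<sigma>]]
      by (simp add: compose_restrict_id[OF horn_D[OF \<sigma>]])
  qed
  obtain E where E: "E \<in> cel k n"
    and E_U: "\<And>p \<sigma>. \<sigma> \<in> cells (horn n r) p \<Longrightarrow> act (space_at NC k) p n \<sigma> E = U p \<sigma>"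
    and E_V: "\<And>i \<psi>. \<psi> \<in> nonsurjections k i \<Longrightarrow> oper NC i k \<psi> n E = V i \<psi>"
    using horn_filler[OF n r, of U k V] U nat_U V nat_V compat by blast
  \<comment> \<open>The map corresponding to \<open>E\<close> under Yoneda: it takes the value
    \<open>E\<close> when \<open>\<sigma>\<close>, \<open>\<psi>\<close> and \<open>\<tau>\<close>
    are identities, and naturality dictates the rest.\<close>
  define w where "w p \<sigma> = (\<lambda>i q. \<lambda>(\<psi>, \<tau>)\<in>Delta i k \<times> Delta q p.
     oper NC i k \<psi> q (act (space_at NC k) q n (compose {..q} \<sigma> \<tau>) E))" for p \<sigma>
  have w_app: "w p \<sigma> i q (\<psi>, \<tau>) = oper NC i k \<psi> q (act (space_at NC k) q n (compose {..q} \<sigma> \<tau>) E)"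
    if "\<psi> \<in> Delta i k" "\<tau> \<in> Delta q p" for p \<sigma> i q \<psi> \<tau>
    using that by (simp add: w_def)
  have Est: "act (space_at NC k) q n (compose {..q} \<sigma> \<tau>) E \<in> cel k q" if "\<sigma> \<in> Delta p n" "\<tau> \<in> Delta q p" for \<sigma> \<tau> p q
    by (rule act_in_cel[OF E Delta_compose[OF that(2,1)]])
  have "simplicial_map (std_simplex n) (map_space (rep_F k) NC) w"
    unfolding simplicial_map_def std_simplex_cells std_simplex_act
  proof (intro conjI allI ballI funcsetI)
    fix p \<sigma> assume \<sigma>: "\<sigma> \<in> Delta p n"
    show "w p \<sigma> \<in> cells (map_space (rep_F k) NC) p"
      unfolding map_space_cells[OF F]
    proof (intro conjI allI ballI)
      show "w p \<sigma> i q \<in> extensional (Delta i k \<times> Delta q p)" for i q by (simp add: w_def)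
      show "w p \<sigma> i q (\<psi>, \<tau>) \<in> cel i q" if "\<psi> \<in> Delta i k" "\<tau> \<in> Delta q p" for i q \<psi> \<tau>
        unfolding w_app[OF that] by (rule oper_in_cel[OF Est[OF \<sigma> that(2)] that(1)])
      show "w p \<sigma> i l (\<psi>, compose {..l} \<tau> \<kappa>) = act (space_at NC i) l q \<kappa> (w p \<sigma> i q (\<psi>, \<tau>))"
        if "\<kappa> \<in> Delta l q" "\<psi> \<in> Delta i k" "\<tau> \<in> Delta q p" for i l q \<kappa> \<psi> \<tau>
        using that w_app[OF that(2,3)] w_app[OF that(2) Delta_compose[OF that(1,3)]]
          oper_act[OF that(2,1) Est[OF \<sigma> that(3)]] act_compose[OF E that(1) Delta_compose[OF that(3) \<sigma>]]
          compose_assoc_Delta[OF that(1,3), of \<sigma>] by simp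
      show "w p \<sigma> m q (compose {..m} \<psi> \<theta>, \<tau>) = oper NC m i \<theta> q (w p \<sigma> i q (\<psi>, \<tau>))"
        if "\<theta> \<in> Delta m i" "\<psi> \<in> Delta i k" "\<tau> \<in> Delta q p" for m i q \<theta> \<psi> \<tau>
        using w_app[OF that(2,3)] w_app[OF Delta_compose[OF that(1,2)] that(3)]
          oper_compose[OF Est[OF \<sigma> that(3)] that(1,2)] by simp
    qed
    fix m \<theta> assume \<theta>: "\<theta> \<in> Delta m p"
    show "w m (compose {..m} \<sigma> \<theta>) = act (map_space (rep_F k) NC) m p \<theta> (w p \<sigma>)"
      unfolding map_space_act[OF F]
      by (intro ext) (auto simp: w_def restrict_def Delta_compose[OF _ \<theta>] compose_assoc_Delta[OF _ \<theta>])
  qed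
  moreover have "w p \<sigma> = u p \<sigma>" if \<sigma>: "\<sigma> \<in> cells (horn n r) p" for p \<sigma>
  proof (intro ext)
    fix i q z
    show "w p \<sigma> i q z = u p \<sigma> i q z"
    proof (cases "z \<in> Delta i k \<times> Delta q p")
      case True
      then obtain \<psi> \<tau> where z: "z = (\<psi>, \<tau>)" "\<psi> \<in> Delta i k" "\<tau> \<in> Delta q p" by blast
      then show ?thesis
        using uU[OF \<sigma> z(2,3)] w_app[OF z(2,3)] act_compose[OF E z(3) horn_D[OF \<sigma>]] E_U[OF \<sigma>] by simp
    next
      case False
      have "u p \<sigma> i q \<in> extensional (Delta i k \<times> Delta q p)" using u'[OF \<sigma>] by blast
      from extensional_arb[OF this False] show ?thesis using False by (simp add: w_def restrict_def)
    qed
  qed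
  moreover have "map_restrict (rep_F_dot k) p (w p \<sigma>) = v p \<sigma>" if \<sigma>: "\<sigma> \<in> Delta p n" for p \<sigma>
    unfolding map_restrict_eq[OF F']
  proof (intro ext)
    fix i q z
    show "restrict (w p \<sigma> i q) (nonsurjections k i \<times> Delta q p) z = v p \<sigma> i q z"
    proof (cases "z \<in> nonsurjections k i \<times> Delta q p")
      case True
      then obtain \<psi> \<tau> where z: "z = (\<psi>, \<tau>)" "\<psi> \<in> nonsurjections k i" "\<tau> \<in> Delta q p" by blast
      then show ?thesis
        using vV[OF \<sigma> z(2,3)] w_app[OF ns_D[OF z(2)] z(3)] E_V[OF z(2)]
          oper_act[OF ns_D[OF z(2)] Delta_compose[OF z(3) \<sigma>] E] by simp
    next
      case False
      have "v p \<sigma> i q \<in> extensional (nonsurjections k i \<times> Delta q p)" using v'[OF \<sigma>] by blast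
      from extensional_arb[OF this False] show ?thesis using False by (simp add: restrict_def)
    qed
  qed
  ultimately show "\<exists>w. simplicial_map (std_simplex n) (map_space (rep_F k) NC) w \<and>
     (\<forall>m. \<forall>\<sigma>\<in>cells (horn n r) m. w m \<sigma> = u m \<sigma>) \<and>
     (\<forall>m. \<forall>\<sigma>\<in>cells (std_simplex n) m. map_restrict (rep_F_dot k) m (w m \<sigma>) = v m \<sigma>)"
    unfolding std_simplex_cells by blast
qed

end

theorem proposition6p1:
  fixes C :: "('o, 'm) cat"
  assumes "small_category C"
  shows "complete_segal_space (classifying_diagram C)"
proof -
  interpret small_category C by (rule assms)
  show ?thesis
    unfolding complete_segal_space_def segal_space_def
    using simplicial_space_NC reedy_fibrant_NC segal_map_weak_equivalence degen_weak_equivalence by simp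
qed

end
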